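(* Let $\xi$ be a Sturmian number. Assume that the partial quotients of its slope are ultimately bounded from above by an integer $M$. Then there exists a positive real number $\kappa$, depending only on $M$, such that $$w_d^*(\xi)\le(2d)^{\kappa\log\log(3d)}\qquad\text{for all } d\ge1.$$
   Context: For $\theta\in(0,1)$ irrational and $\rho\in[0,1)$, the lower and upper Sturmian words of slope $\theta$ and intercept $\rho$ are $s_1s_2\cdots$ and $s'_1s'_2\cdots$, where $s_n=\lfloor n\theta+\rho\rfloor-\lfloor(n-1)\theta+\rho\rfloor$ and $s'_n=\lceil n\theta+\rho\rceil-\lceil(n-1)\theta+\rho\rceil$. A Sturmian number (of slope $\theta$) is a real number $\sum_{n\ge1}x_nb^{-n}$, for some integer $b\ge2$, whose $b$-ary digit sequence $x_1x_2\cdots$ is obtained from a lower or upper Sturmian word of slope $\theta$ by replacing the letters $0,1$ by two distinct digits in $\{0,\dots,b-1\}$; the slope of the Sturmian number is $\theta$, with continued fraction $\theta=[0;a_1,a_2,\dots]$. For a transcendental real $\zeta$ and an integer $d\ge1$, $w_d^*(\zeta)$ is the supremum of the real $w$ such that $0<|\zeta-\alpha|<H(\alpha)^{-w-1}$ has infinitely many solutions in real algebraic numbers $\alpha$ of degree at most $d$, where $H(\alpha)$ is the naive height (maximum absolute value of the coefficients) of the minimal polynomial of $\alpha$ over $\mathbb{Z}$. *)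

theory Defs
  imports "HOL-Analysis.Analysis" "HOL-Computational_Algebra.Computational_Algebra"
begin

definition lower_sturmian :: "real \<Rightarrow> real \<Rightarrow> nat \<Rightarrow> int" where
  "lower_sturmian \<theta> \<rho> n = \<lfloor>real n * \<theta> + \<rho>\<rfloor> - \<lfloor>(real n - 1) * \<theta> + \<rho>\<rfloor>"

definition upper_sturmian :: "real \<Rightarrow> real \<Rightarrow> nat \<Rightarrow> int" where
  "upper_sturmian \<theta> \<rho> n = \<lceil>real n * \<theta> + \<rho>\<rceil> - \<lceil>(real n - 1) * \<theta> + \<rho>\<rceil>"

lemma lower_sturmian_letters:
  assumes "0 < \<theta>" "\<theta> < 1"
  shows "lower_sturmian \<theta> \<rho> n \<in> {0, 1}"
proof -
  have "real n * \<theta> + \<rho> = (real n - 1) * \<theta> + \<rho> + \<theta>" by (simp add: algebra_simps)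
  then show ?thesis unfolding lower_sturmian_def using assms by auto linarith
qed

lemma upper_sturmian_letters:
  assumes "0 < \<theta>" "\<theta> < 1"
  shows "upper_sturmian \<theta> \<rho> n \<in> {0, 1}"
proof -
  have "real n * \<theta> + \<rho> = (real n - 1) * \<theta> + \<rho> + \<theta>" by (simp add: algebra_simps)
  then show ?thesis unfolding upper_sturmian_def using assms by auto linarith
qed

text \<open>Words are indexed from \<open>1\<close>; the letters \<open>0\<close> and \<open>1\<close> are replaced by the digits
  \<open>u\<close> and \<open>v\<close> respectively.\<close>

definition sturmian_number :: "real \<Rightarrow> real \<Rightarrow> bool" where
  "sturmian_number \<theta> \<xi> \<longleftrightarrow> 0 < \<theta> \<and> \<theta> < 1 \<and> \<theta> \<notin> \<rat> \<and>
     (\<exists>(b::nat) (u::nat) (v::nat) \<rho> s.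
        2 \<le> b \<and> u < b \<and> v < b \<and> u \<noteq> v \<and> 0 \<le> \<rho> \<and> \<rho> < 1 \<and>
        (s = lower_sturmian \<theta> \<rho> \<or> s = upper_sturmian \<theta> \<rho>) \<and>
        (\<lambda>n. real (if s (Suc n) = 0 then u else v) / real b ^ Suc n) sums \<xi>)"

text \<open>For irrational \<open>\<theta>\<close> in \<open>(0,1)\<close>, \<open>cf_tail \<theta> n = [0; a\<^bsub>n+1\<^esub>, a\<^bsub>n+2\<^esub>, \<dots>]\<close> is the \<open>n\<close>-th
  iterate of the Gauss map, and \<open>partial_quotient \<theta> n = a\<^bsub>n\<^esub>\<close> for \<open>n \<ge> 1\<close>.\<close>

definition cf_tail :: "real \<Rightarrow> nat \<Rightarrow> real" where
  "cf_tail \<theta> n = ((\<lambda>x. frac (1 / x)) ^^ n) \<theta>"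

definition partial_quotient :: "real \<Rightarrow> nat \<Rightarrow> int" where
  "partial_quotient \<theta> n = (if n = 0 then \<lfloor>\<theta>\<rfloor> else \<lfloor>1 / cf_tail \<theta> (n - 1)\<rfloor>)"

text \<open>Irreducibility in \<open>\<int>[X]\<close> includes primitivity.\<close>

definition is_int_minpoly :: "int poly \<Rightarrow> real \<Rightarrow> bool" where
  "is_int_minpoly p \<alpha> \<longleftrightarrow>
     irreducible p \<and> lead_coeff p > 0 \<and> poly (map_poly of_int p) \<alpha> = 0"

definition int_minpoly :: "real \<Rightarrow> int poly" where
  "int_minpoly \<alpha> = (THE p. is_int_minpoly p \<alpha>)"

definition alg_degree :: "real \<Rightarrow> nat" where
  "alg_degree \<alpha> = degree (int_minpoly \<alpha>)"

definition naive_height :: "real \<Rightarrow> int" where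
  "naive_height \<alpha> = (MAX i\<in>{..degree (int_minpoly \<alpha>)}. \<bar>coeff (int_minpoly \<alpha>) i\<bar>)"

text \<open>The supremum is taken in the extended reals since it may be infinite.\<close>

definition wstar :: "nat \<Rightarrow> real \<Rightarrow> ereal" where
  "wstar d \<zeta> = Sup {ereal w | w.
     infinite {\<alpha>::real. algebraic \<alpha> \<and> alg_degree \<alpha> \<le> d \<and>
       0 < \<bar>\<zeta> - \<alpha>\<bar> \<and> \<bar>\<zeta> - \<alpha>\<bar> < real_of_int (naive_height \<alpha>) powr (- w - 1)}}"

lemma ipoly_mult:
  "poly (map_poly of_int (p * q)) (x::real) = poly (map_poly of_int p) x * poly (map_poly of_int q) x"
proof -
  have "map_poly of_int (p * q) = (map_poly of_int p * map_poly of_int q :: real poly)"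
    by (rule poly_eqI) (simp add: coeff_map_poly coeff_mult)
  then show ?thesis by simp
qed

lemma ipoly_add:
  "poly (map_poly of_int (p + q)) (x::real) = poly (map_poly of_int p) x + poly (map_poly of_int q) x"
proof -
  have "map_poly of_int (p + q) = (map_poly of_int p + map_poly of_int q :: real poly)"
    by (rule poly_eqI) (simp add: coeff_map_poly)
  then show ?thesis by simp
qed

lemma ipoly_prime_factor:
  "p \<noteq> 0 \<Longrightarrow> poly (map_poly of_int p) (\<alpha>::real) = 0 \<Longrightarrow>
    \<exists>q. prime q \<and> q dvd p \<and> poly (map_poly of_int q) \<alpha> = 0"
proof (induction p rule: prime_divisors_induct)
  case zero
  then show ?case by simp
next
  case (unit x)
  from unit(1) obtain y where "x * y = 1" by (metis dvdE)
  with ipoly_mult[of x y \<alpha>] unit show ?case by (simp add: map_poly_1)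
next
  case (factor p x)
  show ?case
  proof (cases "poly (map_poly of_int p) \<alpha> = 0")
    case True
    with factor show ?thesis by auto
  next
    case False
    with factor ipoly_mult[of p x \<alpha>] obtain q
      where "prime q" "q dvd x" "poly (map_poly of_int q) \<alpha> = 0" by auto
    then show ?thesis by auto
  qed
qed

lemma is_int_minpoly_ex1:
  assumes "algebraic \<alpha>"
  shows "\<exists>!p. is_int_minpoly p \<alpha>"
proof -
  define S where "S p \<longleftrightarrow> p \<noteq> 0 \<and> poly (map_poly of_int p) \<alpha> = 0" for p :: "int poly"
  obtain p0 where "S p0" using algebraicE'[OF assms] unfolding S_def by blast
  then obtain p1 where p1: "S p1" "\<And>q. S q \<Longrightarrow> degree p1 \<le> degree q"
    using ex_has_least_nat[of S p0 degree] by blast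
  obtain p where p: "prime p" "p dvd p1" "poly (map_poly of_int p) \<alpha> = 0"
    using ipoly_prime_factor p1(1) unfolding S_def by blast
  have le: "degree p \<le> degree q" if "S q" for q
    using dvd_imp_degree_le[OF p(2)] p1 that unfolding S_def by (meson order_trans)
  have p0: "p \<noteq> 0" using p(1) by auto
  have deg: "degree p \<noteq> 0"
  proof
    assume "degree p = 0"
    then obtain c where "p = [:c:]" by (rule degree_eq_zeroE)
    with p(3) p0 show False by (simp add: map_poly_pCons)
  qed
  have dvd: "p dvd q" if q: "poly (map_poly of_int q) \<alpha> = 0" for q
  proof -
    obtain s r where sr: "pseudo_divmod q p = (s, r)" by fastforce
    define c where "c = coeff p (degree p) ^ (Suc (degree q) - degree p)"
    have eq: "[:c:] * q = p * s + r" and r: "r = 0 \<or> degree r < degree p"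
      using pseudo_divmod[OF p0 sr] by (auto simp: c_def)
    have "poly (map_poly of_int r) \<alpha> = 0"
      using arg_cong[OF eq, of "\<lambda>f. poly (map_poly of_int f) \<alpha>"] q p(3)
      by (simp only: ipoly_add ipoly_mult)
    then have "r = 0" using r le[of r] unfolding S_def by force
    then have "p dvd [:c:] * q" using eq by simp
    then consider "p dvd [:c:]" | "p dvd q" using p(1) prime_dvd_mult_iff by blast
    then show ?thesis
    proof cases
      case 1
      have "[:c:] \<noteq> 0" using p0 by (simp add: c_def)
      from dvd_imp_degree_le[OF 1 this] deg show ?thesis by simp
    qed
  qed
  have norm_pos: "normalize f = f \<longleftrightarrow> lead_coeff f > 0" if "f \<noteq> 0" for f :: "int poly"
  proof -
    have "normalize f = f \<longleftrightarrow> unit_factor f = 1"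
      using that by (metis is_unit_normalize mult_cancel_right1 unit_factor_mult_normalize normalize_eq_0_iff)
    also have "\<dots> \<longleftrightarrow> sgn (lead_coeff f) = 1"
      by (simp add: unit_factor_poly_def monom_0 one_pCons)
    also have "\<dots> \<longleftrightarrow> lead_coeff f > 0" by (simp add: sgn_if)
    finally show ?thesis .
  qed
  show ?thesis
  proof
    show "is_int_minpoly p \<alpha>"
      unfolding is_int_minpoly_def
      using p p0 norm_pos by (auto intro: prime_elem_imp_irreducible simp: prime_def)
  next
    fix q assume q: "is_int_minpoly q \<alpha>"
    then have "p dvd q" using dvd by (simp add: is_int_minpoly_def)
    moreover have "\<not> p dvd 1" using p(1) by (auto simp: prime_def)
    ultimately have "q dvd p" using q unfolding is_int_minpoly_def
      by (meson irreducibleD')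
    with \<open>p dvd q\<close> have "normalize p = normalize q" by (rule associatedI)
    moreover have "q \<noteq> 0" using q by (auto simp: is_int_minpoly_def)
    then have "normalize q = q" using norm_pos q by (simp add: is_int_minpoly_def)
    moreover have "normalize p = p" using p(1) by (simp add: prime_def)
    ultimately show "q = p" by simp
  qed
qed

lemma is_int_minpoly_int_minpoly: "algebraic \<alpha> \<Longrightarrow> is_int_minpoly (int_minpoly \<alpha>) \<alpha>"
  unfolding int_minpoly_def by (rule theI') (rule is_int_minpoly_ex1)

end

theory Submission
  imports Defs "Subresultants.Subresultant_Gcd" "HOL-Computational_Algebra.Field_as_Ring"
begin

text \<open>Mahler's method in two variables. A Sturmian word is desubstituted again and again; the
  \<open>k\<close>-th desubstituted word \<open>w\<close> has the generating function \<open>F(x, y)\<close>, the sum over the positions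
  of the letter \<open>1\<close> of \<open>x\<close> and \<open>y\<close> raised to the numbers of letters \<open>0\<close> and \<open>1\<close> that precede, and \<open>\<xi>\<close>
  is a rational linear function of \<open>F(b\<^bsup>-q\<^esup>, b\<^bsup>-q'\<^esup>)\<close>, where \<open>q, q'\<close> are the lengths of the \<open>k\<close>-fold
  images of the letters. The pigeonhole principle gives a polynomial
  \<open>P(x, y, t)\<close> of degree at most \<open>n\<^sup>2\<close> in each variable for which \<open>P(x, y, F(x, y))\<close> vanishes to order \<open>n\<^sup>3\<close>.
  With \<open>n\<close> a suitable multiple of \<open>3d + 4\<close> this beats Liouville's inequality for an algebraic number \<open>\<alpha>\<close> of
  degree at most \<open>d\<close> and height about \<open>b\<^bsup>q\<^esup>\<close> unless the \<open>k\<close>-th auxiliary polynomial vanishes at \<open>\<alpha>\<close>.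

  It cannot vanish at \<open>\<alpha>\<close> both for \<open>k\<close> and for \<open>k + m\<close>, where \<open>m\<close> is a multiple of \<open>log d\<close>. Otherwise the
  resultant of the two polynomials would be a polynomial in \<open>x, y\<close> with a zero
  at \<open>(b\<^bsup>-q\<^esup>, b\<^bsup>-q'\<^esup>)\<close>, hence zero, and they would have a common factor. Evaluating its
  homogenisation at a suitable vector gives a polynomial that vanishes at \<open>(1, 1)\<close> and whose Newton
  polygon is small both in \<open>x, y\<close> and in the monomials to which \<open>m\<close> further desubstitutions lead. As
  the partial quotients are bounded, only monomials have this property. The resulting bound is a power
  of \<open>2d\<close> whose exponent depends on \<open>M\<close> only.\<close>

section \<open>Resultants and Liouville's inequality\<close>

text \<open>With degrees up to n^2 in three variables there are more than n^6 coefficients for the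
  n^6 conditions that give order n^3. The order exceeds the degree by a factor n, which is a
  multiple of 3d + 4 since Liouville's inequality raises the coefficients of the auxiliary
  polynomial to the power d. A further factor \<open>R + 2\<close> in n pays for q and q' being
  comparable only up to that factor. The obstacle is uniformity in k. A nonzero resultant in x, y is
  nonzero at the k-th point only for large k, with a threshold depending on the resultant, so only
  finitely many resultants may occur. This is why polynomials are attached to prefixes and why m
  steps are recorded by their finitely many types. The vanishing of the auxiliary polynomial at t is
  a homogeneous condition on a vector (f, g), for which two charts, g = 1 and f + g = 1, suffice.
  Sizes halve or double in each block of \<open>R\<close> steps, so about log n blocks separate the
  two Newton polygons. As q + q' at most doubles per step, passing from k to k + m multiplies the
  exponent by at most 2^m, a power of d.\<close>

no_notation fps_nth (infixl "$" 75)
no_notation Finite_Cartesian_Product.vec_nth (infixl "$" 90)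

text \<open>Cramer's rule without division: apply adj(A) A = det(A) I to \<open>v\<close> and read
  the entry \<open>k\<close>, where \<open>v\<close> is 1.\<close>

lemma det_eq_cofactor_mult_vec:
  fixes A :: "'a::comm_ring_1 Matrix.mat" and v :: "'a Matrix.vec"
  assumes A: "A \<in> carrier_mat N N" and v: "v \<in> carrier_vec N" and k: "k < N" and "v $ k = 1"
  shows "Determinant.det A = (\<Sum>i<N. cofactor A i k * (A *\<^sub>v v) $ i)"
proof -
  note adj = adj_mat[OF A]
  have "Determinant.det A = (Determinant.det A \<cdot>\<^sub>m 1\<^sub>m N *\<^sub>v v) $ k"
  proof -
    have "(Determinant.det A \<cdot>\<^sub>m 1\<^sub>m N *\<^sub>v v) $ k
      = (\<Sum>i<N. Determinant.det A * (if i = k then 1 else 0) * v $ i)"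
      using assms by (simp add: scalar_prod_def atLeast0LessThan)
    also have "\<dots> = (\<Sum>i<N. if i = k then Determinant.det A * v $ i else 0)"
      by (rule sum.cong) auto
    finally show ?thesis using assms by simp
  qed
  also have "\<dots> = (adj_mat A * A *\<^sub>v v) $ k" using adj by simp
  also have "\<dots> = (adj_mat A *\<^sub>v (A *\<^sub>v v)) $ k"
    by (subst assoc_mult_mat_vec[OF adj(1) A v]) simp
  also have "\<dots> = (\<Sum>i<N. cofactor A i k * (A *\<^sub>v v) $ i)"
    using adj A v k by (auto simp: scalar_prod_def adj_mat_def atLeast0LessThan intro!: sum.cong)
  finally show ?thesis .
qed

lemma abs_det_le:
  fixes A :: "real Matrix.mat"
  assumes A: "A \<in> carrier_mat N N" and r: "\<And>i j. i < N \<Longrightarrow> j < N \<Longrightarrow> \<bar>A $$ (i, j)\<bar> \<le> r i"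
  shows "\<bar>Determinant.det A\<bar> \<le> fact N * (\<Prod>i<N. r i)"
proof -
  have "\<bar>Determinant.det A\<bar> \<le> (\<Sum>p\<in>{p. p permutes {0..<N}}. \<bar>signof p * (\<Prod>i = 0..<N. A $$ (i, p i))\<bar>)"
    unfolding det_def'[OF A] by (rule sum_abs)
  also have "\<dots> \<le> (\<Sum>p\<in>{p. p permutes {0..<N}}. (\<Prod>i<N. r i))"
  proof (rule sum_mono)
    fix p assume p: "p \<in> {p. p permutes {0..<N}}"
    have "\<bar>signof p * (\<Prod>i = 0..<N. A $$ (i, p i))\<bar> = (\<Prod>i<N. \<bar>A $$ (i, p i)\<bar>)"
      by (simp add: abs_mult abs_prod sign_def atLeast0LessThan)
    also have "\<dots> \<le> (\<Prod>i<N. r i)"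
      using p permutes_in_image[of p "{0..<N}"] by (intro prod_mono) (auto intro!: r)
    finally show "\<bar>signof p * (\<Prod>i = 0..<N. A $$ (i, p i))\<bar> \<le> (\<Prod>i<N. r i)" .
  qed
  also have "\<dots> = fact N * (\<Prod>i<N. r i)"
    by (simp add: card_permutations[of "{0..<N}" N])
  finally show ?thesis .
qed

lemma abs_cofactor_le:
  fixes A :: "real Matrix.mat"
  assumes A: "A \<in> carrier_mat N N" and r: "\<And>i j. i < N \<Longrightarrow> j < N \<Longrightarrow> \<bar>A $$ (i, j)\<bar> \<le> r i"
    and r1: "\<And>i. 1 \<le> r i" and "i < N" "k < N"
  shows "\<bar>cofactor A i k\<bar> \<le> fact N * (\<Prod>i<N. r i)"
proof -
  \<comment> \<open>\<open>s\<close> enumerates the rows other than \<open>i\<close>; the factor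
    \<open>r i\<close> of the deleted row can be restored because it is at least 1.\<close>
  define s where "s j = (if j < i then j else Suc j)" for j
  have d: "mat_delete A i k \<in> carrier_mat (N - 1) (N - 1)" using mat_delete_carrier[OF A] .
  have "\<bar>cofactor A i k\<bar> = \<bar>Determinant.det (mat_delete A i k)\<bar>"
    by (simp add: cofactor_def abs_mult)
  also have "\<dots> \<le> fact (N - 1) * (\<Prod>j<N - 1. r (s j))"
    by (rule abs_det_le[OF d]) (use A assms in \<open>auto simp: mat_delete_def s_def intro!: r\<close>)
  also have "(\<Prod>j<N - 1. r (s j)) = (\<Prod>j\<in>s ` {..<N-1}. r j)"
    by (subst prod.reindex) (auto simp: inj_on_def s_def split: if_splits)
  also have "\<dots> \<le> (\<Prod>j<N. r j)"
    using assms(4) r1 by (intro prod_mono2) (auto simp: s_def intro: order_trans[OF zero_le_one])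
  finally have "\<bar>cofactor A i k\<bar> \<le> fact (N - 1) * (\<Prod>j<N. r j)"
    by simp
  also have "\<dots> \<le> fact N * (\<Prod>j<N. r j)"
    using r1 by (intro mult_right_mono prod_nonneg fact_mono) (auto intro: order_trans[OF zero_le_one])
  finally show ?thesis .
qed

text \<open>Descending powers, in the order in which the rows of the Sylvester matrix list
  coefficients. The last entry is 1, as \<open>det_eq_cofactor_mult_vec\<close> requires.\<close>

definition power_vec :: "nat \<Rightarrow> 'a::comm_ring_1 \<Rightarrow> 'a Matrix.vec" where
  "power_vec N x = Matrix.vec N (\<lambda>j. x ^ (N - 1 - j))"

lemma sum_shifted_coeffs:
  fixes p :: "'a::comm_ring_1 poly"
  assumes "degree p \<le> m" "i + m < N"
  shows "(\<Sum>j<N. (if i \<le> j \<and> j - i \<le> m then coeff p (m + i - j) else 0) * x ^ (N - 1 - j))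
    = x ^ (N - 1 - i - m) * poly p x"
proof -
  have "(\<Sum>j<N. (if i \<le> j \<and> j - i \<le> m then coeff p (m + i - j) else 0) * x ^ (N - 1 - j))
     = (\<Sum>j\<in>{i..i+m}. coeff p (m + i - j) * x ^ (N - 1 - j))"
    by (rule sum.mono_neutral_cong_right) (use assms in auto)
  also have "\<dots> = (\<Sum>k\<le>m. coeff p k * x ^ (N - 1 - i - m + k))"
    by (rule sum.reindex_bij_witness[of _ "\<lambda>k. m + i - k" "\<lambda>j. m + i - j"])
      (use assms in \<open>auto intro!: arg_cong[where f="\<lambda>e. _ * x ^ e"]\<close>)
  also have "\<dots> = x ^ (N - 1 - i - m) * (\<Sum>k\<le>m. coeff p k * x ^ k)"
    by (simp add: sum_distrib_left power_add mult_ac)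
  also have "(\<Sum>k\<le>m. coeff p k * x ^ k) = poly p x"
    unfolding poly_altdef
    by (rule sum.mono_neutral_right) (use assms in \<open>auto simp: coeff_eq_0\<close>)
  finally show ?thesis .
qed

lemma sylvester_mat_sub_mult_power_vec:
  fixes p q :: "'a::comm_ring_1 poly"
  assumes "degree p \<le> m" "degree q \<le> n" "i < m + n"
  shows "(sylvester_mat_sub m n p q *\<^sub>v power_vec (m + n) x) $ i =
    (if i < n then x ^ (n - 1 - i) * poly p x else x ^ (m + n - 1 - i) * poly q x)"
proof -
  have "(sylvester_mat_sub m n p q *\<^sub>v power_vec (m + n) x) $ i
    = (\<Sum>j<m+n. sylvester_mat_sub m n p q $$ (i, j) * x ^ (m + n - 1 - j))"
    using assms by (simp add: scalar_prod_def power_vec_def atLeast0LessThan)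
  also have "\<dots> = (if i < n then x ^ (n - 1 - i) * poly p x else x ^ (m + n - 1 - i) * poly q x)"
  proof (cases "i < n")
    case True
    have "(\<Sum>j<m+n. sylvester_mat_sub m n p q $$ (i, j) * x ^ (m + n - 1 - j))
      = (\<Sum>j<m+n. (if i \<le> j \<and> j - i \<le> m then coeff p (m + i - j) else 0) * x ^ (m + n - 1 - j))"
      by (rule sum.cong) (use True assms in \<open>auto simp: sylvester_mat_sub_index\<close>)
    then show ?thesis using sum_shifted_coeffs[of p m i "m + n" x] assms True by simp
  next
    case False
    have "(\<Sum>j<m+n. sylvester_mat_sub m n p q $$ (i, j) * x ^ (m + n - 1 - j))
      = (\<Sum>j<m+n. (if i - n \<le> j \<and> j - (i - n) \<le> n then coeff q (n + (i - n) - j) else 0) * x ^ (m + n - 1 - j))"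
      by (rule sum.cong) (use False assms in \<open>auto simp: sylvester_mat_sub_index\<close>)
    then show ?thesis using sum_shifted_coeffs[of q n "i - n" "m + n" x] assms False
      by simp
  qed
  finally show ?thesis .
qed

text \<open>Makes explicit that the resultant lies in the ideal generated by the two values at
  \<open>x\<close>, with cofactors of the last column as multipliers. The formal degrees
  \<open>m\<close>, \<open>n\<close> may exceed the true ones, so the identity survives
  specialisations that lower a degree.\<close>

lemma resultant_sub_eq_combination:
  fixes p q :: "'a::comm_ring_1 poly"
  assumes "degree p \<le> m" "degree q \<le> n" "0 < m + n"
  shows "resultant_sub m n p q = (\<Sum>i<m+n. cofactor (sylvester_mat_sub m n p q) i (m + n - 1) *
    (if i < n then x ^ (n - 1 - i) * poly p x else x ^ (m + n - 1 - i) * poly q x))"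
proof -
  have "resultant_sub m n p q = (\<Sum>i<m+n. cofactor (sylvester_mat_sub m n p q) i (m + n - 1) *
    (sylvester_mat_sub m n p q *\<^sub>v power_vec (m + n) x) $ i)"
    unfolding resultant_sub_def
    by (rule det_eq_cofactor_mult_vec) (use assms in \<open>auto simp: power_vec_def\<close>)
  also have "\<dots> = (\<Sum>i<m+n. cofactor (sylvester_mat_sub m n p q) i (m + n - 1) *
    (if i < n then x ^ (n - 1 - i) * poly p x else x ^ (m + n - 1 - i) * poly q x))"
    by (rule sum.cong) (use sylvester_mat_sub_mult_power_vec[OF assms(1,2)] in auto)
  finally show ?thesis .
qed

text \<open>As \<open>\<mu>\<close> is irreducible and does not divide \<open>q\<close>, their
  resultant is a nonzero integer. Expanded at \<open>\<alpha>\<close>, the rows of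
  \<open>\<mu>\<close> contribute 0 and all others contain the value of \<open>q\<close>, so that
  value times a bound for the cofactors is at least 1.\<close>

lemma liouville_inequality:
  fixes \<mu> q :: "int poly" and \<alpha> H L :: real
  assumes irr: "irreducible \<mu>" and root: "poly (map_poly of_int \<mu>) \<alpha> = 0"
    and nz: "poly (map_poly of_int q) \<alpha> \<noteq> 0"
    and H: "1 \<le> H" "\<And>i. \<bar>of_int (coeff \<mu> i)\<bar> \<le> H"
    and L: "1 \<le> L" "\<And>i. \<bar>of_int (coeff q i)\<bar> \<le> L"
    and mn: "degree \<mu> \<le> m" "degree q \<le> n" "0 < n"
  shows "1 \<le> \<bar>poly (map_poly of_int q) \<alpha>\<bar> * (real (m + n) * fact (m + n) * (1 + \<bar>\<alpha>\<bar>) ^ (m + n) * H ^ n * L ^ m)"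
proof -
  define d e N where "d = degree \<mu>" and "e = degree q" and "N = d + e"
  define P Q where "P = (map_poly of_int \<mu> :: real poly)" and "Q = (map_poly of_int q :: real poly)"
  have \<mu>0: "\<mu> \<noteq> 0" using irr by auto
  have dpos: "0 < d"
  proof (rule ccontr)
    assume "\<not> 0 < d"
    then obtain c where c: "\<mu> = [:c:]" unfolding d_def by (auto elim: degree_eq_zeroE)
    with root \<mu>0 show False by (simp add: map_poly_pCons)
  qed
  have "\<not> \<mu> dvd q"
    using nz root by (auto simp: ipoly_mult elim!: dvdE)
  moreover have "prime_elem \<mu>" using irr by (rule irreducible_imp_prime_elem_gcd)
  ultimately have "coprime \<mu> q" by (simp add: prime_elem_imp_coprime)
  then have "gcd \<mu> q = 1" by simp
  then have "resultant \<mu> q \<noteq> 0" by (simp add: resultant_0_gcd)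
  then have r1: "1 \<le> \<bar>real_of_int (resultant \<mu> q)\<bar>" by linarith
  define S where "S = sylvester_mat_sub d e P Q"
  have SN: "S \<in> carrier_mat N N" unfolding S_def N_def by (rule sylvester_mat_sub_carrier)
  have "S = map_mat real_of_int (sylvester_mat_sub d e \<mu> q)"
    unfolding S_def P_def Q_def by (rule sylvester_mat_sub_map[symmetric]) simp
  then have detS: "resultant_sub d e P Q = real_of_int (resultant \<mu> q)"
    unfolding resultant_sub_def resultant_def sylvester_mat_def d_def e_def S_def by (simp add: of_int_hom.hom_det)
  have degP: "degree P \<le> d" "degree Q \<le> e"
    unfolding P_def Q_def d_def e_def by (auto intro: degree_map_poly_le)
  define r where "r i = (if i < e then H else L)" for i
  have rS: "\<bar>S $$ (i, j)\<bar> \<le> r i" if "i < N" "j < N" for i j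
    using that H L unfolding S_def N_def r_def
    by (auto simp: sylvester_mat_sub_index P_def Q_def coeff_map_poly)
  have rr1: "1 \<le> r i" for i using H L by (simp add: r_def)
  have prodr: "(\<Prod>i<N. r i) = H ^ e * L ^ d"
  proof -
    have "{..<N} = {..<e} \<union> {e..<N}" unfolding N_def by auto
    then have "(\<Prod>i<N. r i) = (\<Prod>i<e. r i) * (\<Prod>i\<in>{e..<N}. r i)"
      by (simp add: prod.union_disjoint ivl_disj_int)
    also have "\<dots> = H ^ e * L ^ d" by (simp add: r_def N_def)
    finally show ?thesis .
  qed
  have cof: "\<bar>cofactor S i (N - 1)\<bar> \<le> fact N * (H ^ e * L ^ d)" if "i < N" for i
    using abs_cofactor_le[OF SN rS rr1 that, of "N - 1"] that prodr by simp
  have "resultant_sub d e P Q = (\<Sum>i<N. cofactor S i (N - 1) *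
      (if i < e then 0 else \<alpha> ^ (N - 1 - i) * poly Q \<alpha>))"
    using resultant_sub_eq_combination[OF degP, of \<alpha>] dpos root unfolding N_def S_def P_def
    by (simp cong: if_cong)
  then have "\<bar>real_of_int (resultant \<mu> q)\<bar> \<le> (\<Sum>i<N. \<bar>cofactor S i (N - 1) *
      (if i < e then 0 else \<alpha> ^ (N - 1 - i) * poly Q \<alpha>)\<bar>)"
    unfolding detS by (simp only: sum_abs)
  also have "\<dots> \<le> (\<Sum>i<N. (fact N * (H ^ e * L ^ d)) * ((1 + \<bar>\<alpha>\<bar>) ^ N * \<bar>poly Q \<alpha>\<bar>))"
  proof (rule sum_mono)
    fix i assume i: "i \<in> {..<N}"
    have "\<bar>\<alpha>\<bar> ^ (N - 1 - i) \<le> (1 + \<bar>\<alpha>\<bar>) ^ (N - 1 - i)" by (intro power_mono) auto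
    also have "\<dots> \<le> (1 + \<bar>\<alpha>\<bar>) ^ N" by (intro power_increasing) auto
    finally have "\<bar>(if i < e then 0 else \<alpha> ^ (N - 1 - i) * poly Q \<alpha>)\<bar> \<le> (1 + \<bar>\<alpha>\<bar>) ^ N * \<bar>poly Q \<alpha>\<bar>"
      by (auto simp: abs_mult power_abs mult_right_mono)
    then show "\<bar>cofactor S i (N - 1) * (if i < e then 0 else \<alpha> ^ (N - 1 - i) * poly Q \<alpha>)\<bar>
      \<le> (fact N * (H ^ e * L ^ d)) * ((1 + \<bar>\<alpha>\<bar>) ^ N * \<bar>poly Q \<alpha>\<bar>)"
      unfolding abs_mult[of "cofactor S i (N - 1)"] using cof[of i] i H L by (intro mult_mono) auto
  qed
  also have "\<dots> = \<bar>poly Q \<alpha>\<bar> * (real N * fact N * (1 + \<bar>\<alpha>\<bar>) ^ N * H ^ e * L ^ d)"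
    by (simp add: mult_ac)
  also have "\<dots> \<le> \<bar>poly Q \<alpha>\<bar> * (real (m + n) * fact (m + n) * (1 + \<bar>\<alpha>\<bar>) ^ (m + n) * H ^ n * L ^ m)"
  proof -
    have le: "N \<le> m + n" "e \<le> n" "d \<le> m" using mn unfolding N_def d_def e_def by auto
    show ?thesis
      using H L le by (intro mult_left_mono mult_mono power_increasing fact_mono) auto
  qed
  finally show ?thesis using r1 unfolding Q_def by linarith
qed

section \<open>Bivariate polynomials and their supports\<close>

text \<open>The inner variable of a polynomial in \<open>real poly poly\<close> is \<open>x\<close>, the outer one is \<open>y\<close>.\<close>

definition beval :: "real poly poly \<Rightarrow> real \<Rightarrow> real \<Rightarrow> real" where
  "beval r x y = poly (poly r [:y:]) x"

definition bcoeff :: "real poly poly \<Rightarrow> nat \<Rightarrow> nat \<Rightarrow> real" where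
  "bcoeff r i j = coeff (coeff r j) i"

definition bsupp :: "real poly poly \<Rightarrow> (nat \<times> nat) set" where
  "bsupp r = {(i, j). bcoeff r i j \<noteq> 0}"

definition bmonom :: "real \<Rightarrow> nat \<Rightarrow> nat \<Rightarrow> real poly poly" where
  "bmonom c i j = monom (monom c i) j"

lemma beval_simps [simp]:
  "beval 0 x y = 0" "beval 1 x y = 1" "beval (r + s) x y = beval r x y + beval s x y"
  "beval (r - s) x y = beval r x y - beval s x y" "beval (- r) x y = - beval r x y"
  "beval (r * s) x y = beval r x y * beval s x y" "beval (r ^ n) x y = beval r x y ^ n"
  by (simp_all add: beval_def)

lemma beval_sum [simp]: "beval (\<Sum>i\<in>I. f i) x y = (\<Sum>i\<in>I. beval (f i) x y)"
  by (induction I rule: infinite_finite_induct) simp_all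

lemma beval_bmonom [simp]: "beval (bmonom c i j) x y = c * x ^ i * y ^ j"
  by (simp add: beval_def bmonom_def poly_monom)

lemma bcoeff_bmonom: "bcoeff (bmonom c i j) i' j' = (if i = i' \<and> j = j' then c else 0)"
  by (auto simp: bcoeff_def bmonom_def)

lemma bmonom_mult: "bmonom c i j * bmonom c' i' j' = bmonom (c * c') (i + i') (j + j')"
  by (simp add: bmonom_def mult_monom)

lemma bcoeff_sum [simp]: "bcoeff (\<Sum>k\<in>I. f k) i j = (\<Sum>k\<in>I. bcoeff (f k) i j)"
  by (simp add: bcoeff_def coeff_sum)

lemma bcoeff_mult: "bcoeff (r * s) i j = (\<Sum>j'\<le>j. \<Sum>i'\<le>i. bcoeff r i' j' * bcoeff s (i - i') (j - j'))"
  by (simp add: bcoeff_def coeff_mult coeff_sum)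

lemma bcoeff_eqI: "(\<And>i j. bcoeff r i j = bcoeff s i j) \<Longrightarrow> r = s"
  by (intro poly_eqI) (simp add: bcoeff_def)

lemma bsupp_bounds: "bsupp r \<subseteq> {..Max ((\<lambda>j. degree (coeff r j)) ` {..degree r})} \<times> {..degree r}"
proof (clarsimp simp: bsupp_def bcoeff_def)
  fix i j assume nz: "coeff (coeff r j) i \<noteq> 0"
  have j: "j \<le> degree r" using nz by (intro le_degree) auto
  have "i \<le> degree (coeff r j)" using nz by (rule le_degree)
  also have "\<dots> \<le> Max ((\<lambda>j. degree (coeff r j)) ` {..degree r})" using j by (intro Max_ge) auto
  finally show "i \<le> Max ((\<lambda>j. degree (coeff r j)) ` {..degree r}) \<and> j \<le> degree r" using j by simp
qed

lemma finite_bsupp [simp]: "finite (bsupp r)"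
  using bsupp_bounds by (rule finite_subset) simp

lemma bsupp_eq_empty_iff: "bsupp r = {} \<longleftrightarrow> r = 0"
proof
  assume e: "bsupp r = {}"
  show "r = 0"
  proof (rule bcoeff_eqI)
    fix i j
    have "(i, j) \<notin> bsupp r" using e by simp
    then show "bcoeff r i j = bcoeff 0 i j" by (simp add: bsupp_def bcoeff_def)
  qed
qed (auto simp: bsupp_def bcoeff_def)

lemma bpoly_as_sum_bmonom: "r = (\<Sum>(i, j)\<in>bsupp r. bmonom (bcoeff r i j) i j)"
proof (rule bcoeff_eqI)
  fix i j
  have "bcoeff (\<Sum>(i, j)\<in>bsupp r. bmonom (bcoeff r i j) i j) i j
    = (\<Sum>p\<in>bsupp r. if p = (i, j) then bcoeff r i j else 0)"
    unfolding bcoeff_sum case_prod_beta by (rule sum.cong) (auto simp: bcoeff_bmonom)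
  also have "\<dots> = bcoeff r i j" by (simp add: sum.delta) (simp add: bsupp_def)
  finally show "bcoeff r i j = bcoeff (\<Sum>(i, j)\<in>bsupp r. bmonom (bcoeff r i j) i j) i j" by simp
qed

lemma beval_altdef: "beval r x y = (\<Sum>(i, j)\<in>bsupp r. bcoeff r i j * x ^ i * y ^ j)"
  by (subst bpoly_as_sum_bmonom) (simp add: case_prod_beta)

lemma beval_eq_0_imp: assumes "\<And>x y. beval r x y = 0" shows "r = 0"
proof (rule ccontr)
  assume "r \<noteq> 0"
  then have "finite {p. poly r p = 0}" by (rule poly_roots_finite)
  moreover have "poly r [:y:] = 0" for y
    using assms unfolding beval_def by (metis poly_all_0_iff_0)
  then have "range (\<lambda>y. [:y:]) \<subseteq> {p. poly r p = 0}" by auto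
  moreover have "infinite (range (\<lambda>y::real. [:y:]))"
    using finite_imageD[of "\<lambda>y::real. [:y:]" UNIV] by (auto simp: inj_def infinite_UNIV_char_0)
  ultimately show False using finite_subset by blast
qed

text \<open>Without zero divisors an identity needs checking only where \<open>q\<close> does not
  vanish, so one may divide by the value of \<open>q\<close>.\<close>

lemma beval_eqI:
  assumes "q \<noteq> 0" "\<And>x y. beval q x y \<noteq> 0 \<Longrightarrow> beval r x y = beval s x y"
  shows "r = s"
proof -
  have "q * (r - s) = 0" by (rule beval_eq_0_imp) (use assms(2) in auto)
  then show ?thesis using assms(1) by simp
qed

text \<open>Signed digits in base \<open>B\<close>: \<open>p * B + q\<close> has absolute value
  below B^2, so a single integer encodes a lexicographic comparison.\<close>

lemma lex_weight:
  fixes B D p q :: int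
  assumes "\<bar>p\<bar> < B" "\<bar>q\<bar> < B"
  shows "D * B\<^sup>2 + p * B + q \<le> 0 \<Longrightarrow> D \<le> 0"
    and "D * B\<^sup>2 + p * B + q = 0 \<Longrightarrow> D = 0 \<and> p = 0 \<and> q = 0"
proof -
  have *: "E \<le> 0" if "E * B\<^sup>2 + p * B + q \<le> 0" "\<bar>p\<bar> < B" "\<bar>q\<bar> < B" for E p q
  proof (rule ccontr)
    assume "\<not> E \<le> 0"
    then have "1 * B\<^sup>2 \<le> E * B\<^sup>2" by (intro mult_right_mono) auto
    moreover have "(1 - B) * B \<le> p * B" using that by (intro mult_right_mono) auto
    ultimately show False using that by (simp add: power2_eq_square algebra_simps)
  qed
  show "D * B\<^sup>2 + p * B + q \<le> 0 \<Longrightarrow> D \<le> 0" using *[of D p q] assms by simp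
  assume z: "D * B\<^sup>2 + p * B + q = 0"
  have "D \<le> 0" "- D \<le> 0" using *[of D p q] *[of "- D" "- p" "- q"] z assms by auto
  then have D: "D = 0" by simp
  have "p = 0"
  proof (rule ccontr)
    assume "p \<noteq> 0"
    then have "1 * B \<le> \<bar>p\<bar> * B" using assms by (intro mult_right_mono) auto
    also have "\<bar>p\<bar> * B = \<bar>p * B\<bar>" using assms by (simp add: abs_mult)
    also have "\<dots> = \<bar>q\<bar>" using z D by (metis abs_minus_cancel add.right_neutral add_eq_0_iff add_0 mult_zero_left)
    finally show False using assms by simp
  qed
  with z D show "D = 0 \<and> p = 0 \<and> q = 0" by simp
qed

text \<open>The leading monomials of two factors, for the order that compares the weight \<open>a i + b j\<close> and
  breaks ties lexicographically, multiply without cancellation.\<close>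

lemma bsupp_mult_top:
  fixes a b :: int
  assumes "c \<noteq> 0" "d \<noteq> 0"
  defines "w \<equiv> \<lambda>(i, j). a * int i + b * int j"
  shows "\<exists>t\<in>bsupp (c * d). \<forall>s\<in>bsupp c. \<forall>s'\<in>bsupp d. w s + w s' \<le> w t"
proof -
  have "\<exists>B::nat. \<forall>(i, j)\<in>bsupp c \<union> bsupp d. i < B \<and> j < B"
  proof -
    have "finite (fst ` (bsupp c \<union> bsupp d) \<union> snd ` (bsupp c \<union> bsupp d))" by simp
    then obtain B where "\<forall>k\<in>fst ` (bsupp c \<union> bsupp d) \<union> snd ` (bsupp c \<union> bsupp d). k < B"
      using finite_nat_set_iff_bounded by blast
    then have "\<forall>z\<in>bsupp c \<union> bsupp d. fst z < B \<and> snd z < B" by blast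
    then show ?thesis by (intro exI[of _ B]) (simp add: case_prod_beta)
  qed
  then obtain B :: nat where B: "\<And>i j. (i, j) \<in> bsupp c \<union> bsupp d \<Longrightarrow> i < B \<and> j < B" by blast
  define \<kappa> where "\<kappa> s = w s * (int B)\<^sup>2 + int (fst s) * int B + int (snd s)" for s
  have key: "w s \<le> w s'" "\<kappa> s = \<kappa> s' \<Longrightarrow> s = s'"
    if "\<kappa> s \<le> \<kappa> s'" "s \<in> bsupp c \<union> bsupp d" "s' \<in> bsupp c \<union> bsupp d" for s s'
  proof -
    have b: "\<bar>int (fst s) - int (fst s')\<bar> < int B" "\<bar>int (snd s) - int (snd s')\<bar> < int B"
      using B[of "fst s" "snd s"] B[of "fst s'" "snd s'"] that by auto
    have e: "\<kappa> s - \<kappa> s' = (w s - w s') * (int B)\<^sup>2 + (int (fst s) - int (fst s')) * int B + (int (snd s) - int (snd s'))"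
      by (simp add: \<kappa>_def algebra_simps)
    show "w s \<le> w s'" using lex_weight(1)[OF b, of "w s - w s'"] that e by simp
    show "s = s'" if "\<kappa> s = \<kappa> s'" using lex_weight(2)[OF b, of "w s - w s'"] that e
      by (simp add: prod_eq_iff)
  qed
  have ex: "\<exists>m\<in>S. \<forall>s\<in>S. \<kappa> s \<le> \<kappa> m" if "finite S" "S \<noteq> {}" for S
  proof -
    have "Max (\<kappa> ` S) \<in> \<kappa> ` S" using that by (intro Max_in) auto
    then obtain m where "m \<in> S" "\<kappa> m = Max (\<kappa> ` S)" by auto
    then show ?thesis using that by (intro bexI[of _ m]) auto
  qed
  obtain m where m: "m \<in> bsupp c" "\<And>s. s \<in> bsupp c \<Longrightarrow> \<kappa> s \<le> \<kappa> m"
    using ex[of "bsupp c"] assms by (auto simp: bsupp_eq_empty_iff)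
  obtain n where n: "n \<in> bsupp d" "\<And>s. s \<in> bsupp d \<Longrightarrow> \<kappa> s \<le> \<kappa> n"
    using ex[of "bsupp d"] assms by (auto simp: bsupp_eq_empty_iff)
  obtain m1 m2 n1 n2 where mn: "m = (m1, m2)" "n = (n1, n2)" by (meson surj_pair)
  have "bcoeff (c * d) (m1 + n1) (m2 + n2) =
    (\<Sum>(j, i)\<in>{..m2 + n2} \<times> {..m1 + n1}. bcoeff c i j * bcoeff d (m1 + n1 - i) (m2 + n2 - j))"
    by (simp add: bcoeff_mult sum.cartesian_product)
  also have "\<dots> = (\<Sum>(j, i)\<in>{(m2, m1)}. bcoeff c i j * bcoeff d (m1 + n1 - i) (m2 + n2 - j))"
  proof (rule sum.mono_neutral_right)
    show "\<forall>q\<in>{..m2 + n2} \<times> {..m1 + n1} - {(m2, m1)}.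
      (case q of (j, i) \<Rightarrow> bcoeff c i j * bcoeff d (m1 + n1 - i) (m2 + n2 - j)) = 0"
    proof (rule ballI, rule ccontr)
      fix q assume q: "q \<in> {..m2 + n2} \<times> {..m1 + n1} - {(m2, m1)}"
        and nz: "(case q of (j, i) \<Rightarrow> bcoeff c i j * bcoeff d (m1 + n1 - i) (m2 + n2 - j)) \<noteq> 0"
      obtain j i where "q = (j, i)" by (cases q)
      with q nz have ji: "j \<in> {..m2 + n2}" "i \<in> {..m1 + n1}" "(j, i) \<noteq> (m2, m1)"
        and "bcoeff c i j * bcoeff d (m1 + n1 - i) (m2 + n2 - j) \<noteq> 0" by auto
      then have s: "(i, j) \<in> bsupp c" "(m1 + n1 - i, m2 + n2 - j) \<in> bsupp d" by (auto simp: bsupp_def)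
      have le: "\<kappa> (i, j) \<le> \<kappa> m" "\<kappa> (m1 + n1 - i, m2 + n2 - j) \<le> \<kappa> n" using m n s by auto
      have "\<kappa> (i, j) + \<kappa> (m1 + n1 - i, m2 + n2 - j) = \<kappa> m + \<kappa> n"
        using ji by (simp add: \<kappa>_def w_def mn of_nat_diff algebra_simps)
      \<comment> \<open>Two numbers bounded by the maxima, with the sum of the maxima as their sum,
        must both attain them.\<close>
      with le have "\<kappa> (i, j) = \<kappa> m" by linarith
      with key(2)[of "(i, j)" m] s m ji mn show False by auto
    qed
  qed auto
  also have "\<dots> \<noteq> 0" using m n by (simp add: mn bsupp_def)
  finally have t: "(m1 + n1, m2 + n2) \<in> bsupp (c * d)" by (simp add: bsupp_def)
  show ?thesis
  proof (intro bexI[OF _ t] ballI)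
    fix s s' assume "s \<in> bsupp c" "s' \<in> bsupp d"
    then have "w s \<le> w m" "w s' \<le> w n" using m n key(1) by auto
    then show "w s + w s' \<le> w (m1 + n1, m2 + n2)" by (simp add: w_def mn algebra_simps)
  qed
qed

text \<open>The Newton polygon of a product is the Minkowski sum of those of the factors, so in no
  direction is a factor wider than the product. The two ends come from \<open>bsupp_mult_top\<close>
  for (a, b) and (-a, -b).\<close>

lemma bsupp_factor_width:
  fixes a b lo hi :: int
  assumes "c \<noteq> 0" "d \<noteq> 0"
    and bnd: "\<And>i j. (i, j) \<in> bsupp (c * d) \<Longrightarrow> lo \<le> a * int i + b * int j \<and> a * int i + b * int j \<le> hi"
    and s: "(i, j) \<in> bsupp c" "(i', j') \<in> bsupp c"
  shows "a * (int i - int i') + b * (int j - int j') \<le> hi - lo"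
proof -
  obtain k l where kl: "(k, l) \<in> bsupp d" using assms(2) by (auto simp flip: bsupp_eq_empty_iff)
  from bsupp_mult_top[OF assms(1,2), of a b] obtain t
    where t: "t \<in> bsupp (c * d)" "a * int i + b * int j + (a * int k + b * int l) \<le> a * int (fst t) + b * int (snd t)"
    using s kl by (force simp: case_prod_beta)
  from bsupp_mult_top[OF assms(1,2), of "- a" "- b"] obtain t'
    where t': "t' \<in> bsupp (c * d)" "- a * int i' + - b * int j' + (- a * int k + - b * int l) \<le> - a * int (fst t') + - b * int (snd t')"
    using s kl by (force simp: case_prod_beta)
  show ?thesis
    using bnd[of "fst t" "snd t"] bnd[of "fst t'" "snd t'"] t t' by (simp add: algebra_simps)
qed

section \<open>Exponents under iterated substitution\<close>

text \<open>\<open>(p, q, r, s)\<close> stands for the substitution of \<open>x\<^bsup>p\<^esup> y\<^bsup>q\<^esup>\<close> and \<open>x\<^bsup>r\<^esup> y\<^bsup>s\<^esup>\<close> for \<open>x\<close> and \<open>y\<close>.\<close>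

type_synonym expmat = "nat \<times> nat \<times> nat \<times> nat"

fun mstep :: "expmat \<Rightarrow> bool \<Rightarrow> expmat" where
  "mstep (p, q, r, s) e = (if e then (p + r, q + s, r, s) else (p, q, p + r, q + s))"

definition mats :: "bool list \<Rightarrow> expmat" where
  "mats es = foldl mstep (1, 0, 0, 1) es"

text \<open>The effect of the substitutions on a difference of exponents, the last step being applied first.
  While the entries have opposite signs this is the subtractive Euclidean algorithm; as soon as they do
  not, they only grow.\<close>

fun ecl :: "bool list \<Rightarrow> int \<times> int \<Rightarrow> int \<times> int" where
  "ecl [] p = p"
| "ecl (e # es) (a, b) = ecl es (if e then (a, a + b) else (a + b, b))"

lemma mats_snoc: "mats (es @ [e]) = mstep (mats es) e"
  by (simp add: mats_def)

lemma mats_det: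
  assumes "mats es = (p, q, r, s)"
  shows "int p * int s - int q * int r = 1"
  using assms
proof (induction es arbitrary: p q r s rule: rev_induct)
  case Nil
  then show ?case by (auto simp: mats_def)
next
  case (snoc e es)
  obtain p' q' r' s' where m: "mats es = (p', q', r', s')" by (cases "mats es")
  from snoc.IH[OF m] snoc.prems m show ?case
    by (cases e) (auto simp: mats_snoc algebra_simps)
qed

text \<open>Appending a letter multiplies the matrix on the left by an elementary one, so a row
  vector meets the last letter first; hence \<open>rev\<close>.\<close>

lemma ecl_mats:
  assumes "mats es = (p, q, r, s)"
  shows "ecl (rev es) (a, b) = (a * int p + b * int r, a * int q + b * int s)"
  using assms
proof (induction es arbitrary: p q r s a b rule: rev_induct)
  case Nil
  then show ?case by (auto simp: mats_def)
next
  case (snoc e es)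
  obtain p' q' r' s' where m: "mats es = (p', q', r', s')" by (cases "mats es")
  from snoc.IH[OF m] snoc.prems m show ?case
    by (cases e) (auto simp: mats_snoc algebra_simps)
qed

lemma ecl_append: "ecl (xs @ ys) p = ecl ys (ecl xs p)"
  by (induction xs p rule: ecl.induct) auto

lemma ecl_minus: "ecl es (- a, - b) = (- fst (ecl es (a, b)), - snd (ecl es (a, b)))"
proof (induction es arbitrary: a b)
  case (Cons e es)
  show ?case using Cons[of a "a + b"] Cons[of "a + b" b] by (cases e) auto
qed simp

section \<open>Signs and sizes under the Euclidean steps\<close>

definition opp :: "int \<times> int \<Rightarrow> bool" where
  "opp p \<longleftrightarrow> (0 < fst p \<and> snd p < 0) \<or> (fst p < 0 \<and> 0 < snd p)"

definition sz :: "int \<times> int \<Rightarrow> int" where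
  "sz p = \<bar>fst p\<bar> + \<bar>snd p\<bar>"

lemma opp_ecl1: "opp (ecl [e] p) \<Longrightarrow> opp p \<and> sz (ecl [e] p) < sz p"
  by (cases p; cases e) (auto simp: opp_def sz_def)

text \<open>Opposite signs at the end force opposite signs throughout; each step is then a
  subtraction that lowers the integer \<open>sz\<close> by at least 1.\<close>

lemma opp_ecl: "opp (ecl es p) \<Longrightarrow> opp p \<and> sz (ecl es p) + int (length es) \<le> sz p"
proof (induction es arbitrary: p)
  case (Cons e es)
  have "ecl (e # es) p = ecl es (ecl [e] p)" using ecl_append[of "[e]" es p] by simp
  with Cons.prems Cons.IH[of "ecl [e] p"]
  have "opp (ecl [e] p)" "sz (ecl (e # es) p) + int (length es) \<le> sz (ecl [e] p)" by auto
  with opp_ecl1[of e p] show ?case by auto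
qed simp

text \<open>For \<open>e\<close> true the pairs are (a, b), (a, a + b), (2a + b, a + b). Opposite
  signs throughout give the final size |a| and force |a| < |b|.\<close>

lemma opp_ecl_pair: "opp (ecl [e, \<not> e] p) \<Longrightarrow> 2 * sz (ecl [e, \<not> e] p) \<le> sz p"
  by (cases p; cases e) (auto simp: opp_def sz_def)

lemma ex_change:
  assumes "True \<in> set es" "False \<in> set es"
  shows "\<exists>xs e ys. es = xs @ [e, \<not> e] @ ys"
  using assms
proof (induction es)
  case (Cons a es)
  show ?case
  proof (cases "True \<in> set es \<and> False \<in> set es")
    case True
    with Cons obtain xs e ys where "es = xs @ [e, \<not> e] @ ys" by auto
    then show ?thesis by (intro exI[of _ "a # xs"] exI[of _ e] exI[of _ ys]) simp
  next
    case False
    with Cons.prems have "es \<noteq> []" by auto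
    then obtain b ys where b: "es = b # ys" by (cases es) auto
    have "b = (\<not> a)" using False Cons.prems by (cases a; cases b) (auto simp: b)
    with b have "es = (\<not> a) # ys" by simp
    then show ?thesis by (intro exI[of _ "[]"] exI[of _ a] exI[of _ ys]) simp
  qed
qed simp

text \<open>Blocks in which both kinds of step occur. Bounded partial quotients turn every late
  window of a fixed length into such a block.\<close>

definition mixed :: "bool list \<Rightarrow> bool" where
  "mixed es \<longleftrightarrow> True \<in> set es \<and> False \<in> set es"

lemma opp_ecl_mixed:
  assumes "mixed es" "opp (ecl es p)"
  shows "2 * sz (ecl es p) \<le> sz p"
proof -
  obtain xs e ys where es: "es = xs @ [e, \<not> e] @ ys" using ex_change assms(1) unfolding mixed_def by blast
  have 1: "opp (ecl ys (ecl [e, \<not> e] (ecl xs p)))" using assms(2) unfolding es ecl_append .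
  note 2 = opp_ecl[OF 1]
  note 3 = opp_ecl[OF conjunct1[OF 2]]
  note 4 = opp_ecl[OF conjunct1[OF 3]]
  have "2 * sz (ecl [e, \<not> e] (ecl xs p)) \<le> sz (ecl xs p)" by (rule opp_ecl_pair[OF conjunct1[OF 2]])
  with 2 4 show ?thesis unfolding es ecl_append by linarith
qed

lemma opp_ecl_concat:
  assumes "\<forall>es\<in>set bs. mixed es" "opp (ecl (concat bs) p)"
  shows "opp p \<and> 2 ^ length bs * sz (ecl (concat bs) p) \<le> sz p"
  using assms
proof (induction bs arbitrary: p)
  case (Cons b bs)
  have o: "opp (ecl (concat bs) (ecl b p))" using Cons.prems by (simp add: ecl_append)
  with Cons have IH: "opp (ecl b p)" "2 ^ length bs * sz (ecl (concat bs) (ecl b p)) \<le> sz (ecl b p)" by auto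
  have "2 * sz (ecl b p) \<le> sz p" "opp p" using opp_ecl_mixed[of b p] opp_ecl[OF IH(1)] IH(1) Cons.prems by auto
  with IH(2) show ?case by (simp add: ecl_append)
qed simp

lemma ecl_nonneg:
  assumes "0 \<le> fst p" "0 \<le> snd p"
  shows "fst p \<le> fst (ecl es p) \<and> snd p \<le> snd (ecl es p)"
  using assms
proof (induction es arbitrary: p)
  case (Cons e es)
  obtain a b where p: "p = (a, b)" by (cases p)
  show ?case using Cons.IH[of "if e then (a, a + b) else (a + b, b)"] Cons.prems by (cases e) (auto simp: p)
qed simp

text \<open>The entry changed by a step receives the sum of both entries and never decreases
  afterwards; a mixed block changes each of them.\<close>

lemma ecl_mixed_nonneg:
  assumes "mixed es" "0 \<le> fst p" "0 \<le> snd p"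
  shows "fst p + snd p \<le> fst (ecl es p) \<and> fst p + snd p \<le> snd (ecl es p)"
proof -
  have *: "fst p + snd p \<le> (if e then snd (ecl es p) else fst (ecl es p))" if e: "e \<in> set es" for e
  proof -
    obtain xs ys where es: "es = xs @ [e] @ ys" using split_list[OF e] by auto
    define q where "q = ecl xs p"
    have q: "fst p \<le> fst q" "snd p \<le> snd q" using ecl_nonneg[OF assms(2,3)] by (auto simp: q_def)
    define q' where "q' = ecl [e] q"
    have q': "0 \<le> fst q'" "0 \<le> snd q'" "fst p + snd p \<le> (if e then snd q' else fst q')"
      using q assms by (cases q; cases e; auto simp: q'_def)+
    then show ?thesis using ecl_nonneg[OF q'(1,2), of ys] unfolding es ecl_append q_def q'_def
      by (auto split: if_splits)
  qed
  show ?thesis using *[of True] *[of False] assms(1) by (auto simp: mixed_def)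
qed

lemma ecl_concat_growth:
  assumes "\<forall>es\<in>set bs. mixed es" "k \<le> fst p" "k \<le> snd p" "0 \<le> k"
  shows "2 ^ length bs * k \<le> fst (ecl (concat bs) p) \<and> 2 ^ length bs * k \<le> snd (ecl (concat bs) p)"
  using assms
proof (induction bs arbitrary: p k)
  case (Cons b bs)
  have "2 * k \<le> fst (ecl b p)" "2 * k \<le> snd (ecl b p)" using ecl_mixed_nonneg[of b p] Cons.prems by auto
  from Cons.IH[OF _ this] Cons.prems show ?case by (simp add: ecl_append mult_ac)
qed simp

lemma ecl_eq_0: "ecl es p = (0, 0) \<Longrightarrow> p = (0, 0)"
proof (induction es arbitrary: p)
  case (Cons e es)
  obtain a b where p: "p = (a, b)" by (cases p)
  show ?case using Cons.IH[of "if e then (a, a + b) else (a + b, b)"] Cons.prems by (cases e) (auto simp: p)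
qed simp

text \<open>Were the signs opposite after \<open>n\<close> blocks, \<open>n\<close> halvings would
  have brought the size, at most 2A at first, below 2. So the signs agree, the middle block makes
  both entries at least 1 in absolute value, and the last \<open>n\<close> blocks double them beyond
  \<open>A\<close>.\<close>

lemma ecl_large:
  assumes mix: "\<forall>es\<in>set bs. mixed es" and len: "length bs = n + 1 + n"
    and p: "p \<noteq> (0, 0)" "\<bar>fst p\<bar> \<le> A" "\<bar>snd p\<bar> \<le> A" and A: "A < 2 ^ n"
  shows "A < \<bar>fst (ecl (concat bs) p)\<bar>"
proof -
  define b1 b2 b3 where "b1 = take n bs" and "b2 = bs ! n" and "b3 = drop (Suc n) bs"
  have bs: "bs = b1 @ [b2] @ b3" unfolding b1_def b2_def b3_def using len by (simp add: id_take_nth_drop)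
  have l: "length b1 = n" "length b3 = n" using len by (auto simp: b1_def b3_def)
  define q where "q = ecl (concat b1) p"
  have q0: "q \<noteq> (0, 0)" using p(1) ecl_eq_0 unfolding q_def by blast
  have "\<not> opp q"
  proof
    assume o: "opp q"
    then have "2 ^ n * sz q \<le> sz p" using opp_ecl_concat[of b1 p] mix l bs unfolding q_def by auto
    moreover have "2 \<le> sz q" using o by (auto simp: opp_def sz_def)
    then have "2 ^ n * 2 \<le> 2 ^ n * sz q" by (intro mult_left_mono) auto
    ultimately have "2 ^ n * 2 \<le> sz p" by linarith
    then show False using p A unfolding sz_def by linarith
  qed
  have pos: "A < fst (ecl (concat ([b2] @ b3)) q)" if "0 \<le> fst q" "0 \<le> snd q" "q \<noteq> (0, 0)" for q
  proof -
    have "1 \<le> fst q + snd q" using that by (cases q) auto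
    then have "1 \<le> fst (ecl b2 q)" "1 \<le> snd (ecl b2 q)"
      using ecl_mixed_nonneg[of b2 q] mix that bs by auto
    from ecl_concat_growth[OF _ this, of b3] mix bs l show ?thesis using A by (simp add: ecl_append)
  qed
  have e: "ecl (concat bs) p = ecl (concat ([b2] @ b3)) q" by (simp add: bs ecl_append q_def)
  have "(0 \<le> fst q \<and> 0 \<le> snd q) \<or> (0 \<le> - fst q \<and> 0 \<le> - snd q)"
    using \<open>\<not> opp q\<close> unfolding opp_def by linarith
  then consider "0 \<le> fst q" "0 \<le> snd q" | "0 \<le> - fst q" "0 \<le> - snd q" by blast
  then show ?thesis
  proof cases
    case 1
    then show ?thesis using pos[OF 1 q0] e by simp
  next
    case 2
    then have "A < fst (ecl (concat ([b2] @ b3)) (- fst q, - snd q))"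
      using q0 by (intro pos) (auto simp: prod_eq_iff)
    then show ?thesis using e ecl_minus[of "concat ([b2] @ b3)" "fst q" "snd q"] by simp
  qed
qed

section \<open>Monomial substitutions and common factors\<close>

definition bsub :: "expmat \<Rightarrow> real poly poly \<Rightarrow> real poly poly" where
  "bsub M r = (case M of (p, q, s, t) \<Rightarrow>
     (\<Sum>(i, j)\<in>bsupp r. bmonom (bcoeff r i j) (i * p + j * s) (i * q + j * t)))"

lemma beval_bsub: "beval (bsub (p, q, s, t) r) x y = beval r (x ^ p * y ^ q) (x ^ s * y ^ t)"
  by (auto simp: bsub_def beval_altdef[of r] case_prod_beta power_add power_mult power_mult_distrib
      mult_ac power_commutes intro!: sum.cong)

lemma bsupp_bsub:
  assumes "(k, l) \<in> bsupp (bsub (p, q, s, t) r)"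
  obtains i j where "(i, j) \<in> bsupp r" "k = i * p + j * s" "l = i * q + j * t"
proof -
  have "(\<Sum>(i, j)\<in>bsupp r. bcoeff (bmonom (bcoeff r i j) (i * p + j * s) (i * q + j * t)) k l) \<noteq> 0"
    using assms by (simp add: bsupp_def bsub_def case_prod_beta)
  then obtain z where "z \<in> bsupp r" "(case z of (i, j) \<Rightarrow> bcoeff (bmonom (bcoeff r i j) (i * p + j * s) (i * q + j * t)) k l) \<noteq> 0"
    using sum.not_neutral_contains_not_neutral by blast
  then show ?thesis using that by (cases z) (auto simp: bcoeff_bmonom split: if_splits)
qed

lemma monomial_beval_1_1:
  assumes "bsupp c = {(i, j)}"
  shows "beval c 1 1 \<noteq> 0"
  using assms by (simp add: beval_altdef) (auto simp: bsupp_def)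

text \<open>Let (x, y) be the difference of two exponents of \<open>c\<close>. As \<open>c\<close>
  divides \<open>a0\<close>, |x| is at most \<open>A\<close>; as \<open>c\<close> divides a
  substituted polynomial, the preimage (a, b) of (x, y) under the exponent matrix has entries at
  most \<open>A\<close> too. For (a, b) nonzero, \<open>ecl_large\<close> gives |x| > A. Hence
  \<open>c\<close> is a monomial.\<close>

lemma common_factor_beval_1_1:
  assumes fac: "c * d1 = a0" "c * d2 = bsub (mats (concat bs)) r"
    and nz: "a0 \<noteq> 0" "bsub (mats (concat bs)) r \<noteq> 0"
    and deg: "bsupp a0 \<subseteq> {..A} \<times> {..A}" "bsupp r \<subseteq> {..A} \<times> {..A}"
    and mix: "\<forall>es\<in>set bs. mixed es" and len: "length bs = n + 1 + n" and A: "A < 2 ^ n"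
  shows "beval c 1 1 \<noteq> 0"
proof -
  have c0: "c \<noteq> 0" "d1 \<noteq> 0" "d2 \<noteq> 0" using fac nz by auto
  obtain p q s t where M: "mats (concat bs) = (p, q, s, t)" by (cases "mats (concat bs)")
  have det: "int p * int t - int q * int s = 1" using mats_det[OF M] .
  have uniq: "z = z'" if z: "z \<in> bsupp c" "z' \<in> bsupp c" for z z'
  proof (rule ccontr)
    assume "z \<noteq> z'"
    define x y where "x = int (fst z) - int (fst z')" and "y = int (snd z) - int (snd z')"
    have xy: "(x, y) \<noteq> (0, 0)" using \<open>z \<noteq> z'\<close> by (auto simp: x_def y_def prod_eq_iff)
    have b0: "0 \<le> 1 * int k + 0 * int l \<and> 1 * int k + 0 * int l \<le> int A" if "(k, l) \<in> bsupp (c * d1)" for k l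
      using that deg(1) fac(1) by auto
    have dx: "\<bar>x\<bar> \<le> int A"
      using bsupp_factor_width[OF c0(1,2) b0, of "fst z" "snd z" "fst z'" "snd z'"]
        bsupp_factor_width[OF c0(1,2) b0, of "fst z'" "snd z'" "fst z" "snd z"] z
      by (simp add: x_def)
    have pt: "\<exists>i j. i \<le> A \<and> j \<le> A \<and> k = i * p + j * s \<and> l = i * q + j * t"
      if "(k, l) \<in> bsupp (c * d2)" for k l
    proof -
      from that fac M have "(k, l) \<in> bsupp (bsub (p, q, s, t) r)" by simp
      from bsupp_bsub[OF this] obtain i j where "(i, j) \<in> bsupp r" "k = i * p + j * s" "l = i * q + j * t" by blast
      then show ?thesis using deg(2) by (intro exI[of _ i] exI[of _ j]) auto
    qed
    \<comment> \<open>The directions (t, -s) here and (-q, p) below are the columns of the inverse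
      matrix; they recover the exponents \<open>i\<close> and \<open>j\<close> from before the
      substitution.\<close>
    have b1: "0 \<le> int t * int k + (- int s) * int l \<and> int t * int k + (- int s) * int l \<le> int A"
      if kl: "(k, l) \<in> bsupp (c * d2)" for k l
    proof -
      from pt[OF kl] obtain i j where ij: "i \<le> A" "k = i * p + j * s" "l = i * q + j * t" by blast
      have "int t * int k + (- int s) * int l = int i * (int p * int t - int q * int s)"
        unfolding ij by (simp add: algebra_simps)
      then show ?thesis using ij by (simp add: det)
    qed
    have b2: "0 \<le> (- int q) * int k + int p * int l \<and> (- int q) * int k + int p * int l \<le> int A"
      if kl: "(k, l) \<in> bsupp (c * d2)" for k l
    proof -
      from pt[OF kl] obtain i j where ij: "j \<le> A" "k = i * p + j * s" "l = i * q + j * t" by blast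
      have "(- int q) * int k + int p * int l = int j * (int p * int t - int q * int s)"
        unfolding ij by (simp add: algebra_simps)
      then show ?thesis using ij by (simp add: det)
    qed
    define a b where "a = int t * x - int s * y" and "b = int p * y - int q * x"
    have "\<bar>a\<bar> \<le> int A"
      using bsupp_factor_width[OF c0(1,3) b1, of "fst z" "snd z" "fst z'" "snd z'"]
        bsupp_factor_width[OF c0(1,3) b1, of "fst z'" "snd z'" "fst z" "snd z"] z
      by (simp add: a_def x_def y_def algebra_simps)
    moreover have "\<bar>b\<bar> \<le> int A"
      using bsupp_factor_width[OF c0(1,3) b2, of "fst z" "snd z" "fst z'" "snd z'"]
        bsupp_factor_width[OF c0(1,3) b2, of "fst z'" "snd z'" "fst z" "snd z"] z
      by (simp add: b_def x_def y_def algebra_simps)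
    moreover have e1: "ecl (rev (concat bs)) (a, b) = (x, y)"
    proof -
      have "a * int p + b * int s = x * (int p * int t - int q * int s)"
        "a * int q + b * int t = y * (int p * int t - int q * int s)"
        unfolding a_def b_def by (simp_all add: algebra_simps)
      then show ?thesis using ecl_mats[OF M, of a b] by (simp add: det)
    qed
    moreover have "(a, b) \<noteq> (0, 0)"
    proof
      assume "(a, b) = (0, 0)"
      with e1 ecl_mats[OF M, of a b] xy show False by auto
    qed
    moreover have "rev (concat bs) = concat (map rev (rev bs))" by (simp add: rev_concat rev_map)
    moreover have "\<forall>es\<in>set (map rev (rev bs)). mixed es" using mix by (auto simp: mixed_def)
    ultimately have "int A < \<bar>x\<bar>"
      using ecl_large[of "map rev (rev bs)" n "(a, b)" "int A"] len A by simp
    with dx show False by simp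
  qed
  obtain i j where "(i, j) \<in> bsupp c" using c0 by (auto simp flip: bsupp_eq_empty_iff)
  then have "bsupp c = {(i, j)}" using uniq by blast
  then show ?thesis by (rule monomial_beval_1_1)
qed

section \<open>Common roots of two transformed polynomials\<close>

definition degree_box :: "nat \<Rightarrow> real poly poly \<Rightarrow> bool" where
  "degree_box A r \<longleftrightarrow> bsupp r \<subseteq> {..A} \<times> {..A}"

lemma degree_box_mult: assumes "degree_box A r" "degree_box B s" shows "degree_box (A + B) (r * s)"
  unfolding degree_box_def
proof (rule subrelI)
  fix i j assume "(i, j) \<in> bsupp (r * s)"
  then have "(\<Sum>j'\<le>j. \<Sum>i'\<le>i. bcoeff r i' j' * bcoeff s (i - i') (j - j')) \<noteq> 0"
    by (simp add: bsupp_def bcoeff_mult)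
  then obtain j' where j': "j' \<le> j" "(\<Sum>i'\<le>i. bcoeff r i' j' * bcoeff s (i - i') (j - j')) \<noteq> 0"
    by (metis (no_types, lifting) atMost_iff sum.not_neutral_contains_not_neutral)
  then obtain i' where i': "i' \<le> i" "bcoeff r i' j' * bcoeff s (i - i') (j - j') \<noteq> 0"
    by (metis (no_types, lifting) atMost_iff sum.not_neutral_contains_not_neutral)
  then have "(i', j') \<in> bsupp r" "(i - i', j - j') \<in> bsupp s" by (auto simp: bsupp_def)
  then have "(i', j') \<in> {..A} \<times> {..A}" "(i - i', j - j') \<in> {..B} \<times> {..B}"
    using assms unfolding degree_box_def by blast+
  then show "(i, j) \<in> {..A + B} \<times> {..A + B}" using i' j' by auto
qed

lemma degree_box_power: assumes "degree_box A r" shows "degree_box (n * A) (r ^ n)"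
proof (induction n)
  case 0
  show ?case by (auto simp: degree_box_def bsupp_def bcoeff_def coeff_1 split: if_splits)
next
  case (Suc n)
  then show ?case using degree_box_mult[OF assms Suc] by simp
qed

lemma degree_box_mono: "degree_box A r \<Longrightarrow> A \<le> B \<Longrightarrow> degree_box B r"
  by (auto simp: degree_box_def)

text \<open>The exponent map has determinant 1, hence is injective, and the substitution merges no
  two monomials.\<close>

lemma bsub_nonzero:
  assumes M: "mats es = (p, q, u, v)" and r: "r \<noteq> 0"
  shows "bsub (p, q, u, v) r \<noteq> 0"
proof
  assume z: "bsub (p, q, u, v) r = 0"
  obtain i j where ij: "(i, j) \<in> bsupp r" using r by (auto simp flip: bsupp_eq_empty_iff)
  have inj: "(i', j') = (i, j)" if "i' * p + j' * u = i * p + j * u" "i' * q + j' * v = i * q + j * v" for i' j'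
  proof -
    have det: "int p * int v - int q * int u = 1" using mats_det[OF M] .
    define A B where "A = int i' - int i" and "B = int j' - int j"
    have e1: "A * int p + B * int u = 0" using arg_cong[OF that(1), of int] by (simp add: A_def B_def algebra_simps)
    have e2: "A * int q + B * int v = 0" using arg_cong[OF that(2), of int] by (simp add: A_def B_def algebra_simps)
    have "A * (int p * int v - int q * int u) = (A * int p + B * int u) * int v - (A * int q + B * int v) * int u"
      "B * (int p * int v - int q * int u) = (A * int q + B * int v) * int p - (A * int p + B * int u) * int q"
      by (simp_all add: algebra_simps)
    then have "A = 0" "B = 0" unfolding det e1 e2 by simp_all
    then show ?thesis by (simp add: A_def B_def)
  qed
  have "bcoeff (bsub (p, q, u, v) r) (i * p + j * u) (i * q + j * v)
    = (\<Sum>z\<in>bsupp r. if z = (i, j) then bcoeff r i j else 0)"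
    unfolding bsub_def case_prod_beta bcoeff_sum fst_conv snd_conv
    by (rule sum.cong) (auto simp: bcoeff_bmonom dest!: inj)
  also have "\<dots> = bcoeff r i j" using ij by simp
  finally show False using z ij by (simp add: bsupp_def bcoeff_def)
qed

text \<open>The Boolean pairs stand for the substitutions \<open>1 \<mapsto> 10\<close>, \<open>1 \<mapsto> 01\<close> (first entry \<open>False\<close>) and
  \<open>0 \<mapsto> 01\<close>, \<open>0 \<mapsto> 10\<close> (first entry \<open>True\<close>). If a word is the image of another one, the generating
  functions \<open>f, g\<close> of its letters \<open>1, 0\<close> arise from those of the other word by a matrix of monomials and
  their sums. A step applies the adjugate of this matrix, and \<open>d\<close> collects the determinants.\<close>

fun rstep :: "bool \<times> bool \<Rightarrow> 'a::comm_ring_1 \<times> 'a \<times> 'a \<times> 'a \<times> 'a \<Rightarrow> 'a \<times> 'a \<times> 'a \<times> 'a \<times> 'a" where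
  "rstep (e, h) (x, y, f, g, d) =
    (if e then (x * y, y, if h then y * f - g else f - x * g, g, if h then y * d else d)
     else (x, x * y, f, if h then x * g - f else g - y * f, if h then x * d else d))"

definition rsteps :: "(bool \<times> bool) list \<Rightarrow> 'a::comm_ring_1 \<times> 'a \<times> 'a \<times> 'a \<times> 'a \<Rightarrow> 'a \<times> 'a \<times> 'a \<times> 'a \<times> 'a" where
  "rsteps ts st = fold rstep ts st"

lemma rsteps_simps [simp]:
  "rsteps [] st = st" "rsteps (t # ts) st = rsteps ts (rstep t st)"
  "rsteps (ts @ us) st = rsteps us (rsteps ts st)"
  by (simp_all add: rsteps_def)

lemma rsteps_linear:
  assumes "rsteps ts (x, y, f1, g1, d) = (X, Y, F1, G1, D)"
    and "rsteps ts (x, y, f2, g2, d) = (X', Y', F2, G2, D')"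
  shows "rsteps ts (x, y, a * f1 + b * f2, a * g1 + b * g2, d) = (X, Y, a * F1 + b * F2, a * G1 + b * G2, D)"
  using assms
proof (induction ts arbitrary: x y f1 g1 f2 g2 d)
  case (Cons t ts)
  obtain e h where t: "t = (e, h)" by (cases t)
  have *: "rstep t (x, y, a * f1 + b * f2, a * g1 + b * g2, d) =
    (let (x', y', f1', g1', d') = rstep t (x, y, f1, g1, d);
         (_, _, f2', g2', _) = rstep t (x, y, f2, g2, d)
     in (x', y', a * f1' + b * f2', a * g1' + b * g2', d'))"
    by (cases e; cases h) (simp_all add: t algebra_simps)
  obtain x' y' f1' g1' d' where 1: "rstep t (x, y, f1, g1, d) = (x', y', f1', g1', d')"
    by (metis prod_cases5)
  obtain f2' g2' where 2: "rstep t (x, y, f2, g2, d) = (x', y', f2', g2', d')"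
    using 1 by (cases e; cases h) (simp_all add: t)
  show ?case using Cons.IH[of x' y' f1' g1' d' f2' g2'] Cons.prems 1 2 * by simp
qed simp

text \<open>In each of the four cases the form is multiplied by exactly the factor that
  \<open>D\<close> collects. The form thus has a known value at every level and can serve to
  homogenise polynomials in \<open>f\<close>.\<close>

lemma rsteps_ell:
  assumes "rsteps ts (x, y, f, g, 1) = (X, Y, F, G, D)"
  shows "(1 - Y) * F + (1 - X) * G = D * ((1 - y) * f + (1 - x) * g)"
  using assms
proof (induction ts arbitrary: X Y F G D rule: rev_induct)
  case (snoc t ts)
  obtain e h where t: "t = (e, h)" by (cases t)
  obtain X' Y' F' G' D' where 1: "rsteps ts (x, y, f, g, 1) = (X', Y', F', G', D')"
    by (metis prod_cases5)
  have IH: "(1 - Y') * F' + (1 - X') * G' = D' * ((1 - y) * f + (1 - x) * g)" using snoc.IH[OF 1] .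
  have st: "rstep (e, h) (X', Y', F', G', D') = (X, Y, F, G, D)" using snoc.prems 1 t by simp
  have "\<exists>c. (1 - Y) * F + (1 - X) * G = c * ((1 - Y') * F' + (1 - X') * G') \<and> D = c * D'"
  proof (cases e; cases h)
    assume "e" "h"
    with st have eqs: "X = X' * Y'" "Y = Y'" "F = Y' * F' - G'" "G = G'" "D = Y' * D'" by auto
    show ?thesis unfolding eqs by (intro exI[of _ Y']) (simp add: algebra_simps)
  next
    assume "e" "\<not> h"
    with st have eqs: "X = X' * Y'" "Y = Y'" "F = F' - X' * G'" "G = G'" "D = D'" by auto
    show ?thesis unfolding eqs by (intro exI[of _ 1]) (simp add: algebra_simps)
  next
    assume "\<not> e" "h"
    with st have eqs: "X = X'" "Y = X' * Y'" "F = F'" "G = X' * G' - F'" "D = X' * D'" by auto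
    show ?thesis unfolding eqs by (intro exI[of _ X']) (simp add: algebra_simps)
  next
    assume "\<not> e" "\<not> h"
    with st have eqs: "X = X'" "Y = X' * Y'" "F = F'" "G = G' - Y' * F'" "D = D'" by auto
    show ?thesis unfolding eqs by (intro exI[of _ 1]) (simp add: algebra_simps)
  qed
  then show ?case using IH by (auto simp: mult_ac)
qed simp

text \<open>The vector (1 - x, -(1 - y)) is annihilated by the form (1 - y) f + (1 - x) g. The steps
  carry it to the corresponding vector of the new level with no scalar factor.\<close>

lemma rsteps_kernel:
  assumes "rsteps ts (x, y, 1 - x, - (1 - y), 1) = (X, Y, F, G, D)"
  shows "F = 1 - X \<and> G = - (1 - Y)"
  using assms
proof (induction ts arbitrary: X Y F G D rule: rev_induct)
  case (snoc t ts)
  obtain e h where t: "t = (e, h)" by (cases t)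
  obtain X' Y' F' G' D' where 1: "rsteps ts (x, y, 1 - x, - (1 - y), 1) = (X', Y', F', G', D')"
    by (metis prod_cases5)
  have IH: "F' = 1 - X'" "G' = - (1 - Y')" using snoc.IH[OF 1] by auto
  have st: "rstep (e, h) (X', Y', F', G', D') = (X, Y, F, G, D)" using snoc.prems 1 t by simp
  show ?case using st unfolding IH by (cases e; cases h) (auto simp: algebra_simps)
qed simp

lemma rsteps_beval:
  assumes "rsteps ts (x, y, f, g, d) = (X, Y, F, G, D)"
  shows "rsteps ts (beval x u v, beval y u v, beval f u v, beval g u v, beval d u v)
    = (beval X u v, beval Y u v, beval F u v, beval G u v, beval D u v)"
  using assms
proof (induction ts arbitrary: x y f g d)
  case (Cons t ts)
  obtain e h where t: "t = (e, h)" by (cases t)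
  obtain x' y' f' g' d' where 1: "rstep t (x, y, f, g, d) = (x', y', f', g', d')"
    by (metis prod_cases5)
  have "rstep t (beval x u v, beval y u v, beval f u v, beval g u v, beval d u v)
    = (beval x' u v, beval y' u v, beval f' u v, beval g' u v, beval d' u v)"
    using 1 by (cases e; cases h) (auto simp: t)
  then show ?case using Cons.IH[of x' y' f' g' d'] Cons.prems 1 by simp
qed auto

lemma rsteps_bmonom:
  assumes "rsteps ts (bmonom 1 1 0, bmonom 1 0 1, f, g, 1) = (X, Y, F, G, D)"
    and "mats (map fst ts) = (p, q, r, s)"
  shows "X = bmonom 1 p q \<and> Y = bmonom 1 r s"
  using assms
proof (induction ts arbitrary: X Y F G D p q r s rule: rev_induct)
  case Nil
  then show ?case by (auto simp: mats_def)
next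
  case (snoc t ts)
  obtain e h where t: "t = (e, h)" by (cases t)
  obtain X' Y' F' G' D' where 1: "rsteps ts (bmonom 1 1 0, bmonom 1 0 1, f, g, 1) = (X', Y', F', G', D')"
    by (metis prod_cases5)
  obtain p' q' r' s' where m: "mats (map fst ts) = (p', q', r', s')" by (cases "mats (map fst ts)")
  from snoc.IH[OF 1 m] have IH: "X' = bmonom 1 p' q'" "Y' = bmonom 1 r' s'" by auto
  have st: "rstep (e, h) (X', Y', F', G', D') = (X, Y, F, G, D)" using snoc.prems 1 t by simp
  have mm: "mstep (p', q', r', s') e = (p, q, r, s)" using snoc.prems m t by (simp add: mats_snoc)
  show ?case using st mm by (cases e; cases h) (auto simp: IH bmonom_mult)
qed

section \<open>Trivariate polynomials, specialised resultants, homogenisation\<close>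

definition teval :: "real poly poly poly \<Rightarrow> real \<Rightarrow> real \<Rightarrow> real \<Rightarrow> real" where
  "teval p x y t = beval (poly p [:[:t:]:]) x y"

lemma beval_const [simp]: "beval [:[:t:]:] x y = t" "beval (Polynomial.smult [:t:] r) x y = t * beval r x y"
  by (simp_all add: beval_def)

lemma teval_simps [simp]:
  "teval 0 x y t = 0" "teval 1 x y t = 1" "teval (p + q) x y t = teval p x y t + teval q x y t"
  "teval (p * q) x y t = teval p x y t * teval q x y t" "teval (p ^ n) x y t = teval p x y t ^ n"
  "teval (pCons c p) x y t = beval c x y + t * teval p x y t"
  "teval (Polynomial.smult c p) x y t = beval c x y * teval p x y t"
  by (simp_all add: teval_def del: mult_pCons_left)

lemma teval_sum [simp]: "teval (\<Sum>i\<in>I. f i) x y t = (\<Sum>i\<in>I. teval (f i) x y t)"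
  by (induction I rule: infinite_finite_induct) simp_all

lemma teval_altdef: "degree p \<le> n \<Longrightarrow> teval p x y t = (\<Sum>i\<le>n. beval (coeff p i) x y * t ^ i)"
proof -
  assume n: "degree p \<le> n"
  have "teval p x y t = (\<Sum>i\<le>degree p. beval (coeff p i) x y * t ^ i)"
    by (simp add: teval_def poly_altdef)
  also have "\<dots> = (\<Sum>i\<le>n. beval (coeff p i) x y * t ^ i)"
    by (rule sum.mono_neutral_left) (use n in \<open>auto simp: coeff_eq_0\<close>)
  finally show ?thesis .
qed

lemma poly_map_beval: "poly (map_poly (\<lambda>c. beval c x y) p) t = teval p x y t"
  by (induction p) (auto simp: map_poly_pCons)

text \<open>Specialising x and y may lower the degrees in \<open>t\<close>, so the determinant keeps
  the formal degrees; it is still a combination of the two values at \<open>t\<close>, both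
  0.\<close>

lemma beval_resultant_eq_0:
  assumes "teval p x y t = 0" "teval q x y t = 0" "0 < degree p"
  shows "beval (resultant p q) x y = 0"
proof -
  define h where "h c = beval c x y" for c
  interpret h: comm_ring_hom h by unfold_locales (auto simp: h_def)
  have "beval (resultant p q) x y = h (resultant p q)" by (simp add: h_def)
  also have "\<dots> = Determinant.det (map_mat h (sylvester_mat p q))"
    unfolding resultant_def by simp
  also have "\<dots> = resultant_sub (degree p) (degree q) (map_poly h p) (map_poly h q)"
    unfolding resultant_sub_def sylvester_mat_def by (subst sylvester_mat_sub_map) auto
  also have "\<dots> = 0"
  proof -
    have z: "poly (map_poly h p) t = 0" "poly (map_poly h q) t = 0"
      using assms(1,2) unfolding h_def poly_map_beval by auto
    show ?thesis
      by (subst resultant_sub_eq_combination[where x = t])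
        (use assms(3) in \<open>simp_all add: z degree_map_poly_le cong: if_cong\<close>)
  qed
  finally show ?thesis .
qed

text \<open>For \<open>K\<^sub>1 = 1 - x\<close> and \<open>K\<^sub>2 = s (1 - x) - (1 - y)\<close> this is the value of the homogenised polynomial at the
  vector annihilated by the form \<open>(1 - y) f + (1 - x) g\<close>, which all steps preserve up to a monomial.\<close>

definition hom_eval :: "real poly poly \<Rightarrow> real poly poly \<Rightarrow> nat \<Rightarrow> real poly poly poly \<Rightarrow> real poly poly" where
  "hom_eval K1 K2 n p = (\<Sum>i\<le>n. coeff p i * K1 ^ i * K2 ^ (n - i))"

lemma beval_hom_eval:
  assumes "degree p \<le> n" "beval K2 x y \<noteq> 0"
  shows "beval (hom_eval K1 K2 n p) x y = beval K2 x y ^ n * teval p x y (beval K1 x y / beval K2 x y)"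
proof -
  have "beval K2 x y ^ n * teval p x y (beval K1 x y / beval K2 x y)
    = (\<Sum>i\<le>n. beval K2 x y ^ n * (beval (coeff p i) x y * (beval K1 x y / beval K2 x y) ^ i))"
    by (simp add: teval_altdef[OF assms(1)] sum_distrib_left)
  also have "\<dots> = (\<Sum>i\<le>n. beval (coeff p i) x y * beval K1 x y ^ i * beval K2 x y ^ (n - i))"
    using assms(2) by (intro sum.cong) (auto simp: power_divide power_diff)
  finally show ?thesis by (simp add: hom_eval_def)
qed

lemma hom_eval_mult:
  assumes "degree p \<le> n" "degree q \<le> m" "K2 \<noteq> 0"
  shows "hom_eval K1 K2 (n + m) (p * q) = hom_eval K1 K2 n p * hom_eval K1 K2 m q"
proof (rule beval_eqI[OF assms(3)])
  fix x y assume nz: "beval K2 x y \<noteq> 0"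
  have "degree (p * q) \<le> n + m" using degree_mult_le[of p q] assms by linarith
  then show "beval (hom_eval K1 K2 (n + m) (p * q)) x y = beval (hom_eval K1 K2 n p * hom_eval K1 K2 m q) x y"
    using assms nz by (simp add: beval_hom_eval power_add)
qed

text \<open>\<open>C\<close> is homogenised in its own degree and the cofactor in what remains of
  \<open>n\<close>, so factors in \<open>t\<close> become factors of the homogenised value.\<close>

lemma hom_eval_dvd:
  assumes "p = C * q" "p \<noteq> 0" "degree p \<le> n" "K2 \<noteq> 0"
  shows "hom_eval K1 K2 n p = hom_eval K1 K2 (degree C) C * hom_eval K1 K2 (n - degree C) q"
proof -
  have "degree p = degree C + degree q" using assms(1,2) by (auto simp: degree_mult_eq)
  with assms show ?thesis using hom_eval_mult[of C "degree C" q "n - degree C" K2 K1] by simp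
qed

lemma degree_linear_power_le:
  assumes "degree p \<le> 1" shows "degree (p ^ n) \<le> n"
  using degree_power_le[of p n] assms by (metis mult.left_neutral mult_le_mono1 order_trans)

text \<open>In the chart g + s f = 1 both equations become polynomials \<open>p0\<close>,
  \<open>p1\<close> in t = f, and \<open>r\<close> is their resultant. A common factor of positive
  degree is excluded at the kernel vector: only top coefficients survive there, so its value divides
  both \<open>a D0 * K1 ^ D0\<close> and the substituted \<open>b D1 * K1 ^ D1\<close>. By
  \<open>common_factor_beval_1_1\<close> this value is nonzero at (1, 1), where however the kernel
  vector itself is zero.\<close>

lemma no_common_root:
  fixes a b :: "nat \<Rightarrow> real poly poly" and s :: real
  assumes nz: "a D0 \<noteq> 0" "b D1 \<noteq> 0" and bx: "degree_box N (a D0)" "degree_box N (b D1)"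
    and ts: "map fst ts = concat bs" "\<forall>es\<in>set bs. mixed es" "length bs = n + 1 + n"
    and n: "N + D0 < 2 ^ n" "N + D1 < 2 ^ n"
  shows "\<exists>r. r \<noteq> 0 \<and> (\<forall>x y f g X Y F G D.
      rsteps ts (x, y, f, g, 1) = (X, Y, F, G, D) \<longrightarrow> g + s * f \<noteq> 0 \<longrightarrow>
      (\<Sum>l\<le>D0. beval (a l) x y * f ^ l * ((1 - y) * f + (1 - x) * g) ^ (D0 - l)) = 0 \<longrightarrow>
      (\<Sum>l\<le>D1. beval (b l) X Y * F ^ l * ((1 - Y) * F + (1 - X) * G) ^ (D1 - l)) = 0 \<longrightarrow>
      beval r x y = 0)"
proof -
  define X0 Y0 where "X0 = bmonom 1 1 0" and "Y0 = bmonom 1 0 1"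
  have evX [simp]: "beval X0 x y = x" "beval Y0 x y = y" for x y by (simp_all add: X0_def Y0_def)
  define K1 K2 where "K1 = 1 - X0" and "K2 = [:[:s:]:] * (1 - X0) - (1 - Y0)"
  have evK: "beval K1 x y = 1 - x" "beval K2 x y = s * (1 - x) - (1 - y)" for x y
    by (simp_all add: K1_def K2_def)
  have K1: "K1 \<noteq> 0" using evK(1)[of 0 0] by auto
  have K2: "K2 \<noteq> 0" using evK(2)[of 1 0] by auto
  \<comment> \<open>For f = t and g = 1 - s t the form (1 - y) f + (1 - x) g is K1 - K2 t, with root
    K1 / K2.\<close>
  define L where "L = [:K1, - K2:]"
  obtain p q u v where M: "mats (concat bs) = (p, q, u, v)" by (cases "mats (concat bs)")
  obtain Xm Ym N11 N21 \<delta> where r1: "rsteps ts (X0, Y0, 1, 0, 1) = (Xm, Ym, N11, N21, \<delta>)"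
    by (metis prod_cases5)
  obtain Xm' Ym' N12 N22 \<delta>' where r2: "rsteps ts (X0, Y0, 0, 1, 1) = (Xm', Ym', N12, N22, \<delta>')"
    by (metis prod_cases5)
  from rsteps_bmonom[OF r1[unfolded X0_def Y0_def]] M ts(1)
  have mon: "Xm = bmonom 1 p q" "Ym = bmonom 1 u v" by auto
  have steps: "rsteps ts (x, y, f, g, 1) =
      (beval Xm x y, beval Ym x y, beval N11 x y * f + beval N12 x y * g, beval N21 x y * f + beval N22 x y * g, beval \<delta> x y)" for x y f g
  proof -
    have "rsteps ts (x, y, 1, 0, 1) = (beval Xm x y, beval Ym x y, beval N11 x y, beval N21 x y, beval \<delta> x y)"
      "rsteps ts (x, y, 0, 1, 1) = (beval Xm' x y, beval Ym' x y, beval N12 x y, beval N22 x y, beval \<delta>' x y)"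
      using rsteps_beval[OF r1, of x y] rsteps_beval[OF r2, of x y] by simp_all
    from rsteps_linear[OF this, of f g] show ?thesis by (simp add: mult.commute)
  qed
  have ker: "beval N11 x y * (1 - x) - beval N12 x y * (1 - y) = 1 - beval Xm x y" for x y
    using rsteps_kernel[OF steps[of x y "1 - x" "- (1 - y)"]] by (simp add: algebra_simps)
  \<comment> \<open>The entry \<open>F\<close> after all steps, again for f = t and g = 1 - s
    t.\<close>
  define F1 where "F1 = [:N12, N11 - [:[:s:]:] * N12:]"
  define Mm where "Mm = mats (concat bs)"
  have evMm: "beval (bsub Mm c) x y = beval c (beval Xm x y) (beval Ym x y)" for c x y
    by (simp add: Mm_def M beval_bsub mon)
  define p0 where "p0 = (\<Sum>l\<le>D0. [:a l:] * [:0, 1:] ^ l * L ^ (D0 - l))"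
  define p1 where "p1 = (\<Sum>l\<le>D1. [:bsub Mm (b l):] * F1 ^ l * ([:\<delta>:] * L) ^ (D1 - l))"
  have deg: "degree p0 \<le> D0" "degree p1 \<le> D1"
  proof -
    have t: "degree ([:c:] * A ^ l * B ^ (D - l)) \<le> D" if "degree A \<le> 1" "degree B \<le> 1" "l \<le> D"
      for c :: "real poly poly" and A B l D
    proof -
      have "degree ([:c:] * A ^ l * B ^ (D - l)) \<le> degree [:c:] + degree (A ^ l) + degree (B ^ (D - l))"
        by (meson add_le_mono1 degree_mult_le order_trans)
      also have "\<dots> \<le> 0 + l + (D - l)" using that by (intro add_mono degree_linear_power_le) auto
      finally show ?thesis using that by simp
    qed
    have dl: "degree L \<le> 1" "degree F1 \<le> 1" "degree ([:\<delta>:] * L) \<le> 1" "degree [:0, 1 :: real poly poly:] \<le> 1"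
      using degree_mult_le[of "[:\<delta>:]" L] by (auto simp: L_def F1_def intro: order_trans[OF degree_pCons_le])
    show "degree p0 \<le> D0" unfolding p0_def by (intro degree_sum_le t dl) auto
    show "degree p1 \<le> D1" unfolding p1_def by (intro degree_sum_le t dl) auto
  qed
  have top: "(\<Sum>l\<le>D. c l * A ^ l * (0::real) ^ (D - l)) = c D * A ^ D" for c :: "nat \<Rightarrow> real" and A D
  proof -
    have "(\<Sum>l\<le>D. c l * A ^ l * (0::real) ^ (D - l)) = (\<Sum>l\<in>{D}. c l * A ^ l * (0::real) ^ (D - l))"
      by (rule sum.mono_neutral_right) (auto simp: power_0_left)
    then show ?thesis by simp
  qed
  have ev3p0: "teval p0 x y t = (\<Sum>l\<le>D0. beval (a l) x y * t ^ l * teval L x y t ^ (D0 - l))" for x y t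
    by (simp add: p0_def mult_ac)
  have ev3p1: "teval p1 x y t = (\<Sum>l\<le>D1. beval (bsub Mm (b l)) x y * teval F1 x y t ^ l * (beval \<delta> x y * teval L x y t) ^ (D1 - l))" for x y t
    by (simp add: p1_def mult_ac)
  have L0: "teval L x y (beval K1 x y / beval K2 x y) = 0" if "beval K2 x y \<noteq> 0" for x y
    using that by (simp add: L_def)
  \<comment> \<open>At the root of \<open>L\<close> every term except the one with l = D0 contains a
    factor 0.\<close>
  have H0: "hom_eval K1 K2 D0 p0 = a D0 * K1 ^ D0"
  proof (rule beval_eqI[OF K2])
    fix x y assume nz2: "beval K2 x y \<noteq> 0"
    have "teval p0 x y (beval K1 x y / beval K2 x y) = beval (a D0) x y * (beval K1 x y / beval K2 x y) ^ D0"
      by (simp only: ev3p0 L0[OF nz2] top)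
    then show "beval (hom_eval K1 K2 D0 p0) x y = beval (a D0 * K1 ^ D0) x y"
      using nz2 by (simp add: beval_hom_eval[OF deg(1) nz2] power_divide)
  qed
  define B1 where "B1 = b D1 * K1 ^ D1"
  have H1: "hom_eval K1 K2 D1 p1 = bsub Mm B1"
  proof (rule beval_eqI[OF K2])
    fix x y assume nz2: "beval K2 x y \<noteq> 0"
    define t where "t = beval K1 x y / beval K2 x y"
    \<comment> \<open>K2 times the vector (t, 1 - s t) at t = K1 / K2 is the kernel vector (1 - x,
      -(1 - y)), so \<open>ker\<close> evaluates \<open>F\<close>; the result 1 - Xm is a
      substituted polynomial.\<close>
    have "beval K2 x y * (beval N12 x y + t * (beval N11 x y - s * beval N12 x y))
      = beval N12 x y * beval K2 x y + beval K1 x y * (beval N11 x y - s * beval N12 x y)"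
      using nz2 by (simp add: t_def field_simps)
    also have "\<dots> = beval N11 x y * (1 - x) - beval N12 x y * (1 - y)" by (simp add: evK algebra_simps)
    finally have F: "beval K2 x y * (beval N12 x y + t * (beval N11 x y - s * beval N12 x y)) = 1 - beval Xm x y"
      by (simp add: ker)
    have "beval (hom_eval K1 K2 D1 p1) x y = beval K2 x y ^ D1 * (beval (bsub Mm (b D1)) x y * teval F1 x y t ^ D1)"
      unfolding beval_hom_eval[OF deg(2) nz2] t_def by (simp only: ev3p1 L0[OF nz2] mult_zero_right top)
    also have "\<dots> = beval (bsub Mm (b D1)) x y * (beval K2 x y * teval F1 x y t) ^ D1"
      by (simp add: power_mult_distrib)
    also have "beval K2 x y * teval F1 x y t = 1 - beval Xm x y"
      using F by (simp add: F1_def)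
    finally show "beval (hom_eval K1 K2 D1 p1) x y = beval (bsub Mm B1) x y"
      by (simp add: evMm B1_def evK mon power_mult_distrib power_mult mult_ac)
  qed
  have bxK: "degree_box 1 K1" unfolding K1_def X0_def degree_box_def bsupp_def
    by (auto simp: bcoeff_def bmonom_def coeff_1 split: if_splits)
  have nz0: "a D0 * K1 ^ D0 \<noteq> 0" using nz K1 by simp
  have nz1: "bsub Mm B1 \<noteq> 0"
    using bsub_nonzero[OF M, of B1] nz K1 by (simp add: Mm_def M B1_def bmonom_def)
  have "degree (gcd p0 p1) = 0"
  proof (rule ccontr)
    assume dg: "degree (gcd p0 p1) \<noteq> 0"
    define C where "C = gcd p0 p1"
    obtain e0 e1 where e: "p0 = C * e0" "p1 = C * e1" unfolding C_def by (meson dvd_def gcd_dvd1 gcd_dvd2)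
    have p01: "p0 \<noteq> 0" "p1 \<noteq> 0" using H0 nz0 H1 nz1 by (auto simp: hom_eval_def)
    define c where "c = hom_eval K1 K2 (degree C) C"
    have "beval c 1 1 \<noteq> 0"
    proof (rule common_factor_beval_1_1)
      show "c * hom_eval K1 K2 (D0 - degree C) e0 = a D0 * K1 ^ D0"
        using hom_eval_dvd[OF e(1) p01(1) deg(1) K2] H0 unfolding c_def by simp
      show "c * hom_eval K1 K2 (D1 - degree C) e1 = bsub (mats (concat bs)) B1"
        using hom_eval_dvd[OF e(2) p01(2) deg(2) K2] H1 unfolding c_def Mm_def by simp
      show "bsupp (a D0 * K1 ^ D0) \<subseteq> {..max (N + D0) (N + D1)} \<times> {..max (N + D0) (N + D1)}"
        using degree_box_mono[OF degree_box_mult[OF bx(1) degree_box_power[OF bxK, of D0]], of "max (N + D0) (N + D1)"]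
        by (simp add: degree_box_def)
      show "bsupp B1 \<subseteq> {..max (N + D0) (N + D1)} \<times> {..max (N + D0) (N + D1)}"
        using degree_box_mono[OF degree_box_mult[OF bx(2) degree_box_power[OF bxK, of D1]], of "max (N + D0) (N + D1)"]
        by (simp add: degree_box_def B1_def)
    qed (use nz0 nz1 ts n in \<open>auto simp: Mm_def\<close>)
    \<comment> \<open>Every term has positive total degree in \<open>K1\<close> and
      \<open>K2\<close>, which both vanish at (1, 1).\<close>
    moreover have "beval c 1 1 = 0"
      unfolding c_def hom_eval_def using dg by (auto simp: evK C_def power_0_left intro!: sum.neutral)
    ultimately show False by simp
  qed
  then have res: "resultant p0 p1 \<noteq> 0" by (simp add: resultant_0_gcd)
  \<comment> \<open>\<open>beval_resultant_eq_0\<close> needs positive degree; if \<open>p0\<close>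
    is constant in \<open>t\<close>, its vanishing is already a condition on x, y alone.\<close>
  define r where "r = (if degree p0 = 0 then coeff p0 0 else resultant p0 p1)"
  have "r \<noteq> 0"
  proof (cases "degree p0 = 0")
    case True
    then obtain c where c: "p0 = [:c:]" by (auto elim: degree_eq_zeroE)
    have "c \<noteq> 0" using H0 nz0 c by (auto simp: hom_eval_def)
    then show ?thesis by (simp add: r_def c)
  qed (use res in \<open>simp add: r_def\<close>)
  moreover have "beval r x y = 0"
    if st: "rsteps ts (x, y, f, g, 1) = (X, Y, F, G, D)" and sg: "g + s * f \<noteq> 0"
      and z0: "(\<Sum>l\<le>D0. beval (a l) x y * f ^ l * ((1 - y) * f + (1 - x) * g) ^ (D0 - l)) = 0"
      and z1: "(\<Sum>l\<le>D1. beval (b l) X Y * F ^ l * ((1 - Y) * F + (1 - X) * G) ^ (D1 - l)) = 0"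
    for x y f g X Y F G D
  proof -
    define \<sigma> t where "\<sigma> = g + s * f" and "t = f / \<sigma>"
    have \<sigma>: "\<sigma> \<noteq> 0" using sg by (simp add: \<sigma>_def)
    have f: "f = \<sigma> * t" using \<sigma> by (simp add: t_def)
    have g: "g = \<sigma> * (1 - s * t)"
    proof -
      have "\<sigma> * (1 - s * t) = \<sigma> - s * (\<sigma> * t)" by (simp add: algebra_simps)
      also have "\<dots> = g" unfolding f[symmetric] by (simp add: \<sigma>_def)
      finally show ?thesis by simp
    qed
    have hom: "(\<Sum>l\<le>E. c l * (\<sigma> * A) ^ l * (\<sigma> * B) ^ (E - l)) = \<sigma> ^ E * (\<Sum>l\<le>E. c l * A ^ l * B ^ (E - l))"
      for c :: "nat \<Rightarrow> real" and A B E
    proof -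
      have "c l * (\<sigma> * A) ^ l * (\<sigma> * B) ^ (E - l) = \<sigma> ^ E * (c l * A ^ l * B ^ (E - l))" if "l \<le> E" for l
      proof -
        have "\<sigma> ^ E = \<sigma> ^ l * \<sigma> ^ (E - l)" using that by (simp flip: power_add)
        then show ?thesis by (simp add: power_mult_distrib mult_ac)
      qed
      then show ?thesis by (auto simp: sum_distrib_left intro!: sum.cong)
    qed
    have l: "(1 - y) * f + (1 - x) * g = \<sigma> * teval L x y t"
      unfolding f g by (simp add: L_def evK algebra_simps)
    have "\<sigma> ^ D0 * teval p0 x y t = 0"
      using z0 unfolding l unfolding f hom by (simp add: ev3p0)
    then have e0: "teval p0 x y t = 0" using \<sigma> by simp
    have XY: "X = beval Xm x y" "Y = beval Ym x y" "F = beval N11 x y * f + beval N12 x y * g" "D = beval \<delta> x y"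
      using st steps[of x y f g] by auto
    have l1: "(1 - Y) * F + (1 - X) * G = \<sigma> * (beval \<delta> x y * teval L x y t)"
      using rsteps_ell[OF st] unfolding l XY(4) by (simp add: mult_ac)
    have F: "F = \<sigma> * teval F1 x y t" unfolding XY f g by (simp add: F1_def algebra_simps)
    have "\<sigma> ^ D1 * teval p1 x y t = 0"
      using z1 unfolding l1 unfolding F hom by (simp add: ev3p1 evMm XY)
    then have e1: "teval p1 x y t = 0" using \<sigma> by simp
    show ?thesis
    proof (cases "degree p0 = 0")
      case True
      then obtain c where "p0 = [:c:]" by (auto elim: degree_eq_zeroE)
      then show ?thesis using e0 by (simp add: r_def)
    next
      case False
      then show ?thesis using beval_resultant_eq_0[OF e0 e1] by (simp add: r_def)
    qed
  qed
  ultimately show ?thesis by blast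
qed

section \<open>Auxiliary polynomials for words\<close>

text \<open>The box principle behind Siegel's lemma: two integer vectors in a box have the same
  image, and their difference is \<open>c\<close>. No bound on \<open>c\<close> is recorded, as its
  size will affect constants only.\<close>

lemma pigeonhole_kernel:
  fixes K :: "'e \<Rightarrow> 'i \<Rightarrow> int"
  assumes fin: "finite I" "finite E" and card: "card E < card I"
  shows "\<exists>c. (\<exists>i\<in>I. c i \<noteq> 0) \<and> (\<forall>e\<in>E. (\<Sum>i\<in>I. K e i * c i) = 0)"
proof -
  define S where "S = nat (\<Sum>e\<in>E. \<Sum>i\<in>I. \<bar>K e i\<bar>)"
  have S: "(\<Sum>i\<in>I. \<bar>K e i\<bar>) \<le> int S" if "e \<in> E" for e
    unfolding S_def using that fin
    by (subst nat_0_le) (auto intro!: sum_nonneg member_le_sum[where f = "\<lambda>e. \<Sum>i\<in>I. \<bar>K e i\<bar>"])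
  \<comment> \<open>Chosen so that (2SB + 1)^|E| is at most ((2S + 1)(B + 1))^|E| = B (B + 1)^|E|,
    which is below (B + 1)^|I|.\<close>
  define B where "B = (2 * S + 1) ^ card E"
  define dom where "dom = (\<Pi>\<^sub>E i\<in>I. {0..int B})"
  define cod where "cod = (\<Pi>\<^sub>E e\<in>E. {- int (S * B)..int (S * B)})"
  define \<Phi> where "\<Phi> c = (\<lambda>e\<in>E. \<Sum>i\<in>I. K e i * c i)" for c
  have "\<Phi> ` dom \<subseteq> cod"
  proof (rule image_subsetI)
    fix c assume c: "c \<in> dom"
    have "\<bar>\<Sum>i\<in>I. K e i * c i\<bar> \<le> int (S * B)" if e: "e \<in> E" for e
    proof -
      have "\<bar>\<Sum>i\<in>I. K e i * c i\<bar> \<le> (\<Sum>i\<in>I. \<bar>K e i * c i\<bar>)" by (rule sum_abs)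
      also have "\<dots> \<le> (\<Sum>i\<in>I. \<bar>K e i\<bar> * int B)"
        using c by (intro sum_mono) (auto simp: abs_mult dom_def PiE_iff intro!: mult_left_mono)
      also have "\<dots> = (\<Sum>i\<in>I. \<bar>K e i\<bar>) * int B" by (simp add: sum_distrib_right)
      also have "\<dots> \<le> int S * int B" using S[OF e] by (intro mult_right_mono) auto
      finally show ?thesis by simp
    qed
    then show "\<Phi> c \<in> cod" unfolding cod_def \<Phi>_def by (auto simp: abs_le_iff) (smt (verit))
  qed
  moreover have "finite cod" unfolding cod_def using fin by (intro finite_PiE) auto
  moreover have "card cod < card dom"
  proof -
    have "card cod = (2 * S * B + 1) ^ card E"
      unfolding cod_def using fin by (subst card_PiE) (auto simp: nat_add_distrib nat_mult_distrib mult_ac)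
    also have "\<dots> \<le> ((2 * S + 1) * (B + 1)) ^ card E" by (intro power_mono) auto
    also have "\<dots> = B * (B + 1) ^ card E" by (simp only: power_mult_distrib B_def)
    also have "\<dots> < (B + 1) * (B + 1) ^ card E" by simp
    also have "\<dots> \<le> (B + 1) ^ card I"
      using power_increasing[of "Suc (card E)" "card I" "B + 1"] card by simp
    also have "\<dots> = card dom" unfolding dom_def using fin by (subst card_PiE) (auto simp: nat_add_distrib)
    finally show ?thesis .
  qed
  ultimately have "\<not> inj_on \<Phi> dom" using card_inj_on_le[of \<Phi> dom cod] by linarith
  then obtain c c' where c: "c \<in> dom" "c' \<in> dom" "\<Phi> c = \<Phi> c'" "c \<noteq> c'" by (auto simp: inj_on_def)
  have "\<exists>i\<in>I. c i - c' i \<noteq> 0" using c unfolding dom_def by (metis PiE_ext eq_iff_diff_eq_0)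
  moreover have "(\<Sum>i\<in>I. K e i * (c i - c' i)) = 0" if "e \<in> E" for e
    using fun_cong[OF c(3), of e] that by (simp add: \<Phi>_def right_diff_distrib sum_subtractf)
  ultimately show ?thesis by (intro exI[of _ "\<lambda>i. c i - c' i"]) auto
qed

section \<open>Generating functions of words and their truncations\<close>

definition wt :: "(nat \<Rightarrow> bool) \<Rightarrow> real \<Rightarrow> real \<Rightarrow> nat \<Rightarrow> real" where
  "wt s x y n = (\<Prod>i<n. if s i then y else x)"

definition wF :: "(nat \<Rightarrow> bool) \<Rightarrow> real \<Rightarrow> real \<Rightarrow> real" where
  "wF s x y = (\<Sum>n. of_bool (s n) * wt s x y n)"

definition wG :: "(nat \<Rightarrow> bool) \<Rightarrow> real \<Rightarrow> real \<Rightarrow> real" where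
  "wG s x y = wF (\<lambda>n. \<not> s n) y x"

lemma wt_bounds:
  assumes "0 \<le> x" "x \<le> m" "0 \<le> y" "y \<le> m"
  shows "0 \<le> wt s x y n" "wt s x y n \<le> m ^ n"
proof -
  show "0 \<le> wt s x y n" using assms by (auto simp: wt_def intro!: prod_nonneg)
  have "wt s x y n \<le> (\<Prod>i<n. m)" unfolding wt_def using assms by (intro prod_mono) auto
  then show "wt s x y n \<le> m ^ n" by simp
qed

lemma wF_summable:
  assumes "0 \<le> x" "x \<le> m" "0 \<le> y" "y \<le> m" "m < 1"
  shows "summable (\<lambda>n. of_bool (s n) * wt s x y n)"
proof (rule summable_comparison_test[OF _ summable_geometric[of m]])
  show "\<exists>N. \<forall>n\<ge>N. norm (of_bool (s n) * wt s x y n) \<le> m ^ n"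
    using wt_bounds[OF assms(1-4), of s] assms by (auto simp: abs_mult)
qed (use assms in auto)

lemma wF_tail:
  assumes "0 \<le> x" "x \<le> m" "0 \<le> y" "y \<le> m" "m < 1"
  shows "0 \<le> wF s x y - (\<Sum>n<T. of_bool (s n) * wt s x y n)"
    and "wF s x y - (\<Sum>n<T. of_bool (s n) * wt s x y n) \<le> m ^ T / (1 - m)"
proof -
  note sm = wF_summable[OF assms, of s]
  have e: "wF s x y - (\<Sum>n<T. of_bool (s n) * wt s x y n) = (\<Sum>n. of_bool (s (n + T)) * wt s x y (n + T))"
    unfolding wF_def using suminf_split_initial_segment[OF sm, of T] by simp
  have sm': "summable (\<lambda>n. of_bool (s (n + T)) * wt s x y (n + T))"
    using sm by (subst summable_iff_shift)
  show "0 \<le> wF s x y - (\<Sum>n<T. of_bool (s n) * wt s x y n)"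
    unfolding e using wt_bounds(1)[OF assms(1-4)] by (intro suminf_nonneg sm') auto
  have "(\<Sum>n. of_bool (s (n + T)) * wt s x y (n + T)) \<le> (\<Sum>n. m ^ T * m ^ n)"
  proof (rule suminf_le[OF _ sm'])
    show "of_bool (s (n + T)) * wt s x y (n + T) \<le> m ^ T * m ^ n" for n
      using wt_bounds[OF assms(1-4), of s "n + T"] assms by (auto simp: power_add mult.commute)
    show "summable (\<lambda>n. m ^ T * m ^ n)" using assms by (intro summable_mult summable_geometric) auto
  qed
  also have "\<dots> = m ^ T / (1 - m)"
    using assms by (subst suminf_mult) (auto simp: suminf_geometric)
  finally show "wF s x y - (\<Sum>n<T. of_bool (s n) * wt s x y n) \<le> m ^ T / (1 - m)" unfolding e .
qed

lemma wF_bounds: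
  assumes "0 \<le> x" "x \<le> m" "0 \<le> y" "y \<le> m" "m < 1"
  shows "0 \<le> wF s x y" "wF s x y \<le> 1 / (1 - m)"
  using wF_tail[OF assms, of s 0] by auto

lemma wF_head:
  assumes "0 \<le> x" "x < 1" "0 \<le> y" "y < 1"
  shows "wF s x y = of_bool (s 0) + (if s 0 then y else x) * wF (\<lambda>n. s (Suc n)) x y"
proof -
  define m where "m = max x y"
  have m: "0 \<le> x" "x \<le> m" "0 \<le> y" "y \<le> m" "m < 1" using assms by (auto simp: m_def)
  have w: "wt s x y (Suc n) = (if s 0 then y else x) * wt (\<lambda>n. s (Suc n)) x y n" for n
    unfolding wt_def by (subst prod.lessThan_Suc_shift) simp
  have "wF s x y = of_bool (s 0) * wt s x y 0 + (\<Sum>n. of_bool (s (Suc n)) * wt s x y (Suc n))"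
    unfolding wF_def using suminf_split_head[OF wF_summable[OF m, of s]] by simp
  also have "(\<Sum>n. of_bool (s (Suc n)) * wt s x y (Suc n)) = (\<Sum>n. (if s 0 then y else x) * (of_bool (s (Suc n)) * wt (\<lambda>n. s (Suc n)) x y n))"
    by (simp add: w mult_ac)
  also have "\<dots> = (if s 0 then y else x) * wF (\<lambda>n. s (Suc n)) x y"
    unfolding wF_def by (rule suminf_mult[OF wF_summable[OF m]])
  finally show ?thesis by (simp add: wt_def)
qed

lemma wG_head:
  assumes "0 \<le> x" "x < 1" "0 \<le> y" "y < 1"
  shows "wG s x y = of_bool (\<not> s 0) + (if s 0 then y else x) * wG (\<lambda>n. s (Suc n)) x y"
  unfolding wG_def by (subst wF_head) (use assms in auto)

definition wP :: "(nat \<Rightarrow> bool) \<Rightarrow> nat \<Rightarrow> real poly poly" where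
  "wP s T = (\<Sum>n<T. bmonom (of_bool (s n)) (card {i. i < n \<and> \<not> s i}) (card {i. i < n \<and> s i}))"

lemma wt_eq_monomial: "wt s x y n = x ^ card {i. i < n \<and> \<not> s i} * y ^ card {i. i < n \<and> s i}"
proof (induction n)
  case (Suc n)
  have e: "{i. i < Suc n \<and> P i} = (if P n then insert n {i. i < n \<and> P i} else {i. i < n \<and> P i})" for P
    by (auto simp: less_Suc_eq)
  show ?case using Suc by (simp add: wt_def e[of s] e[of "\<lambda>i. \<not> s i"])
qed (simp add: wt_def)

lemma beval_wP: "beval (wP s T) x y = (\<Sum>n<T. of_bool (s n) * wt s x y n)"
  by (simp add: wP_def wt_eq_monomial mult_ac)

definition int_coeffs :: "real poly poly \<Rightarrow> bool" where
  "int_coeffs r \<longleftrightarrow> (\<forall>i j. bcoeff r i j \<in> \<int>)"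

lemma int_coeffs_mult: "int_coeffs r \<Longrightarrow> int_coeffs s \<Longrightarrow> int_coeffs (r * s)"
  unfolding int_coeffs_def bcoeff_mult by (auto intro!: Ints_sum Ints_mult)

lemma int_coeffs_power: "int_coeffs r \<Longrightarrow> int_coeffs (r ^ n)"
proof (induction n)
  case 0
  show ?case by (auto simp: int_coeffs_def bcoeff_def coeff_1)
qed (simp add: int_coeffs_mult)

lemma int_coeffs_wP: "int_coeffs (wP s T)"
  unfolding int_coeffs_def wP_def bcoeff_sum by (auto simp: bcoeff_bmonom intro!: Ints_sum)

text \<open>The last clause uses the truncation \<open>wP s T\<close> instead of the power series,
  so the notion depends on the first \<open>T\<close> letters only. The exponents i, j < T include
  all monomials of total degree below \<open>T\<close>.\<close>

definition aux_family :: "nat \<Rightarrow> nat \<Rightarrow> nat \<Rightarrow> (nat \<Rightarrow> bool) \<Rightarrow> (nat \<Rightarrow> real poly poly) \<Rightarrow> bool" where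
  "aux_family N D T s a \<longleftrightarrow> (\<forall>l. int_coeffs (a l) \<and> bsupp (a l) \<subseteq> {..N} \<times> {..N}) \<and>
     (\<forall>l>D. a l = 0) \<and> (\<exists>l\<le>D. a l \<noteq> 0) \<and>
     (\<forall>i<T. \<forall>j<T. bcoeff (\<Sum>l\<le>D. a l * wP s T ^ l) i j = 0)"

text \<open>There are \<open>T * T\<close> linear conditions on (N + 1)^2 (D + 1) unknown
  coefficients.\<close>

lemma aux_family_exists:
  assumes "T * T < (N + 1) * (N + 1) * (D + 1)"
  shows "\<exists>a. aux_family N D T s a"
proof -
  define I where "I = {..N} \<times> {..N} \<times> {..D}"
  define E where "E = {..<T} \<times> {..<T}"
  define K where "K = (\<lambda>(u, v) (i, j, l). \<lfloor>bcoeff (bmonom 1 i j * wP s T ^ l) u v\<rfloor>)"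
  have "card E < card I" using assms by (simp add: E_def I_def card_cartesian_product algebra_simps)
  from pigeonhole_kernel[OF _ _ this, of K] obtain c where
    c: "\<exists>i\<in>I. c i \<noteq> 0" "\<And>e. e \<in> E \<Longrightarrow> (\<Sum>i\<in>I. K e i * c i) = 0"
    by (auto simp: I_def E_def)
  define a where "a l = (if l \<le> D then (\<Sum>(i, j)\<in>{..N} \<times> {..N}. bmonom (of_int (c (i, j, l))) i j) else 0)" for l
  have cfa: "bcoeff (a l) i j = (if l \<le> D \<and> i \<le> N \<and> j \<le> N then of_int (c (i, j, l)) else 0)" for l i j
  proof (cases "l \<le> D")
    case True
    have "bcoeff (a l) i j = (\<Sum>z\<in>{..N} \<times> {..N}. if z = (i, j) then of_int (c (i, j, l)) else 0)"
      using True unfolding a_def if_P[OF True] bcoeff_sum case_prod_beta by (intro sum.cong) (auto simp: bcoeff_bmonom)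
    also have "\<dots> = (if l \<le> D \<and> i \<le> N \<and> j \<le> N then of_int (c (i, j, l)) else 0)" using True by auto
    finally show ?thesis .
  qed (simp add: a_def bcoeff_def)
  have int: "int_coeffs (bmonom 1 i j * wP s T ^ l)" for i j l
    by (intro int_coeffs_mult int_coeffs_power int_coeffs_wP) (auto simp: int_coeffs_def bcoeff_bmonom)
  have "aux_family N D T s a"
    unfolding aux_family_def
  proof (intro conjI allI impI)
    fix l
    show "int_coeffs (a l)" by (auto simp: int_coeffs_def cfa)
    show "bsupp (a l) \<subseteq> {..N} \<times> {..N}" by (auto simp: bsupp_def cfa split: if_splits)
    show "a l = 0" if "D < l" using that by (simp add: a_def)
  next
    from c(1) obtain i j l where "(i, j, l) \<in> I" "c (i, j, l) \<noteq> 0" by auto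
    then have "l \<le> D" "bcoeff (a l) i j \<noteq> 0" by (auto simp: I_def cfa)
    then show "\<exists>l\<le>D. a l \<noteq> 0" by (intro exI[of _ l]) (auto simp: bcoeff_def)
  next
    fix u v assume uv: "u < T" "v < T"
    have t: "bcoeff (a l * wP s T ^ l) u v = (\<Sum>(i, j)\<in>{..N} \<times> {..N}. of_int (K (u, v) (i, j, l) * c (i, j, l)))" if "l \<le> D" for l
    proof -
      have "a l * wP s T ^ l = (\<Sum>(i, j)\<in>{..N} \<times> {..N}. bmonom (of_int (c (i, j, l))) i j * wP s T ^ l)"
        using that by (simp add: a_def sum_distrib_right case_prod_beta)
      also have "\<dots> = (\<Sum>(i, j)\<in>{..N} \<times> {..N}. bmonom (of_int (c (i, j, l))) 0 0 * (bmonom 1 i j * wP s T ^ l))"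
        by (simp add: bmonom_mult flip: mult.assoc)
      finally have "bcoeff (a l * wP s T ^ l) u v =
        (\<Sum>(i, j)\<in>{..N} \<times> {..N}. bcoeff (bmonom (of_int (c (i, j, l))) 0 0 * (bmonom 1 i j * wP s T ^ l)) u v)"
        by (simp add: case_prod_beta)
      also have "\<dots> = (\<Sum>(i, j)\<in>{..N} \<times> {..N}. of_int (c (i, j, l)) * bcoeff (bmonom 1 i j * wP s T ^ l) u v)"
        by (simp add: bcoeff_def bmonom_def monom_0)
      also have "\<dots> = (\<Sum>(i, j)\<in>{..N} \<times> {..N}. of_int (K (u, v) (i, j, l) * c (i, j, l)))"
        using int unfolding K_def int_coeffs_def by (intro sum.cong) (auto simp: mult.commute)
      finally show ?thesis .
    qed
    have "bcoeff (\<Sum>l\<le>D. a l * wP s T ^ l) u v = (\<Sum>l\<le>D. \<Sum>(i, j)\<in>{..N} \<times> {..N}. of_int (K (u, v) (i, j, l) * c (i, j, l)))"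
      using t by simp
    also have "\<dots> = (\<Sum>z\<in>I. of_int (K (u, v) z * c z))"
      unfolding sum.cartesian_product I_def
      by (rule sum.reindex_bij_witness[of _ "\<lambda>(i, j, l). (l, i, j)" "\<lambda>(l, i, j). (i, j, l)"]) auto
    also have "\<dots> = of_int (\<Sum>z\<in>I. K (u, v) z * c z)" by simp
    also have "\<dots> = 0" using c(2)[of "(u, v)"] uv by (simp add: E_def)
    finally show "bcoeff (\<Sum>l\<le>D. a l * wP s T ^ l) u v = 0" .
  qed
  then show ?thesis by blast
qed

section \<open>Size of the auxiliary polynomial at small arguments\<close>

definition norm1 :: "real poly poly \<Rightarrow> real" where
  "norm1 r = (\<Sum>(i, j)\<in>bsupp r. \<bar>bcoeff r i j\<bar>)"

lemma norm1_nonneg: "0 \<le> norm1 r"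
  by (auto simp: norm1_def intro!: sum_nonneg)

lemma abs_beval_le_norm1:
  assumes "0 \<le> x" "x \<le> 1" "0 \<le> y" "y \<le> 1"
  shows "\<bar>beval r x y\<bar> \<le> norm1 r"
proof -
  have "\<bar>beval r x y\<bar> \<le> (\<Sum>(i, j)\<in>bsupp r. \<bar>bcoeff r i j * x ^ i * y ^ j\<bar>)"
    unfolding beval_altdef case_prod_beta by (rule sum_abs)
  also have "\<dots> \<le> norm1 r" unfolding norm1_def
  proof (rule sum_mono, clarify)
    fix i j
    have "x ^ i * y ^ j \<le> 1 * 1" using assms by (intro mult_mono power_le_one) auto
    then show "\<bar>bcoeff r i j * x ^ i * y ^ j\<bar> \<le> \<bar>bcoeff r i j\<bar>"
      using assms by (simp add: abs_mult mult.assoc mult_left_le)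
  qed
  finally show ?thesis .
qed

lemma abs_beval_le_norm1_power:
  assumes "0 \<le> x" "x \<le> m" "0 \<le> y" "y \<le> m" "m \<le> 1"
    and "\<forall>i<T. \<forall>j<T. bcoeff r i j = 0"
  shows "\<bar>beval r x y\<bar> \<le> norm1 r * m ^ T"
proof -
  have "\<bar>beval r x y\<bar> \<le> (\<Sum>(i, j)\<in>bsupp r. \<bar>bcoeff r i j * x ^ i * y ^ j\<bar>)"
    unfolding beval_altdef case_prod_beta by (rule sum_abs)
  also have "\<dots> \<le> (\<Sum>(i, j)\<in>bsupp r. \<bar>bcoeff r i j\<bar> * m ^ T)"
  proof (rule sum_mono, clarify)
    fix i j assume "(i, j) \<in> bsupp r"
    then have ij: "T \<le> i + j" using assms(6) by (metis (mono_tags, lifting) case_prodD leI mem_Collect_eq bsupp_def trans_le_add1 trans_le_add2)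
    have "x ^ i * y ^ j \<le> m ^ i * m ^ j" using assms by (intro mult_mono power_mono) auto
    also have "\<dots> = m ^ (i + j)" by (simp add: power_add)
    also have "\<dots> \<le> m ^ T" using assms ij by (intro power_decreasing) auto
    finally show "\<bar>bcoeff r i j * x ^ i * y ^ j\<bar> \<le> \<bar>bcoeff r i j\<bar> * m ^ T"
      using assms by (simp add: abs_mult mult.assoc mult_left_mono)
  qed
  also have "\<dots> = norm1 r * m ^ T" by (simp add: norm1_def sum_distrib_right case_prod_beta)
  finally show ?thesis .
qed

lemma power_diff_le:
  fixes a b B :: real
  assumes "\<bar>a\<bar> \<le> B" "\<bar>b\<bar> \<le> B" "1 \<le> B"
  shows "\<bar>a ^ l - b ^ l\<bar> \<le> real l * B ^ l * \<bar>a - b\<bar>"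
proof (induction l)
  case (Suc l)
  have "a ^ Suc l - b ^ Suc l = a * (a ^ l - b ^ l) + (a - b) * b ^ l" by (simp add: algebra_simps)
  then have "\<bar>a ^ Suc l - b ^ Suc l\<bar> \<le> \<bar>a\<bar> * \<bar>a ^ l - b ^ l\<bar> + \<bar>a - b\<bar> * \<bar>b ^ l\<bar>"
    by (metis abs_mult abs_triangle_ineq)
  also have "\<dots> \<le> B * (real l * B ^ l * \<bar>a - b\<bar>) + \<bar>a - b\<bar> * B ^ l"
    using Suc assms power_mono[of "\<bar>b\<bar>" B l] by (intro add_mono mult_mono) (auto simp: power_abs)
  also have "\<bar>a - b\<bar> * B ^ l \<le> \<bar>a - b\<bar> * B ^ Suc l" using assms by (intro mult_left_mono power_increasing) auto
  finally show ?case by (simp add: algebra_simps)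
qed simp

text \<open>At the truncation only monomials of total degree at least \<open>T\<close> survive;
  replacing the truncation by the series changes its value by at most 2 m^T. The factor in front of
  m^T depends on \<open>a\<close> and on the first \<open>T\<close> letters, not on x, y.\<close>

lemma aux_family_small:
  assumes a: "aux_family N D T s a" and m: "0 \<le> x" "x \<le> m" "0 \<le> y" "y \<le> m" "m \<le> 1/2"
  shows "\<bar>\<Sum>l\<le>D. beval (a l) x y * wF s x y ^ l\<bar> \<le>
    (norm1 (\<Sum>l\<le>D. a l * wP s T ^ l) + (\<Sum>l\<le>D. norm1 (a l) * (real l * 2 ^ l * 2))) * m ^ T"
proof -
  define P where "P = beval (wP s T) x y"
  define F where "F = wF s x y"
  have m1: "m < 1" "m \<le> 1" using m by auto
  have "m ^ T / (1 - m) \<le> m ^ T / (1/2)" using m by (intro divide_left_mono) auto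
  then have "m ^ T / (1 - m) \<le> 2 * m ^ T" by simp
  then have FP: "\<bar>F - P\<bar> \<le> 2 * m ^ T"
    using wF_tail[OF m(1-4) m1(1), of s T] unfolding F_def P_def beval_wP by linarith
  have "1 / (1 - m) \<le> 1 / (1/2)" using m by (intro divide_left_mono) auto
  then have "1 / (1 - m) \<le> 2" by simp
  then have F2: "\<bar>F\<bar> \<le> 2" "0 \<le> F" using wF_bounds[OF m(1-4) m1(1), of s] unfolding F_def by linarith+
  have P0: "0 \<le> P" unfolding P_def beval_wP using wt_bounds(1)[OF m(1-4)] by (intro sum_nonneg) auto
  have P2: "\<bar>P\<bar> \<le> 2" using P0 F2 wF_tail(1)[OF m(1-4) m1(1), of s T] unfolding F_def P_def beval_wP by linarith
  have "(\<Sum>l\<le>D. beval (a l) x y * F ^ l) = beval (\<Sum>l\<le>D. a l * wP s T ^ l) x y + (\<Sum>l\<le>D. beval (a l) x y * (F ^ l - P ^ l))"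
    by (simp add: P_def right_diff_distrib sum_subtractf)
  moreover have "\<bar>beval (\<Sum>l\<le>D. a l * wP s T ^ l) x y\<bar> \<le> norm1 (\<Sum>l\<le>D. a l * wP s T ^ l) * m ^ T"
    by (rule abs_beval_le_norm1_power[OF m(1-4) m1(2)]) (use a in \<open>auto simp: aux_family_def simp del: bcoeff_sum\<close>)
  moreover have "\<bar>\<Sum>l\<le>D. beval (a l) x y * (F ^ l - P ^ l)\<bar> \<le> (\<Sum>l\<le>D. norm1 (a l) * (real l * 2 ^ l * 2)) * m ^ T"
  proof -
    have "\<bar>\<Sum>l\<le>D. beval (a l) x y * (F ^ l - P ^ l)\<bar> \<le> (\<Sum>l\<le>D. \<bar>beval (a l) x y * (F ^ l - P ^ l)\<bar>)" by (rule sum_abs)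
    also have "\<dots> \<le> (\<Sum>l\<le>D. norm1 (a l) * (real l * 2 ^ l * 2 * m ^ T))"
    proof (rule sum_mono)
      fix l
      have "\<bar>F ^ l - P ^ l\<bar> \<le> real l * 2 ^ l * \<bar>F - P\<bar>" using F2 P2 by (intro power_diff_le) auto
      also have "\<dots> \<le> real l * 2 ^ l * (2 * m ^ T)" using FP by (intro mult_left_mono) auto
      finally show "\<bar>beval (a l) x y * (F ^ l - P ^ l)\<bar> \<le> norm1 (a l) * (real l * 2 ^ l * 2 * m ^ T)"
        unfolding abs_mult using m abs_beval_le_norm1[of x y "a l"] by (intro mult_mono norm1_nonneg) (auto simp: mult_ac)
    qed
    also have "\<dots> = (\<Sum>l\<le>D. norm1 (a l) * (real l * 2 ^ l * 2)) * m ^ T" by (simp add: sum_distrib_right mult.assoc)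
    finally show ?thesis .
  qed
  ultimately show ?thesis unfolding F_def[symmetric] by (simp add: distrib_right)
qed

lemma wP_cong:
  assumes "\<And>i. i < T \<Longrightarrow> s i = s' i"
  shows "wP s T = wP s' T"
proof -
  have "{i. i < n \<and> s i} = {i. i < n \<and> s' i}" "{i. i < n \<and> \<not> s i} = {i. i < n \<and> \<not> s' i}" if "n < T" for n
    using assms that by auto
  then show ?thesis unfolding wP_def using assms by (intro sum.cong) auto
qed

section \<open>Desubstitution\<close>

text \<open>The exchange of two intervals of lengths \<open>b\<close> and \<open>a\<close>; with \<open>a = \<theta>\<close>, \<open>b = 1 - \<theta>\<close> it is the rotation by
  \<open>\<theta>\<close>, and the coding \<open>sw\<close> of an orbit is a Sturmian word.\<close>

definition rot :: "real \<Rightarrow> real \<Rightarrow> real \<Rightarrow> real" where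
  "rot a b x = (if x < b then x + a else x - b)"

definition sw :: "real \<Rightarrow> real \<Rightarrow> real \<Rightarrow> nat \<Rightarrow> bool" where
  "sw a b x n \<longleftrightarrow> b \<le> (rot a b ^^ n) x"

lemma sw_Suc: "(\<lambda>n. sw a b x (Suc n)) = sw a b (rot a b x)"
  by (simp add: sw_def fun_eq_iff funpow_Suc_right del: funpow.simps)

lemma sw_0: "sw a b x 0 \<longleftrightarrow> b \<le> x"
  by (simp add: sw_def)

locale unit_pair =
  fixes x y :: real
  assumes xy: "0 \<le> x" "x < 1" "0 \<le> y" "y < 1"
begin

lemma F_lt: "s < b \<Longrightarrow> wF (sw a b s) x y = x * wF (sw a b (s + a)) x y"
  and F_ge: "b \<le> s \<Longrightarrow> wF (sw a b s) x y = 1 + y * wF (sw a b (s - b)) x y"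
  and G_lt: "s < b \<Longrightarrow> wG (sw a b s) x y = 1 + x * wG (sw a b (s + a)) x y"
  and G_ge: "b \<le> s \<Longrightarrow> wG (sw a b s) x y = y * wG (sw a b (s - b)) x y"
  using wF_head[OF xy, of "sw a b s"] wG_head[OF xy, of "sw a b s"]
  by (simp_all add: sw_Suc sw_0 rot_def)

lemma F_bounded: "\<bar>wF s x y\<bar> \<le> 1 / (1 - max x y)"
  and G_bounded: "\<bar>wG s x y\<bar> \<le> 1 / (1 - max x y)"
  using wF_bounds[of x "max x y" y s] wF_bounds[of y "max x y" x "\<lambda>n. \<not> s n"] xy
  by (auto simp: wG_def)

end

text \<open>Iterating the inequality gives |D s| \<le> q^n B for all n. It yields uniqueness of
  bounded solutions of recursions along an orbit.\<close>

lemma contraction_zero: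
  fixes D :: "'a \<Rightarrow> real"
  assumes bnd: "\<And>s. s \<in> S \<Longrightarrow> \<bar>D s\<bar> \<le> B" and q: "0 \<le> q" "q < 1"
    and con: "\<And>s. s \<in> S \<Longrightarrow> \<exists>s'\<in>S. \<bar>D s\<bar> \<le> q * \<bar>D s'\<bar>" and s: "s \<in> S"
  shows "D s = 0"
proof -
  have "\<forall>s\<in>S. \<bar>D s\<bar> \<le> q ^ n * B" for n
  proof (induction n)
    case (Suc n)
    show ?case
    proof
      fix s assume "s \<in> S"
      then obtain s' where s': "s' \<in> S" "\<bar>D s\<bar> \<le> q * \<bar>D s'\<bar>" using con by blast
      then have "q * \<bar>D s'\<bar> \<le> q * (q ^ n * B)" using Suc q by (intro mult_left_mono) auto
      then show "\<bar>D s\<bar> \<le> q ^ Suc n * B" using s' by simp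
    qed
  qed (use bnd in auto)
  then have le: "\<bar>D s\<bar> \<le> q ^ n * B" for n using s by blast
  have "(\<lambda>n. q ^ n * B) \<longlonglongrightarrow> 0 * B" using q by (intro tendsto_intros LIMSEQ_power_zero) auto
  then have "\<bar>D s\<bar> \<le> 0 * B" using le by (intro LIMSEQ_le_const) auto
  then show ?thesis by simp
qed

lemma abs_mult_le_of_eq:
  "u = c * v \<Longrightarrow> 0 \<le> c \<Longrightarrow> c \<le> q \<Longrightarrow> \<bar>u\<bar> \<le> q * \<bar>v\<bar>" for u c v q :: real
  by (simp add: abs_mult mult_right_mono)

context unit_pair
begin

lemma pair1: "unit_pair x (x * y)" and pair2: "unit_pair (x * y) y"
  using xy mult_strict_mono'[of x 1 y 1] by (auto simp: unit_pair_def mult_less_cancel_left1)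

lemma xy_le: "x \<le> max x y" "y \<le> max x y" "x * y \<le> max x y" "0 \<le> x * y" "max x y < 1" "0 \<le> max x y"
  using xy mult_left_le[of y x] by (auto simp: mult.commute)

text \<open>The n-th letter contributes \<open>wt n - wt (n + 1)\<close>, so the sum telescopes to
  1. In terms of recursions, the error at a point is x or y times the error at the next one.\<close>

lemma ell_eq_1: "(1 - y) * wF (sw a b s) x y + (1 - x) * wG (sw a b s) x y = 1"
proof -
  define D where "D s = (1 - y) * wF (sw a b s) x y + (1 - x) * wG (sw a b s) x y - 1" for s
  define B where "B = 1 / (1 - max x y)"
  have "D s = 0"
  proof (rule contraction_zero[where D = D and s = s and S = UNIV and q = "max x y" and B = "B + B + 1"])
    fix s
    have "\<bar>1 - y\<bar> * \<bar>wF (sw a b s) x y\<bar> \<le> 1 * B" "\<bar>1 - x\<bar> * \<bar>wG (sw a b s) x y\<bar> \<le> 1 * B"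
      using xy F_bounded[of "sw a b s"] G_bounded[of "sw a b s"] unfolding B_def[symmetric]
      by (intro mult_mono; simp)+
    then have "\<bar>(1 - y) * wF (sw a b s) x y\<bar> \<le> B" "\<bar>(1 - x) * wG (sw a b s) x y\<bar> \<le> B"
      by (simp_all add: abs_mult)
    then show "\<bar>D s\<bar> \<le> B + B + 1" unfolding D_def by linarith
    show "\<exists>s'\<in>UNIV. \<bar>D s\<bar> \<le> max x y * \<bar>D s'\<bar>"
    proof (cases "s < b")
      case True
      then have "D s = x * D (s + a)" by (simp add: D_def F_lt G_lt algebra_simps)
      then have "\<bar>D s\<bar> \<le> max x y * \<bar>D (s + a)\<bar>" by (rule abs_mult_le_of_eq) (use xy xy_le in auto)
      then show ?thesis by blast
    next
      case False
      then have "D s = y * D (s - b)" by (simp add: D_def F_ge G_ge algebra_simps)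
      then have "\<bar>D s\<bar> \<le> max x y * \<bar>D (s - b)\<bar>" by (rule abs_mult_le_of_eq) (use xy xy_le in auto)
      then show ?thesis by blast
    qed
  qed (use xy_le in auto)
  then show ?thesis by (simp add: D_def)
qed

text \<open>Reading off the first letter determines a bounded function on the orbits, so an identity
  between generating functions of two words follows from one check per letter.\<close>

lemma word_recursion_unique:
  assumes ab: "0 < a" "0 < b"
    and lt: "\<And>s. 0 \<le> s \<Longrightarrow> s < b \<Longrightarrow> P s = d + x * P (s + a)"
    and ge: "\<And>s. b \<le> s \<Longrightarrow> s < a + b \<Longrightarrow> P s = c + y * P (s - b)"
    and bnd: "\<And>s. \<bar>P s\<bar> \<le> B" and s: "0 \<le> s" "s < a + b"
  shows "P s = c * wF (sw a b s) x y + d * wG (sw a b s) x y"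
proof -
  define Q where "Q s = c * wF (sw a b s) x y + d * wG (sw a b s) x y" for s
  define B' where "B' = (\<bar>c\<bar> + \<bar>d\<bar>) * (1 / (1 - max x y))"
  have "P s - Q s = 0"
  proof (rule contraction_zero[where D = "\<lambda>s. P s - Q s" and s = s and S = "{0..<a + b}" and q = "max x y" and B = "B + B'"])
    fix s assume s: "s \<in> {0..<a + b}"
    have "\<bar>c\<bar> * \<bar>wF (sw a b s) x y\<bar> + \<bar>d\<bar> * \<bar>wG (sw a b s) x y\<bar> \<le> B'"
      unfolding B'_def distrib_right by (intro add_mono mult_left_mono F_bounded G_bounded) auto
    then have "\<bar>Q s\<bar> \<le> B'" unfolding Q_def using abs_triangle_ineq[of "c * wF (sw a b s) x y" "d * wG (sw a b s) x y"]
      by (simp add: abs_mult)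
    then show "\<bar>P s - Q s\<bar> \<le> B + B'" using bnd[of s] by linarith
    show "\<exists>s'\<in>{0..<a + b}. \<bar>P s - Q s\<bar> \<le> max x y * \<bar>P s' - Q s'\<bar>"
    proof (cases "s < b")
      case True
      then have "P s - Q s = x * (P (s + a) - Q (s + a))"
        using s lt[of s] F_lt[of s b a] G_lt[of s b a] by (simp add: Q_def algebra_simps)
      then have "\<bar>P s - Q s\<bar> \<le> max x y * \<bar>P (s + a) - Q (s + a)\<bar>"
        by (rule abs_mult_le_of_eq) (use xy xy_le in auto)
      then show ?thesis using s True ab by (intro bexI[of _ "s + a"]) auto
    next
      case False
      then have "P s - Q s = y * (P (s - b) - Q (s - b))"
        using s ge[of s] F_ge[of b s a] G_ge[of b s a] by (simp add: Q_def algebra_simps not_less)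
      then have "\<bar>P s - Q s\<bar> \<le> max x y * \<bar>P (s - b) - Q (s - b)\<bar>"
        by (rule abs_mult_le_of_eq) (use xy xy_le in auto)
      then show ?thesis using s False ab by (intro bexI[of _ "s - b"]) auto
    qed
  qed (use s xy_le in auto)
  then show ?thesis by (simp add: Q_def)
qed

text \<open>Rauzy induction: for a < b the first return map to [a, a + b), shifted by a, is the
  exchange with lengths b - a and a. Points with letter 1 leave the interval for one step of letter
  0, whence 1 becomes 10. The next three lemmas treat return maps to [0, b), [0, a) and [b, a + b),
  with 01, 01 and 10.\<close>

lemma desub_L0:
  assumes "0 < a" "a < b" "0 \<le> s" "s < b"
  shows "wF (sw a b (s + a)) x y = wF (sw a (b - a) s) x (x * y)"
    and "wG (sw a b (s + a)) x y = y * wF (sw a (b - a) s) x (x * y) + wG (sw a (b - a) s) x (x * y)"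
proof -
  interpret n: unit_pair "x" "x * y" by (rule pair1)
  have "wF (sw a b (s + a)) x y = 1 * wF (sw a (b - a) s) x (x * y) + 0 * wG (sw a (b - a) s) x (x * y)"
  proof (rule n.word_recursion_unique[where P = "\<lambda>s. wF (sw a b (s + a)) x y", OF _ _ _ _ F_bounded])
    show "wF (sw a b (s + a)) x y = 0 + x * wF (sw a b (s + a + a)) x y" if "0 \<le> s" "s < (b - a)" for s
      using that assms F_lt[of "s + a" b a] by (simp add: algebra_simps)
    show "wF (sw a b (s + a)) x y = 1 + x * y * wF (sw a b (s - (b - a) + a)) x y" if "(b - a) \<le> s" "s < a + (b - a)" for s
      using that assms F_ge[of b "s + a" a] F_lt[of "s + a - b" b a] by (simp add: algebra_simps)
  qed (use assms in auto)
  then show "wF (sw a b (s + a)) x y = wF (sw a (b - a) s) x (x * y)" by simp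
  have "wG (sw a b (s + a)) x y = y * wF (sw a (b - a) s) x (x * y) + 1 * wG (sw a (b - a) s) x (x * y)"
  proof (rule n.word_recursion_unique[where P = "\<lambda>s. wG (sw a b (s + a)) x y", OF _ _ _ _ G_bounded])
    show "wG (sw a b (s + a)) x y = 1 + x * wG (sw a b (s + a + a)) x y" if "0 \<le> s" "s < (b - a)" for s
      using that assms G_lt[of "s + a" b a] by (simp add: algebra_simps)
    show "wG (sw a b (s + a)) x y = y + x * y * wG (sw a b (s - (b - a) + a)) x y" if "(b - a) \<le> s" "s < a + (b - a)" for s
      using that assms G_ge[of b "s + a" a] G_lt[of "s + a - b" b a] by (simp add: algebra_simps)
  qed (use assms in auto)
  then show "wG (sw a b (s + a)) x y = y * wF (sw a (b - a) s) x (x * y) + wG (sw a (b - a) s) x (x * y)" by simp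
qed

lemma desub_R0:
  assumes "0 < a" "a < b" "0 \<le> s" "s < b"
  shows "wF (sw a b s) x y = x * wF (sw a (b - a) s) x (x * y)"
    and "wG (sw a b s) x y = wF (sw a (b - a) s) x (x * y) + wG (sw a (b - a) s) x (x * y)"
proof -
  interpret n: unit_pair "x" "x * y" by (rule pair1)
  have "wF (sw a b (s)) x y = x * wF (sw a (b - a) s) x (x * y) + 0 * wG (sw a (b - a) s) x (x * y)"
  proof (rule n.word_recursion_unique[where P = "\<lambda>s. wF (sw a b (s)) x y", OF _ _ _ _ F_bounded])
    show "wF (sw a b (s)) x y = 0 + x * wF (sw a b (s + a)) x y" if "0 \<le> s" "s < (b - a)" for s
      using that assms F_lt[of "s" b a] by (simp add: algebra_simps)
    show "wF (sw a b (s)) x y = x + x * y * wF (sw a b (s - (b - a))) x y" if "(b - a) \<le> s" "s < a + (b - a)" for s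
      using that assms F_lt[of "s" b a] F_ge[of b "s + a" a] by (simp add: algebra_simps)
  qed (use assms in auto)
  then show "wF (sw a b s) x y = x * wF (sw a (b - a) s) x (x * y)" by simp
  have "wG (sw a b (s)) x y = 1 * wF (sw a (b - a) s) x (x * y) + 1 * wG (sw a (b - a) s) x (x * y)"
  proof (rule n.word_recursion_unique[where P = "\<lambda>s. wG (sw a b (s)) x y", OF _ _ _ _ G_bounded])
    show "wG (sw a b (s)) x y = 1 + x * wG (sw a b (s + a)) x y" if "0 \<le> s" "s < (b - a)" for s
      using that assms G_lt[of "s" b a] by (simp add: algebra_simps)
    show "wG (sw a b (s)) x y = 1 + x * y * wG (sw a b (s - (b - a))) x y" if "(b - a) \<le> s" "s < a + (b - a)" for s
      using that assms G_lt[of "s" b a] G_ge[of b "s + a" a] by (simp add: algebra_simps)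
  qed (use assms in auto)
  then show "wG (sw a b s) x y = wF (sw a (b - a) s) x (x * y) + wG (sw a (b - a) s) x (x * y)" by simp
qed

lemma desub_L1:
  assumes "0 < b" "b < a" "0 \<le> s" "s < a"
  shows "wF (sw a b s) x y = wF (sw (a - b) b s) (x * y) y + x * wG (sw (a - b) b s) (x * y) y"
    and "wG (sw a b s) x y = wG (sw (a - b) b s) (x * y) y"
proof -
  interpret n: unit_pair "x * y" "y" by (rule pair2)
  have "wF (sw a b (s)) x y = 1 * wF (sw (a - b) b s) (x * y) y + x * wG (sw (a - b) b s) (x * y) y"
  proof (rule n.word_recursion_unique[where P = "\<lambda>s. wF (sw a b (s)) x y", OF _ _ _ _ F_bounded])
    show "wF (sw a b (s)) x y = x + x * y * wF (sw a b (s + (a - b))) x y" if "0 \<le> s" "s < b" for s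
      using that assms F_lt[of "s" b a] F_ge[of b "s + a" a] by (simp add: algebra_simps)
    show "wF (sw a b (s)) x y = 1 + y * wF (sw a b (s - b)) x y" if "b \<le> s" "s < (a - b) + b" for s
      using that assms F_ge[of b "s" a] by (simp add: algebra_simps)
  qed (use assms in auto)
  then show "wF (sw a b s) x y = wF (sw (a - b) b s) (x * y) y + x * wG (sw (a - b) b s) (x * y) y" by simp
  have "wG (sw a b (s)) x y = 0 * wF (sw (a - b) b s) (x * y) y + 1 * wG (sw (a - b) b s) (x * y) y"
  proof (rule n.word_recursion_unique[where P = "\<lambda>s. wG (sw a b (s)) x y", OF _ _ _ _ G_bounded])
    show "wG (sw a b (s)) x y = 1 + x * y * wG (sw a b (s + (a - b))) x y" if "0 \<le> s" "s < b" for s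
      using that assms G_lt[of "s" b a] G_ge[of b "s + a" a] by (simp add: algebra_simps)
    show "wG (sw a b (s)) x y = 0 + y * wG (sw a b (s - b)) x y" if "b \<le> s" "s < (a - b) + b" for s
      using that assms G_ge[of b "s" a] by (simp add: algebra_simps)
  qed (use assms in auto)
  then show "wG (sw a b s) x y = wG (sw (a - b) b s) (x * y) y" by simp
qed

lemma desub_R1:
  assumes "0 < b" "b < a" "0 \<le> s" "s < a"
  shows "wF (sw a b (s + b)) x y = wF (sw (a - b) b s) (x * y) y + wG (sw (a - b) b s) (x * y) y"
    and "wG (sw a b (s + b)) x y = y * wG (sw (a - b) b s) (x * y) y"
proof -
  interpret n: unit_pair "x * y" "y" by (rule pair2)
  have "wF (sw a b (s + b)) x y = 1 * wF (sw (a - b) b s) (x * y) y + 1 * wG (sw (a - b) b s) (x * y) y"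
  proof (rule n.word_recursion_unique[where P = "\<lambda>s. wF (sw a b (s + b)) x y", OF _ _ _ _ F_bounded])
    show "wF (sw a b (s + b)) x y = 1 + x * y * wF (sw a b (s + (a - b) + b)) x y" if "0 \<le> s" "s < b" for s
      using that assms F_ge[of b "s + b" a] F_lt[of "s" b a] by (simp add: algebra_simps)
    show "wF (sw a b (s + b)) x y = 1 + y * wF (sw a b (s - b + b)) x y" if "b \<le> s" "s < (a - b) + b" for s
      using that assms F_ge[of b "s + b" a] by (simp add: algebra_simps)
  qed (use assms in auto)
  then show "wF (sw a b (s + b)) x y = wF (sw (a - b) b s) (x * y) y + wG (sw (a - b) b s) (x * y) y" by simp
  have "wG (sw a b (s + b)) x y = 0 * wF (sw (a - b) b s) (x * y) y + y * wG (sw (a - b) b s) (x * y) y"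
  proof (rule n.word_recursion_unique[where P = "\<lambda>s. wG (sw a b (s + b)) x y", OF _ _ _ _ G_bounded])
    show "wG (sw a b (s + b)) x y = y + x * y * wG (sw a b (s + (a - b) + b)) x y" if "0 \<le> s" "s < b" for s
      using that assms G_ge[of b "s + b" a] G_lt[of "s" b a] by (simp add: algebra_simps)
    show "wG (sw a b (s + b)) x y = 0 + y * wG (sw a b (s - b + b)) x y" if "b \<le> s" "s < (a - b) + b" for s
      using that assms G_ge[of b "s + b" a] by (simp add: algebra_simps)
  qed (use assms in auto)
  then show "wG (sw a b (s + b)) x y = y * wG (sw (a - b) b s) (x * y) y" by simp
qed

end

text \<open>Of the two intervals of length max(a, b) at the ends of [0, a + b), one containing
  \<open>s\<close> is taken for the induction, so the word itself and not a shift of it is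
  desubstituted.\<close>

fun nxt :: "real \<times> real \<times> real \<Rightarrow> real \<times> real \<times> real" where
  "nxt (a, b, s) = (if a < b then (a, b - a, if s < b then s else s - a)
     else (a - b, b, if b \<le> s then s - b else s))"

fun stype :: "real \<times> real \<times> real \<Rightarrow> bool \<times> bool" where
  "stype (a, b, s) = (\<not> a < b, if a < b then s < b else b \<le> s)"

fun valid :: "real \<times> real \<times> real \<Rightarrow> bool" where
  "valid (a, b, s) \<longleftrightarrow> 0 < a \<and> 0 < b \<and> a / b \<notin> \<rat> \<and> 0 \<le> s \<and> s < a + b"

fun wrd :: "real \<times> real \<times> real \<Rightarrow> nat \<Rightarrow> bool" where
  "wrd (a, b, s) = sw a b s"

lemma valid_neq: "valid (a, b, s) \<Longrightarrow> a \<noteq> b"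
  by auto

lemma valid_nxt: "valid t \<Longrightarrow> valid (nxt t)"
proof -
  assume v: "valid t"
  obtain a b s where t: "t = (a, b, s)" by (cases t)
  have ab: "0 < a" "0 < b" "a / b \<notin> \<rat>" "a \<noteq> b" using v valid_neq[of a b s] by (auto simp: t)
  have "a / (b - a) \<notin> \<rat>" if "a < b"
  proof
    assume r: "a / (b - a) \<in> \<rat>"
    define r where "r = a / (b - a)"
    have "0 < r" "a = r * (b - a)" using that ab by (auto simp: r_def)
    then have "a / b = r / (1 + r)" using ab by (simp add: field_simps)
    moreover have "r \<in> \<rat>" using r by (simp add: r_def)
    then have "r / (1 + r) \<in> \<rat>" by (intro Rats_divide Rats_add) auto
    ultimately show False using ab by simp
  qed
  moreover have "(a - b) / b \<notin> \<rat>"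
  proof
    assume "(a - b) / b \<in> \<rat>"
    then have "(a - b) / b + 1 \<in> \<rat>" by simp
    also have "(a - b) / b + 1 = a / b" using ab by (simp add: field_simps)
    finally show False using ab by simp
  qed
  ultimately show ?thesis using v ab by (auto simp: t)
qed

lemma rstep_word:
  assumes v: "valid t" and xy: "0 \<le> x" "x < 1" "0 \<le> y" "y < 1"
  shows "\<exists>X Y D. rstep (stype t) (x, y, d * c * wF (wrd t) x y, d * c * wG (wrd t) x y, d)
     = (X, Y, D * c * wF (wrd (nxt t)) X Y, D * c * wG (wrd (nxt t)) X Y, D)"
proof -
  obtain a b s where t: "t = (a, b, s)" by (cases t)
  have ab: "0 < a" "0 < b" "a \<noteq> b" "0 \<le> s" "s < a + b" using v valid_neq[of a b s] by (auto simp: t)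
  interpret unit_pair x y using xy by unfold_locales
  consider "a < b" "b \<le> s" | "a < b" "s < b" | "b < a" "s < b" | "b < a" "b \<le> s" using ab by linarith
  then show ?thesis
  proof cases
    case 1
    then have h: "0 < a" "a < b" "0 \<le> s - a" "s - a < b" using ab by auto
    show ?thesis using desub_L0[OF h] 1
      by (simp add: t algebra_simps)
  next
    case 2
    then have h: "0 < a" "a < b" "0 \<le> s" "s < b" using ab by auto
    show ?thesis using desub_R0[OF h] 2
      by (auto simp: t algebra_simps)
  next
    case 3
    then have h: "0 < b" "b < a" "0 \<le> s" "s < a" using ab by auto
    show ?thesis using desub_L1[OF h] 3
      by (auto simp: t algebra_simps)
  next
    case 4
    then have h: "0 < b" "b < a" "0 \<le> s - b" "s - b < a" using ab by auto
    show ?thesis using desub_R1[OF h] 4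
      by (auto simp: t algebra_simps)
  qed
qed

section \<open>Continued fractions and Sturmian words\<close>

text \<open>The quantity whose continued fraction is developed; \<open>p\<close> records which of
  the two lengths is the numerator, and it changes at the end of each run of equal steps.\<close>

fun ratio :: "bool \<Rightarrow> real \<times> real \<times> real \<Rightarrow> real" where
  "ratio p (a, b, s) = (if p then b / a else a / b)"

lemma ratio_Not: "ratio (\<not> p) t = 1 / ratio p t"
  by (cases t) auto

lemma stype_ratio: "valid t \<Longrightarrow> 1 < ratio p t \<Longrightarrow> fst (stype t) = (\<not> p)"
  by (cases t; cases p) auto

lemma ratio_nxt: "valid t \<Longrightarrow> 1 < ratio p t \<Longrightarrow> ratio p (nxt t) = ratio p t - 1"
  by (cases t; cases p) (auto simp: field_simps)

lemma valid_funpow: "valid t \<Longrightarrow> valid ((nxt ^^ k) t)"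
  by (induction k) (auto simp: valid_nxt)

lemma ratio_run:
  assumes "valid t" "\<And>i. i < j \<Longrightarrow> 1 < ratio p t - real i"
  shows "ratio p ((nxt ^^ j) t) = ratio p t - real j"
  using assms(2)
proof (induction j)
  case (Suc j)
  have "ratio p ((nxt ^^ j) t) = ratio p t - real j" using Suc by simp
  then show ?case using ratio_nxt[OF valid_funpow[OF assms(1), of j], of p] Suc.prems[of j] by simp
qed simp

lemma cf_tail_Suc: "cf_tail \<theta> (Suc n) = frac (1 / cf_tail \<theta> n)"
  by (simp add: cf_tail_def)

lemma cf_tail_bounds:
  assumes "0 < \<theta>" "\<theta> < 1" "\<theta> \<notin> \<rat>"
  shows "0 < cf_tail \<theta> n \<and> cf_tail \<theta> n < 1 \<and> cf_tail \<theta> n \<notin> \<rat>"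
proof (induction n)
  case 0
  then show ?case using assms by (simp add: cf_tail_def)
next
  case (Suc n)
  define x where "x = 1 / cf_tail \<theta> n"
  have x: "x \<notin> \<rat>"
  proof
    assume "x \<in> \<rat>"
    then have "1 / x \<in> \<rat>" by simp
    then show False using Suc by (simp add: x_def)
  qed
  have f: "frac x \<notin> \<rat>"
  proof
    assume "frac x \<in> \<rat>"
    then have "frac x + of_int \<lfloor>x\<rfloor> \<in> \<rat>" by (intro Rats_add) auto
    then show False using x by (simp add: frac_def)
  qed
  then have "frac x \<noteq> 0" by (metis Rats_0)
  then show ?case using f frac_ge_0[of x] frac_lt_1[of x] by (simp add: cf_tail_Suc x_def)
qed

lemma partial_quotient_Suc: "real_of_int (partial_quotient \<theta> (Suc n)) = 1 / cf_tail \<theta> n - cf_tail \<theta> (Suc n)"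
  by (simp add: partial_quotient_def cf_tail_Suc frac_def)

text \<open>Lower and upper words start from the lengths \<theta> and 1 - \<theta> in opposite
  order, which \<open>p0\<close> records. The initial ratio is 1 / \<theta> - 1, so one step of the
  first run counts as done.\<close>

locale sturm_state =
  fixes \<theta> :: real and t0 :: "real \<times> real \<times> real" and p0 :: bool
  assumes \<theta>: "0 < \<theta>" "\<theta> < 1" "\<theta> \<notin> \<rat>" and t0: "valid t0" "ratio p0 t0 = 1 / \<theta> - 1"
begin

abbreviation T where "T \<equiv> cf_tail \<theta>"

definition pq :: "nat \<Rightarrow> nat" where "pq n = nat (partial_quotient \<theta> n)"

lemma T: "0 < T n" "T n < 1" "T n \<notin> \<rat>"
  using cf_tail_bounds[OF \<theta>] by auto

lemma pq_Suc: "real (pq (Suc n)) = 1 / T n - T (Suc n)" and pq_pos: "1 \<le> pq (Suc n)"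
proof -
  have "1 < 1 / T n" using T[of n] by simp
  then have "real_of_int (partial_quotient \<theta> (Suc n)) > 0"
    using partial_quotient_Suc[of \<theta> n] T[of "Suc n"] by linarith
  then have pos: "0 < partial_quotient \<theta> (Suc n)" by simp
  then show "real (pq (Suc n)) = 1 / T n - T (Suc n)" using partial_quotient_Suc[of \<theta> n] by (simp add: pq_def)
  show "1 \<le> pq (Suc n)" using pos by (simp add: pq_def)
qed

definition ST :: "nat \<Rightarrow> real \<times> real \<times> real" where "ST k = (nxt ^^ k) t0"

lemma valid_ST: "valid (ST k)"
  unfolding ST_def by (rule valid_funpow[OF t0(1)])

lemma ST_add: "ST (k + j) = (nxt ^^ j) (ST k)"
  by (simp add: ST_def funpow_add add.commute[of k j])

text \<open>The remaining subtractions of the run leave the ratio \<open>T (Suc n)\<close> < 1; its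
  reciprocal opens the next run with the roles of the lengths exchanged.\<close>

lemma run_start:
  assumes "ratio p (ST k) = 1 / T n - real i" "i \<le> pq (Suc n)"
  shows "ratio (\<not> p) (ST (k + (pq (Suc n) - i))) = 1 / T (Suc n)"
proof -
  have "ratio p (ST (k + (pq (Suc n) - i))) = ratio p (ST k) - real (pq (Suc n) - i)"
    unfolding ST_add
  proof (rule ratio_run[OF valid_ST])
    fix j assume "j < pq (Suc n) - i"
    then have "real i + real j + 1 \<le> real (pq (Suc n))" by linarith
    then show "1 < ratio p (ST k) - real j" using assms pq_Suc[of n] T[of "Suc n"] by linarith
  qed
  also have "\<dots> = T (Suc n)" using assms pq_Suc[of n] by (simp add: of_nat_diff)
  finally show ?thesis by (simp add: ratio_Not)
qed

lemma reach: "\<exists>k p. ratio p (ST k) = 1 / T (Suc n)"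
proof (induction n)
  case 0
  have "ratio p0 (ST 0) = 1 / T 0 - real 1" using t0 by (simp add: ST_def cf_tail_def)
  then have "ratio (\<not> p0) (ST (0 + (pq (Suc 0) - 1))) = 1 / T (Suc 0)" by (rule run_start) (rule pq_pos)
  then show ?case by blast
next
  case (Suc n)
  then obtain k p where "ratio p (ST k) = 1 / T (Suc n)" by blast
  then have "ratio p (ST k) = 1 / T (Suc n) - real 0" by simp
  then show ?case using run_start by blast
qed

lemma all_ratios:
  assumes "ratio p (ST K) = 1 / T N" "K \<le> k"
  shows "\<exists>n\<ge>N. \<exists>j<pq (Suc n). \<exists>p. ratio p (ST k) = 1 / T n - real j"
  using assms(2)
proof (induction k rule: dec_induct)
  case base
  show ?case using assms(1) pq_pos[of N] by (intro exI[of _ N]) (auto intro!: exI[of _ "0::nat"])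
next
  case (step k)
  then obtain n j p where nj: "N \<le> n" "j < pq (Suc n)" "ratio p (ST k) = 1 / T n - real j" by blast
  show ?case
  proof (cases "Suc j < pq (Suc n)")
    case True
    then have "real j + 2 \<le> real (pq (Suc n))" by linarith
    then have "1 < ratio p (ST k)" using nj pq_Suc[of n] T[of "Suc n"] by linarith
    then have "ratio p (ST (Suc k)) = 1 / T n - real (Suc j)"
      using ratio_nxt[OF valid_ST, of p k] nj by (simp add: ST_def)
    then show ?thesis using True nj by blast
  next
    case False
    then have e: "pq (Suc n) - j = 1" using nj by simp
    have "ratio (\<not> p) (ST (Suc k)) = 1 / T (Suc n) - real 0"
      using run_start[OF nj(3)] nj(2) unfolding e by simp
    then show ?thesis using nj(1) pq_pos[of "Suc n"]
      by (intro exI[of _ "Suc n"]) (auto intro!: exI[of _ "0::nat"])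
  qed
qed

definition e :: "nat \<Rightarrow> bool" where "e k = fst (stype (ST k))"

text \<open>A late run has at most \<open>M\<close> steps, so the run in progress at
  \<open>k\<close> ends, and a step of the other kind occurs, no later than at k + M.\<close>

lemma mixed_windows:
  assumes "\<forall>n\<ge>N. partial_quotient \<theta> n \<le> M"
  shows "\<exists>K. \<forall>k\<ge>K. mixed (map e [k..<k + nat M + 1])"
proof -
  obtain K p where K: "ratio p (ST K) = 1 / T (Suc N)" using reach by blast
  have "mixed (map e [k..<k + nat M + 1])" if k: "K \<le> k" for k
  proof -
    obtain n j p where nj: "Suc N \<le> n" "j < pq (Suc n)" "ratio p (ST k) = 1 / T n - real j"
      using all_ratios[OF K k] by blast
    define l where "l = k + (pq (Suc n) - j)"
    have "real j + 1 \<le> real (pq (Suc n))" using nj by linarith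
    then have "1 < ratio p (ST k)" using nj pq_Suc[of n] T[of "Suc n"] by linarith
    then have ek: "e k = (\<not> p)" using stype_ratio[OF valid_ST] by (simp add: e_def)
    have "ratio (\<not> p) (ST l) = 1 / T (Suc n)" unfolding l_def using run_start[OF nj(3)] nj(2) by simp
    then have "1 < ratio (\<not> p) (ST l)" using T[of "Suc n"] by simp
    then have el: "e l = p" using stype_ratio[OF valid_ST, of "\<not> p" l] by (simp add: e_def)
    have "partial_quotient \<theta> (Suc n) \<le> M" using assms nj by auto
    then have "pq (Suc n) \<le> nat M" by (simp add: pq_def nat_mono)
    then have "l \<in> set [k..<k + nat M + 1]" "k \<in> set [k..<k + nat M + 1]" using nj by (auto simp: l_def)
    then have "e k \<in> set (map e [k..<k + nat M + 1])" "e l \<in> set (map e [k..<k + nat M + 1])"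
      unfolding set_map by blast+
    then show ?thesis unfolding mixed_def using ek el by (cases p) auto
  qed
  then show ?thesis by blast
qed

end

section \<open>Sturmian words as codings of rotations\<close>

lemma rot_frac:
  assumes "0 < \<theta>" "\<theta> < 1"
  shows "rot \<theta> (1 - \<theta>) (frac y) = frac (y + \<theta>)"
    and "(1 - \<theta> \<le> frac y) \<longleftrightarrow> \<lfloor>y + \<theta>\<rfloor> - \<lfloor>y\<rfloor> = 1"
    and "(\<lfloor>y + \<theta>\<rfloor> - \<lfloor>y\<rfloor> = 0) \<longleftrightarrow> \<not> (1 - \<theta> \<le> frac y)"
proof -
  have f: "0 \<le> frac y" "frac y < 1" "y = of_int \<lfloor>y\<rfloor> + frac y"
    using frac_ge_0[of y] frac_lt_1[of y] by (auto simp: frac_def)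
  have 1: "\<lfloor>y + \<theta>\<rfloor> = (if frac y < 1 - \<theta> then \<lfloor>y\<rfloor> else \<lfloor>y\<rfloor> + 1)"
  proof (cases "frac y < 1 - \<theta>")
    case True
    then have "of_int \<lfloor>y\<rfloor> \<le> y + \<theta>" "y + \<theta> < of_int \<lfloor>y\<rfloor> + 1" using f assms by linarith+
    then show ?thesis using True by (simp add: floor_unique)
  next
    case False
    then have "of_int (\<lfloor>y\<rfloor> + 1) \<le> y + \<theta>" "y + \<theta> < of_int (\<lfloor>y\<rfloor> + 1) + 1" using f assms by auto
    then have "\<lfloor>y + \<theta>\<rfloor> = \<lfloor>y\<rfloor> + 1" by (rule floor_unique)
    then show ?thesis using False by simp
  qed
  show "rot \<theta> (1 - \<theta>) (frac y) = frac (y + \<theta>)"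
    unfolding rot_def frac_def 1 using f by (auto simp: frac_def)
  show "(1 - \<theta> \<le> frac y) \<longleftrightarrow> \<lfloor>y + \<theta>\<rfloor> - \<lfloor>y\<rfloor> = 1" "(\<lfloor>y + \<theta>\<rfloor> - \<lfloor>y\<rfloor> = 0) \<longleftrightarrow> \<not> (1 - \<theta> \<le> frac y)"
    unfolding 1 by auto
qed

lemma lower_sturmian_sw:
  assumes "0 < \<theta>" "\<theta> < 1"
  shows "(lower_sturmian \<theta> \<rho> (Suc n) = 0) \<longleftrightarrow> \<not> sw \<theta> (1 - \<theta>) (frac \<rho>) n"
proof -
  have "(rot \<theta> (1 - \<theta>) ^^ n) (frac \<rho>) = frac (real n * \<theta> + \<rho>)"
    by (induction n) (use rot_frac(1)[OF assms] in \<open>auto simp: algebra_simps\<close>)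
  then show ?thesis using rot_frac(3)[OF assms, of "real n * \<theta> + \<rho>"]
    by (simp add: sw_def lower_sturmian_def algebra_simps)
qed

text \<open>Reflection turns ceilings into floors: the upper word codes the orbit of -\<rho> under
  rotation by 1 - \<theta>, with the two letters interchanged.\<close>

lemma upper_sturmian_sw:
  assumes "0 < \<theta>" "\<theta> < 1"
  shows "(upper_sturmian \<theta> \<rho> (Suc n) = 0) \<longleftrightarrow> sw (1 - \<theta>) \<theta> (frac (- \<rho>)) n"
proof -
  have a: "0 < 1 - \<theta>" "1 - \<theta> < 1" "1 - (1 - \<theta>) = \<theta>" using assms by auto
  have fr: "frac (y + (1 - \<theta>)) = frac (y - \<theta>)" for y
    using frac_1_eq[of "y - \<theta>"] by (simp add: algebra_simps)
  have "(rot (1 - \<theta>) \<theta> ^^ n) (frac (- \<rho>)) = frac (- (real n * \<theta> + \<rho>))"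
  proof (induction n)
    case (Suc n)
    have e: "- (real n * \<theta> + \<rho>) - \<theta> = - (real (Suc n) * \<theta> + \<rho>)" by (simp add: algebra_simps)
    have "(rot (1 - \<theta>) \<theta> ^^ Suc n) (frac (- \<rho>)) = rot (1 - \<theta>) \<theta> (frac (- (real n * \<theta> + \<rho>)))"
      by (simp only: funpow.simps comp_apply Suc)
    also have "\<dots> = frac (- (real n * \<theta> + \<rho>) - \<theta>)"
      by (simp only: rot_frac(1)[OF a(1,2), unfolded a(3)] fr)
    finally show ?case by (simp only: e)
  qed simp
  moreover have *: "(\<theta> \<le> frac (- y)) \<longleftrightarrow> \<lceil>y + \<theta>\<rceil> - \<lceil>y\<rceil> = 0" for y
  proof -
    have "\<lfloor>- y + (1 - \<theta>)\<rfloor> = 1 - \<lceil>y + \<theta>\<rceil>"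
      using floor_add_int[of "- (y + \<theta>)" 1] by (simp add: ceiling_def algebra_simps)
    moreover have "\<lfloor>- y\<rfloor> = - \<lceil>y\<rceil>" by (simp add: ceiling_def)
    ultimately show ?thesis using rot_frac(2)[OF a(1,2), unfolded a(3), of "- y"] by linarith
  qed
  moreover have "upper_sturmian \<theta> \<rho> (Suc n) = \<lceil>real n * \<theta> + \<rho> + \<theta>\<rceil> - \<lceil>real n * \<theta> + \<rho>\<rceil>"
    by (simp add: upper_sturmian_def algebra_simps)
  ultimately show ?thesis using *[of "real n * \<theta> + \<rho>"] by (simp only: sw_def)
qed

lemma sturmian_number_state:
  assumes "sturmian_number \<theta> \<xi>"
  shows "\<exists>(b::nat) (u::nat) (v::nat) t0 p0. 2 \<le> b \<and> u < b \<and> v < b \<and> u \<noteq> v \<and> sturm_state \<theta> t0 p0 \<and>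
    (\<lambda>n. real (if wrd t0 n then v else u) / real b ^ Suc n) sums \<xi>"
proof -
  have \<theta>: "0 < \<theta>" "\<theta> < 1" "\<theta> \<notin> \<rat>" using assms by (auto simp: sturmian_number_def)
  obtain b u v :: nat and \<rho> s where b: "2 \<le> b" "u < b" "v < b" "u \<noteq> v"
    and s: "s = lower_sturmian \<theta> \<rho> \<or> s = upper_sturmian \<theta> \<rho>"
    and sums: "(\<lambda>n. real (if s (Suc n) = 0 then u else v) / real b ^ Suc n) sums \<xi>"
    using assms unfolding sturmian_number_def by blast
  have irr: "\<theta> / (1 - \<theta>) \<notin> \<rat>" "(1 - \<theta>) / \<theta> \<notin> \<rat>"
  proof -
    show 1: "(1 - \<theta>) / \<theta> \<notin> \<rat>"
    proof
      assume "(1 - \<theta>) / \<theta> \<in> \<rat>"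
      then have "1 / ((1 - \<theta>) / \<theta> + 1) \<in> \<rat>" by (meson Rats_1 Rats_add Rats_divide)
      also have "1 / ((1 - \<theta>) / \<theta> + 1) = \<theta>" using \<theta> by (simp add: field_simps)
      finally show False using \<theta> by simp
    qed
    show "\<theta> / (1 - \<theta>) \<notin> \<rat>"
    proof
      assume "\<theta> / (1 - \<theta>) \<in> \<rat>"
      then have "1 / (\<theta> / (1 - \<theta>)) \<in> \<rat>" by (meson Rats_1 Rats_divide)
      then show False using 1 by simp
    qed
  qed
  from s show ?thesis
  proof
    assume s: "s = lower_sturmian \<theta> \<rho>"
    have "sturm_state \<theta> (\<theta>, 1 - \<theta>, frac \<rho>) True"
      using \<theta> irr by unfold_locales (auto simp: frac_lt_1 field_simps)
    moreover have "(\<lambda>n. real (if wrd (\<theta>, 1 - \<theta>, frac \<rho>) n then v else u) / real b ^ Suc n) sums \<xi>"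
    proof -
      have "(\<lambda>n. real (if s (Suc n) = 0 then u else v) / real b ^ Suc n)
        = (\<lambda>n. real (if wrd (\<theta>, 1 - \<theta>, frac \<rho>) n then v else u) / real b ^ Suc n)"
        by (simp only: s lower_sturmian_sw[OF \<theta>(1,2), of \<rho>] wrd.simps fun_eq_iff) auto
      with sums show ?thesis by simp
    qed
    ultimately show ?thesis using b by blast
  next
    assume s: "s = upper_sturmian \<theta> \<rho>"
    have "sturm_state \<theta> (1 - \<theta>, \<theta>, frac (- \<rho>)) False"
      using \<theta> irr by unfold_locales (auto simp: frac_lt_1 field_simps)
    \<comment> \<open>The interchange of letters makes \<open>u\<close> and \<open>v\<close>
      exchange their roles.\<close>
    moreover have "(\<lambda>n. real (if wrd (1 - \<theta>, \<theta>, frac (- \<rho>)) n then u else v) / real b ^ Suc n) sums \<xi>"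
      using sums upper_sturmian_sw[OF \<theta>(1,2), of \<rho>] by (simp add: s)
    ultimately show ?thesis using b by blast
  qed
qed

text \<open>At x = y = 1 / b the weight of a prefix depends on its length alone, and a digit is u
  plus v - u at the positions of the letter 1.\<close>

lemma sums_digits:
  fixes b u v :: nat
  assumes b: "2 \<le> b" and sums: "(\<lambda>n. real (if s n then v else u) / real b ^ Suc n) sums \<xi>"
  defines "z \<equiv> 1 / real b"
  shows "(real b - 1) * \<xi> - real u = (real v - real u) * (1 - z) * wF s z z"
proof -
  have z: "0 \<le> z" "z \<le> 1/2" "z < 1" using b by (auto simp: z_def field_simps)
  have w: "wt s z z n = z ^ n" for n by (simp add: wt_def)
  have sm: "(\<lambda>n. of_bool (s n) * wt s z z n) sums wF s z z"
    unfolding wF_def using wF_summable[of z z z s] z by (simp add: summable_sums)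
  have "(\<lambda>n. z * (real u * z ^ n + (real v - real u) * (of_bool (s n) * wt s z z n))) sums
     (z * (real u * (1 / (1 - z)) + (real v - real u) * wF s z z))"
    using z by (intro sums_mult sums_add sm geometric_sums) auto
  also have "(\<lambda>n. z * (real u * z ^ n + (real v - real u) * (of_bool (s n) * wt s z z n)))
     = (\<lambda>n. real (if s n then v else u) / real b ^ Suc n)"
    unfolding w using b by (auto simp: z_def fun_eq_iff field_simps)
  finally have \<xi>: "\<xi> = z * (real u * (1 / (1 - z)) + (real v - real u) * wF s z z)"
    using sums sums_unique2 by blast
  have bz: "(real b - 1) * z = 1 - z" using b by (simp add: z_def field_simps)
  have "(real b - 1) * \<xi> = ((real b - 1) * z) * (real u * (1 / (1 - z)) + (real v - real u) * wF s z z)"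
    unfolding \<xi> by (simp only: mult.assoc)
  also have "\<dots> = real u + (real v - real u) * (1 - z) * wF s z z"
    unfolding bz using z by (simp add: distrib_left)
  finally show ?thesis by simp
qed

section \<open>Evaluation along the chain of desubstitutions\<close>

context sturm_state
begin

fun qq :: "nat \<Rightarrow> nat \<times> nat" where
  "qq 0 = (1, 1)"
| "qq (Suc k) = (case qq k of (q, q') \<Rightarrow> if e k then (q + q', q') else (q, q + q'))"

definition q1 :: "nat \<Rightarrow> nat" where "q1 k = fst (qq k)"
definition q2 :: "nat \<Rightarrow> nat" where "q2 k = snd (qq k)"
definition SS :: "nat \<Rightarrow> nat" where "SS k = q1 k + q2 k"

lemma q_0 [simp]: "q1 0 = 1" "q2 0 = 1"
  by (simp_all add: q1_def q2_def)

lemma q_Suc: "q1 (Suc k) = (if e k then q1 k + q2 k else q1 k)" "q2 (Suc k) = (if e k then q2 k else q1 k + q2 k)"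
  by (simp_all add: q1_def q2_def case_prod_beta)

lemma q_pos: "1 \<le> q1 k" "1 \<le> q2 k"
  by (induction k) (auto simp: q_Suc)

lemma q_mono: "j \<le> k \<Longrightarrow> q1 j \<le> q1 k" "j \<le> k \<Longrightarrow> q2 j \<le> q2 k"
  by (induction k rule: dec_induct) (auto simp: q_Suc)

lemma SS_ge: "k + 2 \<le> SS k"
proof (induction k)
  case (Suc k)
  then show ?case using q_pos[of k] by (auto simp: SS_def q_Suc)
qed (simp add: SS_def)

lemma SS_double: "SS (k + m) \<le> 2 ^ m * SS k"
proof (induction m)
  case (Suc m)
  have "SS (Suc (k + m)) \<le> 2 * SS (k + m)" by (auto simp: SS_def q_Suc)
  then show ?case using Suc by simp
qed simp

lemma SS_mono: "j \<le> k \<Longrightarrow> SS j \<le> SS k"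
  unfolding SS_def using q_mono by (meson add_mono)

text \<open>Among the last \<open>R\<close> steps one makes \<open>q1\<close> at least
  \<open>q2\<close>, and the fewer than \<open>R\<close> steps that follow add at most
  \<open>q1 k\<close> each to \<open>q2\<close>; the same holds with the roles exchanged.\<close>

lemma q_comparable:
  assumes mix: "\<And>k. K \<le> k \<Longrightarrow> mixed (map e [k..<k + R])" and k: "K + R \<le> k"
  shows "SS k \<le> (R + 2) * min (q1 k) (q2 k)"
proof -
  have mx: "mixed (map e [k - R..<k])" using mix[of "k - R"] k by simp
  have 1: "q2 i \<le> q2 j + (i - j) * q1 i" "q1 i \<le> q1 j + (i - j) * q2 i" if "j \<le> i" for i j
  proof -
    show "q2 i \<le> q2 j + (i - j) * q1 i" using that
    proof (induction i rule: dec_induct)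
      case (step i)
      have "q1 i \<le> q1 (Suc i)" by (rule q_mono) simp
      then have "(i - j) * q1 i + q1 i \<le> (i - j) * q1 (Suc i) + q1 (Suc i)" by (intro add_mono mult_left_mono) auto
      then show ?case using step by (auto simp: q_Suc(2) Suc_diff_le)
    qed simp
    show "q1 i \<le> q1 j + (i - j) * q2 i" using that
    proof (induction i rule: dec_induct)
      case (step i)
      have "q2 i \<le> q2 (Suc i)" by (rule q_mono) simp
      then have "(i - j) * q2 i + q2 i \<le> (i - j) * q2 (Suc i) + q2 (Suc i)" by (intro add_mono mult_left_mono) auto
      then show ?case using step by (auto simp: q_Suc(1) Suc_diff_le)
    qed simp
  qed
  obtain i where i: "k - R \<le> i" "i < k" "e i" using mx by (auto simp: mixed_def)
  obtain j where j: "k - R \<le> j" "j < k" "\<not> e j" using mx by (auto simp: mixed_def)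
  have "q2 k \<le> q2 (Suc i) + (k - Suc i) * q1 k" using 1(1)[of "Suc i" k] i by simp
  also have "q2 (Suc i) \<le> q1 (Suc i)" using i by (simp add: q_Suc)
  also have "q1 (Suc i) \<le> q1 k" using i by (intro q_mono) auto
  also have "q1 k + (k - Suc i) * q1 k \<le> (R + 1) * q1 k"
  proof -
    have "(k - Suc i) * q1 k \<le> R * q1 k" using i by (intro mult_right_mono) auto
    then show ?thesis by simp
  qed
  finally have A: "q2 k \<le> (R + 1) * q1 k" by simp
  have "q1 k \<le> q1 (Suc j) + (k - Suc j) * q2 k" using 1(2)[of "Suc j" k] j by simp
  also have "q1 (Suc j) \<le> q2 (Suc j)" using j by (simp add: q_Suc)
  also have "q2 (Suc j) \<le> q2 k" using j by (intro q_mono) auto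
  also have "q2 k + (k - Suc j) * q2 k \<le> (R + 1) * q2 k"
  proof -
    have "(k - Suc j) * q2 k \<le> R * q2 k" using j by (intro mult_right_mono) auto
    then show ?thesis by simp
  qed
  finally have B: "q1 k \<le> (R + 1) * q2 k" by simp
  show ?thesis using A B by (auto simp: SS_def min_def)
qed

lemma weight_ecl:
  assumes "j \<le> k"
  shows "a * int (q1 k) + c * int (q2 k) =
    fst (ecl (rev (map e [j..<k])) (a, c)) * int (q1 j) + snd (ecl (rev (map e [j..<k])) (a, c)) * int (q2 j)"
  using assms
proof (induction k arbitrary: a c rule: dec_induct)
  case (step k)
  have "rev (map e [j..<Suc k]) = e k # rev (map e [j..<k])" using step by simp
  then show ?case using step.IH[of a "a + c"] step.IH[of "a + c" c] by (auto simp: q_Suc algebra_simps)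
qed simp

text \<open>Moved back \<open>L\<close> steps by \<open>weight_ecl\<close>, the pair (a, c) no
  longer has opposite signs, so nothing cancels and the weight is at least the smaller of
  \<open>q1 j\<close>, \<open>q2 j\<close>, which tends to infinity.\<close>

lemma weight_gap:
  assumes mix: "\<And>k. K \<le> k \<Longrightarrow> mixed (map e [k..<k + R])"
  shows "\<exists>K'. \<forall>k\<ge>K'. \<forall>a c. (a, c) \<noteq> (0, 0) \<longrightarrow> \<bar>a\<bar> \<le> int A \<longrightarrow> \<bar>c\<bar> \<le> int A \<longrightarrow>
     int g \<le> \<bar>a * int (q1 k) + c * int (q2 k)\<bar>"
proof -
  \<comment> \<open>One more than the largest possible size 2A, which would drop by 1 at each step
    with opposite signs.\<close>
  define L where "L = 2 * A + 1"
  define K' where "K' = K + R + (R + 2) * g + L"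
  have "int g \<le> \<bar>a * int (q1 k) + c * int (q2 k)\<bar>"
    if k: "K' \<le> k" and ac: "(a, c) \<noteq> (0, 0)" "\<bar>a\<bar> \<le> int A" "\<bar>c\<bar> \<le> int A" for k a c
  proof -
    define j where "j = k - L"
    have j: "j \<le> k" "length (rev (map e [j..<k])) = L" "K + R + (R + 2) * g \<le> j"
      using k by (auto simp: j_def K'_def)
    have "(R + 2) * g \<le> SS j" using SS_ge[of j] j(3) by linarith
    also have "\<dots> \<le> (R + 2) * min (q1 j) (q2 j)" by (rule q_comparable[of K R j]) (use mix j(3) in auto)
    finally have "(R + 2) * g \<le> (R + 2) * min (q1 j) (q2 j)" .
    then have "g \<le> min (q1 j) (q2 j)" by (simp only: mult_le_cancel1)
    then have g: "g \<le> q1 j" "g \<le> q2 j" by auto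
    define p where "p = ecl (rev (map e [j..<k])) (a, c)"
    have p0: "p \<noteq> (0, 0)" using ecl_eq_0 ac(1) unfolding p_def by blast
    have "\<not> opp p"
    proof
      assume "opp p"
      from opp_ecl[OF this[unfolded p_def]] have "sz p + int L \<le> sz (a, c)" unfolding j(2) p_def by blast
      then show False using ac by (simp add: sz_def L_def)
    qed
    then have sgn: "(0 \<le> fst p \<and> 0 \<le> snd p) \<or> (fst p \<le> 0 \<and> snd p \<le> 0)" unfolding opp_def by linarith
    have "a * int (q1 k) + c * int (q2 k) = fst p * int (q1 j) + snd p * int (q2 j)"
      unfolding p_def by (rule weight_ecl[OF j(1)])
    also have "\<bar>\<dots>\<bar> = \<bar>fst p\<bar> * int (q1 j) + \<bar>snd p\<bar> * int (q2 j)"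
    proof (cases "0 \<le> fst p \<and> 0 \<le> snd p")
      case True
      then show ?thesis by simp
    next
      case False
      with sgn have "fst p \<le> 0" "snd p \<le> 0" by auto
      moreover from this have "fst p * int (q1 j) \<le> 0" "snd p * int (q2 j) \<le> 0" by (auto intro: mult_nonpos_nonneg)
      ultimately show ?thesis by simp
    qed
    also have "\<dots> \<ge> int g"
    proof -
      have "\<bar>fst p\<bar> * int g \<le> \<bar>fst p\<bar> * int (q1 j)" "\<bar>snd p\<bar> * int g \<le> \<bar>snd p\<bar> * int (q2 j)"
        using g by (intro mult_left_mono; simp)+
      moreover have "1 \<le> \<bar>fst p\<bar> + \<bar>snd p\<bar>" using p0 by (cases p) auto
      then have "1 * int g \<le> (\<bar>fst p\<bar> + \<bar>snd p\<bar>) * int g" by (intro mult_right_mono) auto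
      ultimately show ?thesis by (simp add: distrib_right)
    qed
    finally show ?thesis .
  qed
  then show ?thesis by blast
qed

text \<open>For large \<open>k\<close> distinct monomials of \<open>r\<close> take values z^w with
  exponents at least \<open>g\<close> apart, so the monomial of least exponent outweighs all others
  together.\<close>

lemma beval_eventually_nonzero:
  assumes mix: "\<And>k. K \<le> k \<Longrightarrow> mixed (map e [k..<k + R])"
    and r: "r \<noteq> 0" and z: "0 < z" "z \<le> 1/2"
  shows "\<exists>K'. \<forall>k\<ge>K'. beval r (z ^ q1 k) (z ^ q2 k) \<noteq> 0"
proof -
  obtain A where A: "\<And>i j. (i, j) \<in> bsupp r \<Longrightarrow> i \<le> A \<and> j \<le> A"
  proof -
    have "finite (fst ` bsupp r \<union> snd ` bsupp r)" by simp
    then obtain A where "\<forall>i\<in>fst ` bsupp r \<union> snd ` bsupp r. i \<le> A" using finite_nat_set_iff_bounded_le by blast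
    then show ?thesis using that[of A] by (metis UnI1 UnI2 fst_conv image_eqI snd_conv)
  qed
  define \<delta> where "\<delta> = Min ((\<lambda>(i, j). \<bar>bcoeff r i j\<bar>) ` bsupp r)"
  have ne: "bsupp r \<noteq> {}" using r by (simp add: bsupp_eq_empty_iff)
  have \<delta>: "0 < \<delta>" unfolding \<delta>_def using ne by (subst Min_gr_iff) (simp_all, auto simp: bsupp_def)
  have \<delta>_le: "\<delta> \<le> \<bar>bcoeff r i j\<bar>" if "(i, j) \<in> bsupp r" for i j
    unfolding \<delta>_def using that by (intro Min_le) force+
  define n where "n = (\<Sum>(i, j)\<in>bsupp r. \<bar>bcoeff r i j\<bar>)"
  have n0: "0 \<le> n" unfolding n_def by (auto intro: sum_nonneg)
  obtain g where g: "n * z ^ g < \<delta>"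
  proof -
    have "(\<lambda>g. n * z ^ g) \<longlonglongrightarrow> n * 0" using z by (intro tendsto_intros LIMSEQ_power_zero) auto
    then have "eventually (\<lambda>g. n * z ^ g < \<delta>) sequentially" using \<delta> by (intro order_tendstoD) auto
    then show ?thesis using that by (auto simp: eventually_sequentially)
  qed
  obtain K' where K': "\<And>k a c. K' \<le> k \<Longrightarrow> (a, c) \<noteq> (0, 0) \<Longrightarrow> \<bar>a\<bar> \<le> int A \<Longrightarrow> \<bar>c\<bar> \<le> int A \<Longrightarrow>
     int g \<le> \<bar>a * int (q1 k) + c * int (q2 k)\<bar>"
    using weight_gap[of K R A g] mix by blast
  have "beval r (z ^ q1 k) (z ^ q2 k) \<noteq> 0" if k: "K' \<le> k" for k
  proof -
    define w where "w = (\<lambda>(i, j). i * q1 k + j * q2 k)"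
    have "Min (w ` bsupp r) \<in> w ` bsupp r" using ne by (intro Min_in) auto
    then obtain s0 where s0: "s0 \<in> bsupp r" "w s0 = Min (w ` bsupp r)" by auto
    have min: "w s0 \<le> w s" if "s \<in> bsupp r" for s using that s0 by simp
    obtain i0 j0 where ij0: "s0 = (i0, j0)" by (cases s0)
    have gap: "w s0 + g \<le> w s" if s: "s \<in> bsupp r" "s \<noteq> s0" for s
    proof -
      obtain i j where ij: "s = (i, j)" by (cases s)
      have b: "i \<le> A" "j \<le> A" "i0 \<le> A" "j0 \<le> A" using A s s0 ij ij0 by auto
      have "int g \<le> \<bar>(int i - int i0) * int (q1 k) + (int j - int j0) * int (q2 k)\<bar>"
        using s b by (intro K'[OF k]) (auto simp: ij ij0)
      also have "(int i - int i0) * int (q1 k) + (int j - int j0) * int (q2 k) = int (w s) - int (w s0)"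
        by (simp add: w_def ij ij0 algebra_simps)
      finally show ?thesis using min[OF s(1)] by linarith
    qed
    have monomial: "bcoeff r (fst s) (snd s) * (z ^ q1 k) ^ fst s * (z ^ q2 k) ^ snd s = bcoeff r (fst s) (snd s) * z ^ w s" for s
      by (cases s) (simp add: w_def power_add mult.commute flip: power_mult)
    have "beval r (z ^ q1 k) (z ^ q2 k) = (\<Sum>s\<in>bsupp r. bcoeff r (fst s) (snd s) * z ^ w s)"
      unfolding beval_altdef case_prod_beta monomial ..
    also have "\<dots> = bcoeff r i0 j0 * z ^ w s0 + (\<Sum>s\<in>bsupp r - {s0}. bcoeff r (fst s) (snd s) * z ^ w s)"
      using s0 by (subst sum.remove[of _ s0]) (auto simp: ij0)
    finally have e: "beval r (z ^ q1 k) (z ^ q2 k) = bcoeff r i0 j0 * z ^ w s0 + (\<Sum>s\<in>bsupp r - {s0}. bcoeff r (fst s) (snd s) * z ^ w s)" .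
    have "\<bar>\<Sum>s\<in>bsupp r - {s0}. bcoeff r (fst s) (snd s) * z ^ w s\<bar> \<le> (\<Sum>s\<in>bsupp r - {s0}. \<bar>bcoeff r (fst s) (snd s) * z ^ w s\<bar>)"
      by (rule sum_abs)
    also have "\<dots> \<le> (\<Sum>s\<in>bsupp r - {s0}. \<bar>bcoeff r (fst s) (snd s)\<bar> * z ^ (w s0 + g))"
      using z gap by (intro sum_mono) (auto simp: abs_mult intro!: mult_left_mono power_decreasing)
    also have "\<dots> \<le> (\<Sum>s\<in>bsupp r. \<bar>bcoeff r (fst s) (snd s)\<bar> * z ^ (w s0 + g))"
      using z by (intro sum_mono2) auto
    also have "\<dots> = (\<Sum>s\<in>bsupp r. \<bar>bcoeff r (fst s) (snd s)\<bar>) * z ^ (w s0 + g)"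
      by (rule sum_distrib_right[symmetric])
    also have "\<dots> = n * z ^ g * z ^ w s0" by (simp add: n_def case_prod_beta power_add)
    also have "\<dots> < \<delta> * z ^ w s0" using g z by (intro mult_strict_right_mono) auto
    also have "\<dots> \<le> \<bar>bcoeff r i0 j0 * z ^ w s0\<bar>" using \<delta>_le[of i0 j0] s0 ij0 z
      by (auto simp: abs_mult intro!: mult_right_mono)
    finally show ?thesis using e by linarith
  qed
  then show ?thesis by blast
qed

end

lemma rsteps_unit_scale:
  assumes "rsteps ts (x, y, f, g, d) = (X, Y, F, G, D)"
  shows "\<exists>D'. rsteps ts (x, y, f, g, d') = (X, Y, F, G, D')"
  using assms
proof (induction ts arbitrary: x y f g d d')
  case (Cons t ts)
  obtain p h where t: "t = (p, h)" by (cases t)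
  obtain x1 y1 f1 g1 d1 where 1: "rstep t (x, y, f, g, d) = (x1, y1, f1, g1, d1)" by (metis prod_cases5)
  obtain d2 where 2: "rstep t (x, y, f, g, d') = (x1, y1, f1, g1, d2)"
    using 1 by (cases p; cases h) (auto simp: t)
  show ?case using Cons.IH[of x1 y1 f1 g1 d1 d2] Cons.prems 1 2 by simp
qed simp

lemma map_upt_blocks:
  "map f [k..<k + R * m] = concat (map (\<lambda>i. map f [k + i * R..<k + i * R + R]) [0..<m])"
proof (induction m)
  case (Suc m)
  have "[k..<k + R * Suc m] = [k..<k + R * m] @ [k + R * m..<k + R * m + R]"
    using upt_add_eq_append[of k "k + R * m" R] by (simp add: algebra_simps)
  then show ?case using Suc by (simp add: mult.commute)
qed simp

section \<open>Linear forms in \<xi> attached to the desubstitutions\<close>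

locale sturm_num = sturm_state +
  fixes b u v :: nat and \<xi> :: real
  assumes b: "2 \<le> b" "u < b" "v < b" "u \<noteq> v"
    and sums: "(\<lambda>n. real (if wrd t0 n then v else u) / real b ^ Suc n) sums \<xi>"
begin

definition z :: real where "z = 1 / real b"

lemma z: "0 < z" "z \<le> 1/2" "z < 1" and bz: "real b ^ n * z ^ n = 1"
  using b by (auto simp: z_def field_simps)

abbreviation x where "x k \<equiv> z ^ q1 k"
abbreviation y where "y k \<equiv> z ^ q2 k"

lemma xy: "0 < x k" "x k \<le> 1/2" "0 < y k" "y k \<le> 1/2"
  using z q_pos[of k] power_decreasing[of 1 "q1 k" z] power_decreasing[of 1 "q2 k" z] by auto

text \<open>The initial vector is left free because it will be linear in \<open>t\<close>. The
  determinants do not depend on it and are collected separately in \<open>cD\<close>.\<close>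

fun fg :: "real \<Rightarrow> real \<Rightarrow> nat \<Rightarrow> real \<times> real" where
  "fg f g 0 = (f, g)"
| "fg f g (Suc k) = (case rstep (stype (ST k)) (x k, y k, fst (fg f g k), snd (fg f g k), 1) of
     (X, Y, F, G, D) \<Rightarrow> (F, G))"

fun cD :: "nat \<Rightarrow> real" where
  "cD 0 = 1"
| "cD (Suc k) = (if snd (stype (ST k)) then (if e k then y k else x k) else 1) * cD k"

definition seg :: "nat \<Rightarrow> nat \<Rightarrow> (bool \<times> bool) list" where
  "seg k m = map (\<lambda>j. stype (ST j)) [k..<k + m]"

lemma rstep_chain:
  "rstep (stype (ST k)) (x k, y k, fst (fg f g k), snd (fg f g k), cD k)
    = (x (Suc k), y (Suc k), fst (fg f g (Suc k)), snd (fg f g (Suc k)), cD (Suc k))"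
proof -
  obtain p h where ph: "stype (ST k) = (p, h)" by (cases "stype (ST k)")
  have "e k = p" by (simp add: e_def ph)
  then show ?thesis by (cases p; cases h) (auto simp: ph q_Suc power_add mult.commute)
qed

lemma rsteps_chain:
  "rsteps (seg k m) (x k, y k, fst (fg f g k), snd (fg f g k), cD k)
    = (x (k + m), y (k + m), fst (fg f g (k + m)), snd (fg f g (k + m)), cD (k + m))"
proof (induction m)
  case (Suc m)
  have "seg k (Suc m) = seg k m @ [stype (ST (k + m))]" by (simp add: seg_def)
  then show ?case using Suc rstep_chain[of "k + m" f g] by simp
qed (simp add: seg_def)

lemma rsteps_chain_0:
  "rsteps (seg 0 k) (z, z, f, g, 1) = (x k, y k, fst (fg f g k), snd (fg f g k), cD k)"
  using rsteps_chain[of 0 k f g] by simp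

lemma cD: "0 < cD k" "cD k \<le> 1"
proof (induction k)
  case (Suc k)
  {
    case 1
    show ?case using Suc xy[of k] by auto
  next
    case 2
    have "y k * cD k \<le> 1" "x k * cD k \<le> 1"
      using Suc xy[of k] mult_mono[of "y k" 1 "cD k" 1] mult_mono[of "x k" 1 "cD k" 1] by auto
    then show ?case using Suc by auto
  }
qed auto

lemma fg_ell: "(1 - y k) * fst (fg f g k) + (1 - x k) * snd (fg f g k) = cD k * ((1 - z) * (f + g))"
  using rsteps_ell[OF rsteps_chain_0[of k f g]] by (simp add: distrib_left)

lemma fg_linear:
  "fst (fg (c * f + d * f') (c * g + d * g') k) = c * fst (fg f g k) + d * fst (fg f' g' k)"
  "snd (fg (c * f + d * f') (c * g + d * g') k) = c * snd (fg f g k) + d * snd (fg f' g' k)"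
  using rsteps_linear[OF rsteps_chain_0[of k f g] rsteps_chain_0[of k f' g'], of c d]
    rsteps_chain_0[of k "c * f + d * f'" "c * g + d * g'"] by simp_all

lemma fg_word:
  "fst (fg (c * wF (wrd t0) z z) (c * wG (wrd t0) z z) k) = cD k * c * wF (wrd (ST k)) (x k) (y k) \<and>
   snd (fg (c * wF (wrd t0) z z) (c * wG (wrd t0) z z) k) = cD k * c * wG (wrd (ST k)) (x k) (y k)"
proof (induction k)
  case 0
  then show ?case by (simp add: ST_def)
next
  case (Suc k)
  have "0 \<le> x k" "x k < 1" "0 \<le> y k" "y k < 1" using xy[of k] by auto
  from rstep_word[OF valid_ST this, of k "cD k" c] obtain X Y D where
    "rstep (stype (ST k)) (x k, y k, cD k * c * wF (wrd (ST k)) (x k) (y k), cD k * c * wG (wrd (ST k)) (x k) (y k), cD k)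
    = (X, Y, D * c * wF (wrd (nxt (ST k))) X Y, D * c * wG (wrd (nxt (ST k))) X Y, D)" by blast
  moreover have "nxt (ST k) = ST (Suc k)" by (simp add: ST_def)
  ultimately show ?case
    using rstep_chain[of k "c * wF (wrd t0) z z" "c * wG (wrd t0) z z"] Suc by (auto simp del: fg.simps cD.simps)
qed

text \<open>The denominators b^q1 and b^q2 persist: a combination such as y F - G becomes integral
  when multiplied by b^(q1 + q2), the new denominator, as y b^q2 = 1.\<close>

lemma fg_int:
  assumes "f \<in> \<int>" "g \<in> \<int>"
  shows "real b ^ q1 k * fst (fg f g k) \<in> \<int> \<and> real b ^ q2 k * snd (fg f g k) \<in> \<int>"
proof (induction k)
  case 0
  then show ?case using assms by auto
next
  case (Suc k)
  define F G where "F = fst (fg f g k)" and "G = snd (fg f g k)"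
  define P Q where "P = real b ^ q1 k" and "Q = real b ^ q2 k"
  have PQ: "P * x k = 1" "Q * y k = 1" by (simp_all add: P_def Q_def bz)
  have int: "P \<in> \<int>" "Q \<in> \<int>" "P * F \<in> \<int>" "Q * G \<in> \<int>" using Suc by (auto simp: P_def Q_def F_def G_def)
  obtain p h where ph: "stype (ST k) = (p, h)" by (cases "stype (ST k)")
  have ek: "e k = p" by (simp add: e_def ph)
  have PP: "P * Q * (y k * F - G) = (Q * y k) * (P * F) - P * (Q * G)"
    "P * Q * (F - x k * G) = Q * (P * F) - (P * x k) * (Q * G)"
    "P * Q * (x k * G - F) = (P * x k) * (Q * G) - Q * (P * F)"
    "P * Q * (G - y k * F) = P * (Q * G) - (Q * y k) * (P * F)"
    by (simp_all add: algebra_simps)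
  have i4: "P * Q * (y k * F - G) \<in> \<int>" "P * Q * (F - x k * G) \<in> \<int>" "P * Q * (x k * G - F) \<in> \<int>" "P * Q * (G - y k * F) \<in> \<int>"
    unfolding PP PQ using int by auto
  show ?case using int i4
    by (cases p; cases h) (auto simp: ph q_Suc ek power_add simp flip: F_def G_def P_def Q_def)
qed

lemma fg_bound: "\<bar>fst (fg f g k)\<bar> + \<bar>snd (fg f g k)\<bar> \<le> 2 ^ k * (\<bar>f\<bar> + \<bar>g\<bar>)"
proof (induction k)
  case (Suc k)
  define F G where "F = fst (fg f g k)" and "G = snd (fg f g k)"
  have "\<bar>x k * G\<bar> \<le> 1 * \<bar>G\<bar>" "\<bar>y k * F\<bar> \<le> 1 * \<bar>F\<bar>"
    unfolding abs_mult using xy[of k] by (intro mult_right_mono; simp)+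
  moreover obtain p h where ph: "stype (ST k) = (p, h)" by (cases "stype (ST k)")
  ultimately have "\<bar>fst (fg f g (Suc k))\<bar> + \<bar>snd (fg f g (Suc k))\<bar> \<le> 2 * (\<bar>F\<bar> + \<bar>G\<bar>)"
    by (cases p; cases h) (auto simp: ph simp flip: F_def G_def)
  then show ?case using Suc by (simp add: F_def G_def)
qed simp

text \<open>The k-th image of the vector ((b - 1) t - u, v - (b - 1) t) is (fA t + fB, gA t + gB).
  The entries of the initial vector add up to v - u, so the form, whose value is \<open>lam\<close>,
  is free of \<open>t\<close>.\<close>

definition fA where "fA k = fst (fg (real b - 1) (- (real b - 1)) k)"
definition fB where "fB k = fst (fg (- real u) (real v) k)"
definition gA where "gA k = snd (fg (real b - 1) (- (real b - 1)) k)"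
definition gB where "gB k = snd (fg (- real u) (real v) k)"
definition lam where "lam k = cD k * ((1 - z) * (real v - real u))"

lemma fg_t:
  "fg ((real b - 1) * t - real u) (real v - (real b - 1) * t) k = (fA k * t + fB k, gA k * t + gB k)"
  using fg_linear[of t "real b - 1" 1 "- real u" "- (real b - 1)" "real v" k]
  by (simp add: fA_def fB_def gA_def gB_def prod_eq_iff algebra_simps)

lemma lam_eq: "lam k = (1 - y k) * (fA k * t + fB k) + (1 - x k) * (gA k * t + gB k)"
  using fg_ell[of k "(real b - 1) * t - real u" "real v - (real b - 1) * t"] by (simp add: fg_t lam_def)

lemma lam_nonzero: "lam k \<noteq> 0"
  using cD[of k] z b by (simp add: lam_def)

lemma lam_bound: "\<bar>lam k\<bar> \<le> real b"
proof -
  have "\<bar>cD k * (1 - z)\<bar> * \<bar>real v - real u\<bar> \<le> 1 * real b"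
  proof (rule mult_mono)
    show "\<bar>cD k * (1 - z)\<bar> \<le> 1" using cD[of k] z mult_mono[of "cD k" 1 "1 - z" 1] by (simp add: abs_mult)
    show "\<bar>real v - real u\<bar> \<le> real b" using b by linarith
  qed auto
  then show ?thesis by (simp add: lam_def abs_mult mult_ac)
qed

text \<open>At t = \<xi> the initial vector is c = (v - u)(1 - z) times the pair of generating
  functions of the initial word: the first entry by \<open>sums_digits\<close>, the second because
  the form has value 1 on words.\<close>

lemma fA_xi: "fA k * \<xi> + fB k = lam k * wF (wrd (ST k)) (x k) (y k)"
proof -
  define c where "c = (real v - real u) * (1 - z)"
  have F: "(real b - 1) * \<xi> - real u = c * wF (wrd t0) z z"
    using sums_digits[OF b(1) sums] by (simp add: c_def z_def)
  have "(1 - z) * wF (wrd t0) z z + (1 - z) * wG (wrd t0) z z = 1"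
  proof -
    obtain a a' s where t: "t0 = (a, a', s)" by (cases t0)
    interpret unit_pair z z using z by unfold_locales auto
    show ?thesis using ell_eq_1[of a a' s] by (simp add: t)
  qed
  then have l: "(1 - z) * (wF (wrd t0) z z + wG (wrd t0) z z) = 1" by (simp add: distrib_left)
  have "c * wG (wrd t0) z z = (real v - real u) * ((1 - z) * (wF (wrd t0) z z + wG (wrd t0) z z)) - c * wF (wrd t0) z z"
    by (simp add: c_def algebra_simps)
  then have G: "real v - (real b - 1) * \<xi> = c * wG (wrd t0) z z"
    unfolding l F[symmetric] by simp
  have "fA k * \<xi> + fB k = fst (fg (c * wF (wrd t0) z z) (c * wG (wrd t0) z z) k)"
    using fg_t[of \<xi> k] unfolding F G by simp
  then show ?thesis using fg_word[of c k] by (simp add: lam_def c_def mult_ac)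
qed

lemma b_pow_int: "j \<le> i \<Longrightarrow> real b ^ j * r \<in> \<int> \<Longrightarrow> real b ^ i * r \<in> \<int>"
proof -
  assume "j \<le> i" "real b ^ j * r \<in> \<int>"
  then have "real b ^ (i - j) * (real b ^ j * r) \<in> \<int>"
    using Ints_mult[of "real b ^ (i - j)" "real b ^ j * r"] by simp
  also have "real b ^ (i - j) * (real b ^ j * r) = real b ^ i * r"
    using \<open>j \<le> i\<close> by (simp flip: mult.assoc power_add)
  finally show ?thesis .
qed

lemma fAB_int: "real b ^ SS k * fA k \<in> \<int>" "real b ^ SS k * fB k \<in> \<int>" "real b ^ SS k * lam k \<in> \<int>"
proof -
  have 1: "real b ^ q1 k * fA k \<in> \<int>" "real b ^ q1 k * fB k \<in> \<int>" "real b ^ q2 k * gB k \<in> \<int>"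
    using fg_int[of "real b - 1" "- (real b - 1)" k] fg_int[of "- real u" "real v" k]
    by (simp_all add: fA_def fB_def gB_def)
  then show "real b ^ SS k * fA k \<in> \<int>" "real b ^ SS k * fB k \<in> \<int>"
    by (auto intro: b_pow_int[of "q1 k"] simp: SS_def)
  \<comment> \<open>\<open>lam\<close> does not depend on \<open>t\<close>, so it can be computed at
    t = 0, where only \<open>fB\<close> and \<open>gB\<close> enter.\<close>
  have "real b ^ SS k * lam k = (real b ^ q2 k - real b ^ q2 k * y k) * (real b ^ q1 k * fB k)
     + (real b ^ q1 k - real b ^ q1 k * x k) * (real b ^ q2 k * gB k)"
    unfolding lam_eq[of k 0] SS_def power_add by (simp add: algebra_simps)
  also have "\<dots> \<in> \<int>" unfolding bz by (intro Ints_add Ints_mult[OF _ 1(2)] Ints_mult[OF _ 1(3)] Ints_diff) auto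
  finally show "real b ^ SS k * lam k \<in> \<int>" .
qed

lemma fAB_bound: "\<bar>fA k\<bar> + \<bar>fB k\<bar> \<le> 2 ^ k * (4 * real b)"
proof -
  have "\<bar>fA k\<bar> \<le> 2 ^ k * (2 * real b)"
    using fg_bound[of "real b - 1" "- (real b - 1)" k] b
    by (simp add: fA_def) (smt (verit) mult_left_mono zero_le_power)
  moreover have "\<bar>fB k\<bar> \<le> 2 ^ k * (2 * real b)"
  proof -
    have "\<bar>fB k\<bar> \<le> 2 ^ k * (real u + real v)" using fg_bound[of "- real u" "real v" k] by (simp add: fB_def)
    also have "\<dots> \<le> 2 ^ k * (2 * real b)" using b by (intro mult_left_mono) auto
    finally show ?thesis .
  qed
  ultimately show ?thesis by (simp add: algebra_simps)
qed

text \<open>The \<open>k\<close>-th auxiliary polynomial as a polynomial in \<open>t\<close>, homogenised by \<open>lam\<close>, which is the value of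
  \<open>(1 - y) f + (1 - x) g\<close> and does not depend on \<open>t\<close>.\<close>

definition pk :: "(nat \<Rightarrow> real poly poly) \<Rightarrow> nat \<Rightarrow> nat \<Rightarrow> real \<Rightarrow> real" where
  "pk a D k t = (\<Sum>l\<le>D. beval (a l) (x k) (y k) * (fA k * t + fB k) ^ l * lam k ^ (D - l))"

lemma pk_xi: "pk a D k \<xi> = lam k ^ D * (\<Sum>l\<le>D. beval (a l) (x k) (y k) * wF (wrd (ST k)) (x k) (y k) ^ l)"
proof -
  have "beval (a l) (x k) (y k) * (lam k * w) ^ l * lam k ^ (D - l) = lam k ^ D * (beval (a l) (x k) (y k) * w ^ l)" if "l \<le> D" for l w
  proof -
    have "lam k ^ D = lam k ^ l * lam k ^ (D - l)" using that by (simp flip: power_add)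
    then show ?thesis by (simp add: power_mult_distrib mult_ac)
  qed
  then show ?thesis unfolding pk_def fA_xi by (auto simp: sum_distrib_left intro!: sum.cong)
qed

text \<open>\<open>no_common_root\<close> supplies one nonzero \<open>r\<close> for each choice of
  two polynomials, a sequence of m step types and a chart. These are finitely many choices, so the
  thresholds of \<open>beval_eventually_nonzero\<close> have a maximum.\<close>

lemma nonvanishing:
  assumes mix: "\<And>k. K \<le> k \<Longrightarrow> mixed (map e [k..<k + R])"
    and fin: "finite Fam" and Fam: "\<And>a D'. (a, D') \<in> Fam \<Longrightarrow> a D' \<noteq> 0 \<and> degree_box N (a D') \<and> D' \<le> D"
    and n: "N + D < 2 ^ n"
  shows "\<exists>K'. \<forall>k\<ge>K'. \<forall>a D0 c D1 t. (a, D0) \<in> Fam \<longrightarrow> (c, D1) \<in> Fam \<longrightarrow>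
    \<not> (pk a D0 k t = 0 \<and> pk c D1 (k + R * (n + 1 + n)) t = 0)"
proof -
  define m where "m = R * (n + 1 + n)"
  define TS where "TS = {ts :: (bool \<times> bool) list. set ts \<subseteq> UNIV \<and> length ts = m \<and>
    (\<exists>bs. map fst ts = concat bs \<and> (\<forall>es\<in>set bs. mixed es) \<and> length bs = n + 1 + n)}"
  have finTS: "finite TS" unfolding TS_def
    by (rule finite_subset[OF _ finite_lists_length_eq[of UNIV m]]) auto
  define Idx where "Idx = Fam \<times> Fam \<times> TS \<times> {0, 1 :: real}"
  define good where "good i r \<longleftrightarrow> (case i of ((a, D0), (c, D1), ts, s) \<Rightarrow> r \<noteq> 0 \<and> (\<forall>x y f g X Y F G D.
      rsteps ts (x, y, f, g, 1) = (X, Y, F, G, D) \<longrightarrow> g + s * f \<noteq> 0 \<longrightarrow>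
      (\<Sum>l\<le>D0. beval (a l) x y * f ^ l * ((1 - y) * f + (1 - x) * g) ^ (D0 - l)) = 0 \<longrightarrow>
      (\<Sum>l\<le>D1. beval (c l) X Y * F ^ l * ((1 - Y) * F + (1 - X) * G) ^ (D1 - l)) = 0 \<longrightarrow>
      beval r x y = 0))" for i r
  have "\<exists>r. good i r" if "i \<in> Idx" for i
  proof -
    obtain a D0 c D1 ts s where i: "i = ((a, D0), (c, D1), ts, s)" by (metis surj_pair)
    have 1: "(a, D0) \<in> Fam" "(c, D1) \<in> Fam" "ts \<in> TS" using that by (auto simp: i Idx_def)
    then obtain bs where bs: "map fst ts = concat bs" "\<forall>es\<in>set bs. mixed es" "length bs = n + 1 + n"
      by (auto simp: TS_def)
    show ?thesis unfolding good_def i prod.case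
      by (rule no_common_root[where N = N and bs = bs and n = n]) (use Fam[OF 1(1)] Fam[OF 1(2)] bs n in auto)
  qed
  then obtain rr where rr: "\<And>i. i \<in> Idx \<Longrightarrow> good i (rr i)" by metis
  have "eventually (\<lambda>k. beval (rr i) (x k) (y k) \<noteq> 0) sequentially" if "i \<in> Idx" for i
    using beval_eventually_nonzero[of K R "rr i" z] mix rr[OF that] z
    unfolding good_def eventually_sequentially by (auto split: prod.splits)
  then have "eventually (\<lambda>k. \<forall>i\<in>Idx. beval (rr i) (x k) (y k) \<noteq> 0) sequentially"
    using fin finTS by (intro eventually_ball_finite) (auto simp: Idx_def)
  then obtain K0 where K0: "\<And>k i. K0 \<le> k \<Longrightarrow> i \<in> Idx \<Longrightarrow> beval (rr i) (x k) (y k) \<noteq> 0"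
    unfolding eventually_sequentially by blast
  have False if k: "max K K0 \<le> k" and ac: "(a, D0) \<in> Fam" "(c, D1) \<in> Fam"
    and z0: "pk a D0 k t = 0" and z1: "pk c D1 (k + m) t = 0" for k a D0 c D1 t
  proof -
    define f g where "f = fA k * t + fB k" and "g = gA k * t + gB k"
    \<comment> \<open>Choice of the chart; (f, g) is not zero, since the form has the nonzero value
      \<open>lam\<close> at it.\<close>
    define s :: real where "s = (if g = 0 then 1 else 0)"
    have fg0: "f \<noteq> 0 \<or> g \<noteq> 0" using lam_nonzero[of k] lam_eq[of k t] by (auto simp: f_def g_def)
    have gs: "g + s * f \<noteq> 0" using fg0 by (auto simp: s_def)
    have seg: "seg k m \<in> TS"
    proof -
      have "map fst (seg k m) = map e [k..<k + m]" by (simp add: seg_def e_def)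
      also have "\<dots> = concat (map (\<lambda>i. map e [k + i * R..<k + i * R + R]) [0..<n + 1 + n])"
        unfolding m_def by (rule map_upt_blocks)
      finally show ?thesis unfolding TS_def using k mix
        by (auto simp: seg_def intro!: exI[of _ "map (\<lambda>i. map e [k + i * R..<k + i * R + R]) [0..<n + 1 + n]"])
    qed
    define i where "i = ((a, D0), (c, D1), seg k m, s)"
    have i: "i \<in> Idx" using ac seg by (auto simp: i_def Idx_def s_def)
    have "rsteps (seg k m) (x k, y k, f, g, cD k) =
      (x (k + m), y (k + m), fA (k + m) * t + fB (k + m), gA (k + m) * t + gB (k + m), cD (k + m))"
      using rsteps_chain[of k m "(real b - 1) * t - real u" "real v - (real b - 1) * t"]
      by (simp add: fg_t f_def g_def)
    from rsteps_unit_scale[OF this] obtain D' where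
      st: "rsteps (seg k m) (x k, y k, f, g, 1) =
      (x (k + m), y (k + m), fA (k + m) * t + fB (k + m), gA (k + m) * t + gB (k + m), D')" by blast
    have "beval (rr i) (x k) (y k) = 0"
      using rr[OF i] st gs z0 z1 unfolding good_def i_def prod.case pk_def lam_eq[of k t] lam_eq[of "k + m" t] f_def[symmetric] g_def[symmetric]
      by blast
    then show False using K0[of k i] k i by simp
  qed
  then show ?thesis unfolding m_def[symmetric] by (intro exI[of _ "max K K0"]) blast
qed

end

section \<open>The approximation estimate\<close>

lemma poly_lipschitz:
  fixes p :: "real poly"
  assumes "degree p \<le> D" "\<And>i. \<bar>coeff p i\<bar> \<le> L" "\<bar>s\<bar> \<le> B" "\<bar>t\<bar> \<le> B" "1 \<le> B"
  shows "\<bar>poly p s - poly p t\<bar> \<le> \<bar>s - t\<bar> * (L * (real (D + 1) * real D * B ^ D))"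
proof -
  have L0: "0 \<le> L" using assms(2)[of 0] by linarith
  have e: "poly p r = (\<Sum>i\<le>D. coeff p i * r ^ i)" for r
    unfolding poly_altdef by (rule sum.mono_neutral_left) (use assms(1) in \<open>auto simp: coeff_eq_0\<close>)
  have "\<bar>poly p s - poly p t\<bar> = \<bar>\<Sum>i\<le>D. coeff p i * (s ^ i - t ^ i)\<bar>"
    unfolding e by (simp add: right_diff_distrib sum_subtractf)
  also have "\<dots> \<le> (\<Sum>i\<le>D. \<bar>coeff p i * (s ^ i - t ^ i)\<bar>)" by (rule sum_abs)
  also have "\<dots> \<le> (\<Sum>i\<le>D. L * (real D * B ^ D * \<bar>s - t\<bar>))"
  proof (rule sum_mono)
    fix i assume i: "i \<in> {..D}"
    have "\<bar>s ^ i - t ^ i\<bar> \<le> real i * B ^ i * \<bar>s - t\<bar>" by (rule power_diff_le[OF assms(3-5)])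
    also have "\<dots> \<le> real D * B ^ D * \<bar>s - t\<bar>" using i assms(5) by (intro mult_mono power_increasing) auto
    finally show "\<bar>coeff p i * (s ^ i - t ^ i)\<bar> \<le> L * (real D * B ^ D * \<bar>s - t\<bar>)"
      unfolding abs_mult using assms(2)[of i] L0 by (intro mult_mono) auto
  qed
  also have "\<dots> = \<bar>s - t\<bar> * (L * (real (D + 1) * real D * B ^ D))" by (simp add: algebra_simps)
  finally show ?thesis .
qed

lemma coeff_linear_power_le:
  fixes A B :: real
  shows "\<bar>coeff ([:B, A:] ^ l) i\<bar> \<le> (\<bar>A\<bar> + \<bar>B\<bar>) ^ l"
proof (induction l arbitrary: i)
  case 0
  show ?case by (simp add: coeff_1)
next
  case (Suc l)
  have "coeff ([:B, A:] ^ Suc l) i = B * coeff ([:B, A:] ^ l) i + A * (if i = 0 then 0 else coeff ([:B, A:] ^ l) (i - 1))"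
    by (cases i) (auto simp: coeff_pCons)
  then have "\<bar>coeff ([:B, A:] ^ Suc l) i\<bar> \<le> \<bar>B\<bar> * \<bar>coeff ([:B, A:] ^ l) i\<bar> + \<bar>A\<bar> * \<bar>if i = 0 then 0 else coeff ([:B, A:] ^ l) (i - 1)\<bar>"
    by (metis abs_mult abs_triangle_ineq)
  also have "\<dots> \<le> \<bar>B\<bar> * (\<bar>A\<bar> + \<bar>B\<bar>) ^ l + \<bar>A\<bar> * (\<bar>A\<bar> + \<bar>B\<bar>) ^ l"
    using Suc by (intro add_mono mult_left_mono) auto
  finally show ?case by (simp add: algebra_simps)
qed

lemma int_poly_of_real_poly:
  fixes P :: "real poly"
  assumes "\<And>i. coeff P i \<in> \<int>"
  obtains p :: "int poly" where "map_poly of_int p = P" "degree p \<le> degree P"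
proof
  define p where "p = map_poly floor P"
  show "map_poly of_int p = P"
    by (rule poly_eqI) (use assms in \<open>auto simp: p_def coeff_map_poly\<close>)
  show "degree p \<le> degree P" unfolding p_def by (rule degree_map_poly_le)
qed

lemma coeff_mult_Ints:
  fixes p q :: "real poly"
  assumes "\<And>i. coeff p i \<in> \<int>" "\<And>i. coeff q i \<in> \<int>"
  shows "coeff (p * q) i \<in> \<int>"
  unfolding coeff_mult using assms by (intro Ints_sum Ints_mult) auto

lemma coeff_power_Ints:
  fixes p :: "real poly"
  assumes "\<And>i. coeff p i \<in> \<int>"
  shows "coeff (p ^ l) i \<in> \<int>"
proof (induction l arbitrary: i)
  case 0
  show ?case by (simp add: coeff_1)
next
  case (Suc l)
  then show ?case using coeff_mult_Ints[of p "p ^ l" i] assms by simp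
qed

context sturm_num
begin

lemma beval_int:
  assumes "int_coeffs r" "bsupp r \<subseteq> {..N} \<times> {..N}"
  shows "real b ^ (N * SS k) * beval r (x k) (y k) \<in> \<int>"
proof -
  have "real b ^ (N * SS k) * (bcoeff r i j * (x k) ^ i * (y k) ^ j) \<in> \<int>" if "(i, j) \<in> bsupp r" for i j
  proof -
    have "i \<le> N" "j \<le> N" using that assms(2) by auto
    then have le: "q1 k * i + q2 k * j \<le> N * SS k"
      unfolding SS_def distrib_left by (metis add_mono mult.commute mult_le_mono1)
    have "real b ^ (N * SS k) * z ^ (q1 k * i + q2 k * j) = real b ^ (N * SS k - (q1 k * i + q2 k * j)) * (real b ^ (q1 k * i + q2 k * j) * z ^ (q1 k * i + q2 k * j))"
      using le by (simp flip: power_add mult.assoc)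
    also have "\<dots> = real b ^ (N * SS k - (q1 k * i + q2 k * j))" by (simp only: bz mult_1_right)
    finally have pw: "real b ^ (N * SS k) * z ^ (q1 k * i + q2 k * j) = real b ^ (N * SS k - (q1 k * i + q2 k * j))" .
    have "real b ^ (N * SS k) * (bcoeff r i j * (x k) ^ i * (y k) ^ j) = bcoeff r i j * (real b ^ (N * SS k) * ((x k) ^ i * (y k) ^ j))"
      by (simp only: mult_ac)
    also have "(x k) ^ i * (y k) ^ j = z ^ (q1 k * i + q2 k * j)" by (simp add: power_add power_mult)
    finally have eq: "real b ^ (N * SS k) * (bcoeff r i j * (x k) ^ i * (y k) ^ j) = bcoeff r i j * real b ^ (N * SS k - (q1 k * i + q2 k * j))"
      by (simp only: pw)
    have "bcoeff r i j * real b ^ (N * SS k - (q1 k * i + q2 k * j)) \<in> \<int>"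
      using assms(1) by (auto simp: int_coeffs_def)
    then show ?thesis by (simp only: eq)
  qed
  then show ?thesis unfolding beval_altdef sum_distrib_left by (intro Ints_sum) auto
qed

lemma pk_int_poly:
  assumes fam: "\<And>l. int_coeffs (a l) \<and> bsupp (a l) \<subseteq> {..N} \<times> {..N}"
  shows "\<exists>ph::int poly. degree ph \<le> D \<and>
    (\<forall>t. poly (map_poly of_int ph) t = real b ^ ((N + D) * SS k) * pk a D k t) \<and>
    (\<forall>i. \<bar>of_int (coeff ph i)\<bar> \<le> (\<Sum>l\<le>D. norm1 (a l)) * real b ^ (N * SS k) * (real b ^ SS k * (2 ^ k * (4 * real b))) ^ D)"
proof -
  define \<beta> where "\<beta> = real b ^ SS k"
  define W where "W = 2 ^ k * (4 * real b)"
  define c where "c l = real b ^ (N * SS k) * beval (a l) (x k) (y k) * (\<beta> * lam k) ^ (D - l)" for l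
  define Q where "Q = [:\<beta> * fB k, \<beta> * fA k:]"
  define P where "P = (\<Sum>l\<le>D. Polynomial.smult (c l) (Q ^ l))"
  have \<beta>: "0 < \<beta>" using b by (simp add: \<beta>_def)
  have Qint: "coeff Q i \<in> \<int>" for i
    using fAB_int[of k] by (auto simp: Q_def coeff_pCons \<beta>_def split: nat.splits)
  have cint: "c l \<in> \<int>" for l
    unfolding c_def using fam[of l] fAB_int(3)[of k] by (intro Ints_mult[OF beval_int Ints_power]) (auto simp: \<beta>_def)
  have Pint: "coeff P i \<in> \<int>" for i
    unfolding P_def coeff_sum coeff_smult by (intro Ints_sum Ints_mult cint coeff_power_Ints Qint)
  obtain ph :: "int poly" where ph: "map_poly of_int ph = P" "degree ph \<le> degree P"
    using int_poly_of_real_poly[OF Pint] by blast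
  have dQ: "degree (Q ^ l) \<le> l" for l
    by (rule degree_linear_power_le) (simp add: Q_def)
  have degP: "degree P \<le> D" unfolding P_def
    by (intro degree_sum_le) (auto intro: order_trans[OF degree_smult_le] order_trans[OF dQ])
  have evP: "poly P t = real b ^ ((N + D) * SS k) * pk a D k t" for t
  proof -
    have Qt: "poly Q t = \<beta> * (fA k * t + fB k)" by (simp add: Q_def algebra_simps)
    have "c l * (\<beta> * (fA k * t + fB k)) ^ l = real b ^ ((N + D) * SS k) * (beval (a l) (x k) (y k) * (fA k * t + fB k) ^ l * lam k ^ (D - l))"
      if "l \<le> D" for l
    proof -
      have "\<beta> ^ (D - l) * \<beta> ^ l = \<beta> ^ D" using that by (simp flip: power_add)
      moreover have "real b ^ ((N + D) * SS k) = real b ^ (N * SS k) * \<beta> ^ D"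
        by (simp add: \<beta>_def distrib_right power_add mult.commute[of D] power_mult)
      ultimately show ?thesis by (simp add: c_def power_mult_distrib mult_ac)
    qed
    then show ?thesis by (simp add: P_def poly_sum Qt pk_def sum_distrib_left)
  qed
  have bndP: "\<bar>coeff P i\<bar> \<le> (\<Sum>l\<le>D. norm1 (a l)) * real b ^ (N * SS k) * (\<beta> * W) ^ D" for i
  proof -
    have W: "real b \<le> W" "0 \<le> W"
    proof -
      have "1 * real b \<le> 2 ^ k * (4 * real b)" using b by (intro mult_mono) auto
      then show "real b \<le> W" "0 \<le> W" by (auto simp: W_def)
    qed
    have "\<bar>coeff P i\<bar> \<le> (\<Sum>l\<le>D. \<bar>c l * coeff (Q ^ l) i\<bar>)"
      unfolding P_def coeff_sum coeff_smult by (rule sum_abs)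
    also have "\<dots> \<le> (\<Sum>l\<le>D. norm1 (a l) * real b ^ (N * SS k) * (\<beta> * W) ^ D)"
    proof (rule sum_mono)
      fix l assume l: "l \<in> {..D}"
      have "\<bar>coeff (Q ^ l) i\<bar> \<le> (\<bar>\<beta> * fA k\<bar> + \<bar>\<beta> * fB k\<bar>) ^ l" unfolding Q_def by (rule coeff_linear_power_le)
      also have "\<bar>\<beta> * fA k\<bar> + \<bar>\<beta> * fB k\<bar> = \<beta> * (\<bar>fA k\<bar> + \<bar>fB k\<bar>)" using \<beta> by (simp add: abs_mult distrib_left)
      also have "(\<beta> * (\<bar>fA k\<bar> + \<bar>fB k\<bar>)) ^ l \<le> (\<beta> * W) ^ l"
        using \<beta> fAB_bound[of k] by (intro power_mono mult_left_mono) (auto simp: W_def)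
      finally have 1: "\<bar>coeff (Q ^ l) i\<bar> \<le> (\<beta> * W) ^ l" .
      have "\<bar>(\<beta> * lam k) ^ (D - l)\<bar> \<le> (\<beta> * W) ^ (D - l)"
        unfolding power_abs using lam_bound[of k] W \<beta> by (intro power_mono) (auto simp: abs_mult)
      moreover have "\<bar>beval (a l) (x k) (y k)\<bar> \<le> norm1 (a l)" using xy[of k] by (intro abs_beval_le_norm1) auto
      ultimately have 2: "\<bar>c l\<bar> \<le> real b ^ (N * SS k) * norm1 (a l) * (\<beta> * W) ^ (D - l)"
        unfolding c_def abs_mult using norm1_nonneg[of "a l"] by (intro mult_mono) auto
      have "\<bar>c l * coeff (Q ^ l) i\<bar> \<le> (real b ^ (N * SS k) * norm1 (a l) * (\<beta> * W) ^ (D - l)) * (\<beta> * W) ^ l"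
        unfolding abs_mult using 1 2 norm1_nonneg[of "a l"] W \<beta> by (intro mult_mono) auto
      also have "\<dots> = norm1 (a l) * real b ^ (N * SS k) * ((\<beta> * W) ^ (D - l) * (\<beta> * W) ^ l)" by (simp only: mult_ac)
      also have "(\<beta> * W) ^ (D - l) * (\<beta> * W) ^ l = (\<beta> * W) ^ D" using l by (simp flip: power_add)
      finally show "\<bar>c l * coeff (Q ^ l) i\<bar> \<le> norm1 (a l) * real b ^ (N * SS k) * (\<beta> * W) ^ D" .
    qed
    finally show ?thesis by (simp only: sum_distrib_right)
  qed
  show ?thesis
  proof (intro exI[of _ ph] conjI allI)
    show "degree ph \<le> D" using ph(2) degP by simp
    show "poly (map_poly of_int ph) t = real b ^ ((N + D) * SS k) * pk a D k t" for t
      unfolding ph(1) by (rule evP)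
    fix i
    have "of_int (coeff ph i) = coeff P i" unfolding ph(1)[symmetric] by (simp add: coeff_map_poly)
    then show "\<bar>of_int (coeff ph i)\<bar> \<le> (\<Sum>l\<le>D. norm1 (a l)) * real b ^ (N * SS k) * (real b ^ SS k * (2 ^ k * (4 * real b))) ^ D"
      using bndP[of i] unfolding \<beta>_def W_def by simp
  qed
qed

text \<open>The auxiliary polynomial is chosen by the prefix of the desubstituted word only, so that finitely
  many polynomials occur and all constants are uniform in \<open>k\<close>.\<close>

definition lword :: "bool list \<Rightarrow> nat \<Rightarrow> bool" where
  "lword bl i = (i < length bl \<and> bl ! i)"

definition fam :: "nat \<Rightarrow> nat \<Rightarrow> nat \<Rightarrow> bool list \<Rightarrow> nat \<Rightarrow> real poly poly" where
  "fam N D V bl = (SOME a. aux_family N D V (lword bl) a)"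

text \<open>The true degree in \<open>t\<close>: \<open>no_common_root\<close> asks for a nonzero
  top coefficient, whereas the box principle only bounds the degree.\<close>

definition topdeg :: "nat \<Rightarrow> (nat \<Rightarrow> real poly poly) \<Rightarrow> nat" where
  "topdeg D a = Max {l. l \<le> D \<and> a l \<noteq> 0}"

definition prefix :: "nat \<Rightarrow> nat \<Rightarrow> bool list" where
  "prefix V k = map (wrd (ST k)) [0..<V]"

lemma wP_prefix: "wP (lword (prefix V k)) V = wP (wrd (ST k)) V"
  by (rule wP_cong) (simp add: lword_def prefix_def)

lemma fam:
  assumes "V * V < (N + 1) * (N + 1) * (D + 1)"
  shows "aux_family N D V (lword bl) (fam N D V bl)"
  unfolding fam_def by (rule someI_ex[OF aux_family_exists[OF assms]])

lemma fam_prefix: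
  assumes "V * V < (N + 1) * (N + 1) * (D + 1)"
  shows "aux_family N D V (wrd (ST k)) (fam N D V (prefix V k))"
  using fam[OF assms, of "prefix V k"] by (simp add: aux_family_def wP_prefix)

lemma topdeg:
  assumes "aux_family N D V s a"
  shows "topdeg D a \<le> D" "a (topdeg D a) \<noteq> 0" "\<And>l. topdeg D a < l \<Longrightarrow> a l = 0"
proof -
  have ne: "{l. l \<le> D \<and> a l \<noteq> 0} \<noteq> {}" using assms by (auto simp: aux_family_def)
  have "topdeg D a \<in> {l. l \<le> D \<and> a l \<noteq> 0}" unfolding topdeg_def using ne by (intro Max_in) auto
  then show "topdeg D a \<le> D" "a (topdeg D a) \<noteq> 0" by auto
  fix l assume l: "topdeg D a < l"
  show "a l = 0"
  proof (rule ccontr)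
    assume "a l \<noteq> 0"
    then have "l \<in> {l. l \<le> D \<and> a l \<noteq> 0}" using assms by (auto simp: aux_family_def not_le[symmetric])
    then have "l \<le> topdeg D a" unfolding topdeg_def by (intro Max_ge) auto
    then show False using l by simp
  qed
qed

definition pkk :: "nat \<Rightarrow> nat \<Rightarrow> nat \<Rightarrow> nat \<Rightarrow> real \<Rightarrow> real" where
  "pkk N D V k = pk (fam N D V (prefix V k)) (topdeg D (fam N D V (prefix V k))) k"

lemma pkk_nonvanishing:
  assumes mix: "\<And>k. K \<le> k \<Longrightarrow> mixed (map e [k..<k + R])"
    and V: "V * V < (N + 1) * (N + 1) * (D + 1)" and n: "N + D < 2 ^ n"
  shows "\<exists>K'. \<forall>k\<ge>K'. \<forall>t. \<not> (pkk N D V k t = 0 \<and> pkk N D V (k + R * (n + 1 + n)) t = 0)"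
proof -
  define Fam where "Fam = (\<lambda>bl. (fam N D V bl, topdeg D (fam N D V bl))) ` {bl. set bl \<subseteq> UNIV \<and> length bl = V}"
  have fin: "finite Fam" unfolding Fam_def by (intro finite_imageI finite_lists_length_eq) auto
  have F: "a D' \<noteq> 0 \<and> degree_box N (a D') \<and> D' \<le> D" if aD: "(a, D') \<in> Fam" for a D'
  proof -
    obtain bl where bl: "a = fam N D V bl" "D' = topdeg D (fam N D V bl)" using aD by (auto simp: Fam_def)
    show ?thesis using topdeg[OF fam[OF V, of bl]] fam[OF V, of bl] unfolding bl degree_box_def aux_family_def by blast
  qed
  have mem: "(fam N D V (prefix V k), topdeg D (fam N D V (prefix V k))) \<in> Fam" for k
    unfolding Fam_def by (rule imageI) (simp add: prefix_def)
  obtain K' where K': "\<forall>k\<ge>K'. \<forall>a D0 c D1 t. (a, D0) \<in> Fam \<longrightarrow> (c, D1) \<in> Fam \<longrightarrow>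
    \<not> (pk a D0 k t = 0 \<and> pk c D1 (k + R * (n + 1 + n)) t = 0)"
    using nonvanishing[of K R Fam N D n] mix fin F n by blast
  show ?thesis unfolding pkk_def using K' mem by blast
qed

lemma pkk_xi_small:
  assumes V: "V * V < (N + 1) * (N + 1) * (D + 1)"
  shows "\<exists>C\<ge>0. \<forall>k. \<bar>pkk N D V k \<xi>\<bar> \<le> C * z ^ (V * min (q1 k) (q2 k))"
proof -
  define c where "c bl = norm1 (\<Sum>l\<le>D. fam N D V bl l * wP (lword bl) V ^ l) +
    (\<Sum>l\<le>D. norm1 (fam N D V bl l) * (real l * 2 ^ l * 2))" for bl
  have c0: "0 \<le> c bl" for bl unfolding c_def by (intro add_nonneg_nonneg sum_nonneg mult_nonneg_nonneg norm1_nonneg) auto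
  define LL where "LL = {bl :: bool list. set bl \<subseteq> UNIV \<and> length bl = V}"
  have finL: "finite LL" unfolding LL_def by (rule finite_lists_length_eq) simp
  define C where "C = (\<Sum>bl\<in>LL. c bl)"
  have C: "c (prefix V k) \<le> C" for k
    unfolding C_def using finL c0 by (intro member_le_sum) (auto simp: LL_def prefix_def)
  have C0: "0 \<le> C" unfolding C_def using c0 by (intro sum_nonneg) auto
  have "\<bar>pkk N D V k \<xi>\<bar> \<le> (real b ^ D * C) * z ^ (V * min (q1 k) (q2 k))" for k
  proof -
    define a where "a = fam N D V (prefix V k)"
    define D' where "D' = topdeg D a"
    have af: "aux_family N D V (wrd (ST k)) a" unfolding a_def by (rule fam_prefix[OF V])
    note td = topdeg[OF af, folded D'_def]
    define m where "m = z ^ min (q1 k) (q2 k)"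
    have m: "x k \<le> m" "y k \<le> m" unfolding m_def using z by (auto intro!: power_decreasing)
    have "m = x k \<or> m = y k" by (simp add: m_def min_def)
    then have m2: "m \<le> 1/2" using xy[of k] by auto
    have "(\<Sum>l\<le>D. beval (a l) (x k) (y k) * wF (wrd (ST k)) (x k) (y k) ^ l)
      = (\<Sum>l\<le>D'. beval (a l) (x k) (y k) * wF (wrd (ST k)) (x k) (y k) ^ l)"
      by (rule sum.mono_neutral_right) (use td in auto)
    then have "\<bar>\<Sum>l\<le>D'. beval (a l) (x k) (y k) * wF (wrd (ST k)) (x k) (y k) ^ l\<bar> \<le> c (prefix V k) * m ^ V"
      using aux_family_small[OF af _ m(1) _ m(2) m2] xy[of k] unfolding c_def a_def wP_prefix by simp
    also have "\<dots> \<le> C * m ^ V" using C z by (intro mult_right_mono) (auto simp: m_def)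
    finally have 1: "\<bar>\<Sum>l\<le>D'. beval (a l) (x k) (y k) * wF (wrd (ST k)) (x k) (y k) ^ l\<bar> \<le> C * m ^ V" .
    have "\<bar>lam k ^ D'\<bar> \<le> real b ^ D'" unfolding power_abs by (intro power_mono lam_bound) auto
    also have "\<dots> \<le> real b ^ D" using b td by (intro power_increasing) auto
    finally have 2: "\<bar>lam k ^ D'\<bar> \<le> real b ^ D" .
    have "\<bar>pkk N D V k \<xi>\<bar> \<le> real b ^ D * (C * m ^ V)"
      unfolding pkk_def pk_xi abs_mult a_def[symmetric] D'_def[symmetric] using 1 2 C0 by (intro mult_mono) auto
    then show ?thesis by (simp add: m_def mult_ac flip: power_mult)
  qed
  then show ?thesis using C0 by (intro exI[of _ "real b ^ D * C"]) auto
qed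

text \<open>Write \<beta> for b^(SS k). The values of the coefficients cost \<beta>^N in
  denominators, and the powers of the linear form and \<open>lam\<close> cost \<beta>^D. The second
  \<beta>^D in the bound for the integer coefficients comes from the growth 2^k \<le> \<beta> of
  \<open>fA\<close> and \<open>fB\<close>.\<close>

lemma pkk_poly:
  assumes V: "V * V < (N + 1) * (N + 1) * (D + 1)"
  shows "\<exists>C\<ge>1. \<forall>k. \<exists>ph::int poly. degree ph \<le> D \<and>
    (\<exists>c. 1 \<le> c \<and> c \<le> (real b ^ SS k) ^ (N + D) \<and> (\<forall>t. poly (map_poly of_int ph) t = c * pkk N D V k t)) \<and>
    (\<forall>i. \<bar>of_int (coeff ph i)\<bar> \<le> C * (real b ^ SS k) ^ (N + 2 * D))"
proof -
  define LL where "LL = {bl :: bool list. set bl \<subseteq> UNIV \<and> length bl = V}"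
  have finL: "finite LL" unfolding LL_def by (rule finite_lists_length_eq) simp
  define s where "s bl = (\<Sum>l\<le>D. norm1 (fam N D V bl l))" for bl
  have s0: "0 \<le> s bl" for bl unfolding s_def by (intro sum_nonneg norm1_nonneg)
  define C where "C = (1 + (\<Sum>bl\<in>LL. s bl)) * (4 * real b) ^ D"
  have b1: "1 \<le> (4 * real b) ^ D" using b by (intro one_le_power) auto
  have sum0: "0 \<le> (\<Sum>bl\<in>LL. s bl)" using s0 by (intro sum_nonneg) auto
  have C1: "1 \<le> C" unfolding C_def using mult_mono[of 1 "1 + (\<Sum>bl\<in>LL. s bl)" 1 "(4 * real b) ^ D"] b1 sum0 by simp
  have "\<exists>ph::int poly. degree ph \<le> D \<and>
    (\<exists>c. 1 \<le> c \<and> c \<le> (real b ^ SS k) ^ (N + D) \<and> (\<forall>t. poly (map_poly of_int ph) t = c * pkk N D V k t)) \<and>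
    (\<forall>i. \<bar>of_int (coeff ph i)\<bar> \<le> C * (real b ^ SS k) ^ (N + 2 * D))" for k
  proof -
    define a where "a = fam N D V (prefix V k)"
    define D' where "D' = topdeg D a"
    define \<beta> where "\<beta> = real b ^ SS k"
    have \<beta>: "1 \<le> \<beta>" using b by (simp add: \<beta>_def)
    have af: "aux_family N D V (wrd (ST k)) a" unfolding a_def by (rule fam_prefix[OF V])
    note td = topdeg[OF af, folded D'_def]
    have fm: "int_coeffs (a l) \<and> bsupp (a l) \<subseteq> {..N} \<times> {..N}" for l using af by (auto simp: aux_family_def)
    obtain ph :: "int poly" where ph: "degree ph \<le> D'"
      "\<And>t. poly (map_poly of_int ph) t = real b ^ ((N + D') * SS k) * pk a D' k t"
      "\<And>i. \<bar>of_int (coeff ph i)\<bar> \<le> (\<Sum>l\<le>D'. norm1 (a l)) * real b ^ (N * SS k) * (real b ^ SS k * (2 ^ k * (4 * real b))) ^ D'"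
      using pk_int_poly[of a N D' k] fm by blast
    have c: "real b ^ ((N + D') * SS k) = \<beta> ^ (N + D')" by (simp add: \<beta>_def mult.commute flip: power_mult)
    have "(2::real) ^ k \<le> 2 ^ SS k" using SS_ge[of k] by (intro power_increasing) auto
    also have "(2::real) ^ SS k \<le> \<beta>" unfolding \<beta>_def using b by (intro power_mono) auto
    finally have k2: "2 ^ k \<le> \<beta>" .
    have bnd: "\<bar>of_int (coeff ph i)\<bar> \<le> C * \<beta> ^ (N + 2 * D)" for i
    proof -
      have "(\<Sum>l\<le>D'. norm1 (a l)) \<le> s (prefix V k)"
        unfolding s_def a_def[symmetric] using td norm1_nonneg by (intro sum_mono2) auto
      also have "\<dots> \<le> (\<Sum>bl\<in>LL. s bl)" using finL s0 by (intro member_le_sum) (auto simp: LL_def prefix_def)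
      finally have 1: "(\<Sum>l\<le>D'. norm1 (a l)) \<le> 1 + (\<Sum>bl\<in>LL. s bl)" by simp
      have "\<beta> * (2 ^ k * (4 * real b)) \<le> \<beta> * (\<beta> * (4 * real b))"
        using \<beta> k2 b by (intro mult_left_mono mult_right_mono) auto
      then have "(\<beta> * (2 ^ k * (4 * real b))) ^ D' \<le> (\<beta> * (\<beta> * (4 * real b))) ^ D'"
        using \<beta> by (intro power_mono) auto
      also have "\<dots> \<le> (\<beta> * (\<beta> * (4 * real b))) ^ D"
      proof (rule power_increasing[OF td(1)])
        have "1 * (1 * 1) \<le> \<beta> * (\<beta> * (4 * real b))" using \<beta> b by (intro mult_mono) auto
        then show "1 \<le> \<beta> * (\<beta> * (4 * real b))" by simp
      qed
      also have "\<dots> = \<beta> ^ (2 * D) * (4 * real b) ^ D" by (simp add: power_mult_distrib mult_2 power_add)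
      finally have 2: "(\<beta> * (2 ^ k * (4 * real b))) ^ D' \<le> \<beta> ^ (2 * D) * (4 * real b) ^ D" .
      have "\<bar>of_int (coeff ph i)\<bar> \<le> (\<Sum>l\<le>D'. norm1 (a l)) * \<beta> ^ N * (\<beta> * (2 ^ k * (4 * real b))) ^ D'"
        using ph(3)[of i] by (simp add: \<beta>_def mult.commute flip: power_mult)
      also have "\<dots> \<le> (1 + (\<Sum>bl\<in>LL. s bl)) * \<beta> ^ N * (\<beta> ^ (2 * D) * (4 * real b) ^ D)"
        using 1 2 \<beta> sum0 by (intro mult_mono) auto
      also have "\<dots> = C * \<beta> ^ (N + 2 * D)" by (simp add: C_def power_add mult_ac)
      finally show ?thesis .
    qed
    have "\<beta> ^ (N + D') \<le> \<beta> ^ (N + D)" using \<beta> td by (intro power_increasing) auto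
    moreover have "1 \<le> \<beta> ^ (N + D')" using \<beta> by (rule one_le_power)
    moreover have "poly (map_poly of_int ph) t = \<beta> ^ (N + D') * pkk N D V k t" for t
      using ph(2)[of t] unfolding c pkk_def a_def[symmetric] D'_def[symmetric] .
    ultimately show ?thesis unfolding \<beta>_def[symmetric] using ph(1) td(1) bnd
      by (intro exI[of _ ph] conjI exI[of _ "\<beta> ^ (N + D')"]) auto
  qed
  then show ?thesis using C1 by blast
qed

text \<open>Put X = (b^(SS k))^(n^2). Liouville costs X^(3d) for the coefficients and X for H;
  clearing denominators costs X^2 in the value at \<xi>, which is otherwise at most a constant times
  X^-(3d + 4). One X remains to absorb the constants, so that value is negligible and the Lipschitz
  term, of size |\<xi> - \<alpha>| X^(3d + 4), must compensate.\<close>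

lemma lower_bound:
  assumes mix: "\<And>k. K \<le> k \<Longrightarrow> mixed (map e [k..<k + R])"
    and d: "1 \<le> d" and n: "n = (R + 2) * (3 * d + 4)"
  shows "\<exists>C>0. \<exists>K'. \<forall>k\<ge>K'. \<forall>\<alpha> \<mu> H. irreducible \<mu> \<longrightarrow> poly (map_poly of_int \<mu>) \<alpha> = 0 \<longrightarrow> degree \<mu> \<le> d \<longrightarrow>
    (\<forall>i. \<bar>of_int (coeff \<mu> i)\<bar> \<le> H) \<longrightarrow> 1 \<le> H \<longrightarrow> H \<le> real b ^ SS k \<longrightarrow> \<bar>\<xi> - \<alpha>\<bar> \<le> 1 \<longrightarrow>
    pkk (n\<^sup>2) (n\<^sup>2) (n ^ 3) k \<alpha> \<noteq> 0 \<longrightarrow> 1 \<le> C * \<bar>\<xi> - \<alpha>\<bar> * (real b ^ SS k) ^ (n\<^sup>2 * (3 * d + 4))"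
proof -
  define E where "E = n\<^sup>2"
  have n1: "1 \<le> n" using n by simp
  have E1: "1 \<le> E" using n1 by (simp add: E_def)
  have V: "n ^ 3 * n ^ 3 < (E + 1) * (E + 1) * (E + 1)"
  proof -
    have "n ^ 3 * n ^ 3 = E ^ 3" by (simp add: E_def flip: power_add power_mult)
    also have "\<dots> < (E + 1) ^ 3" by (intro power_strict_mono) auto
    finally show ?thesis by (simp add: power3_eq_cube)
  qed
  obtain C1 where C1: "0 \<le> C1" "\<And>k. \<bar>pkk E E (n ^ 3) k \<xi>\<bar> \<le> C1 * z ^ (n ^ 3 * min (q1 k) (q2 k))"
    using pkk_xi_small[OF V] by blast
  obtain CL where CL: "1 \<le> CL" and phk: "\<And>k. \<exists>ph::int poly. degree ph \<le> E \<and>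
    (\<exists>c. 1 \<le> c \<and> c \<le> (real b ^ SS k) ^ (E + E) \<and> (\<forall>t. poly (map_poly of_int ph) t = c * pkk E E (n ^ 3) k t)) \<and>
    (\<forall>i. \<bar>of_int (coeff ph i)\<bar> \<le> CL * (real b ^ SS k) ^ (E + 2 * E))"
    using pkk_poly[OF V] by blast
  define B where "B = \<bar>\<xi>\<bar> + 2"
  define K1 where "K1 = real (d + E) * fact (d + E) * B ^ (d + E)"
  define K2 where "K2 = real (E + 1) * real E * B ^ E"
  have K12: "0 \<le> K1" "0 \<le> K2" by (auto simp: K1_def K2_def B_def)
  define C5 where "C5 = K1 * CL ^ d * C1"
  define C6 where "C6 = K1 * CL ^ d * (CL * K2)"
  have C56: "0 \<le> C5" "0 \<le> C6" using K12 CL C1 by (auto simp: C5_def C6_def)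
  \<comment> \<open>From \<open>k0\<close> on, the spare factor X exceeds twice the constant
    \<open>C5\<close>.\<close>
  obtain k0 :: nat where k0: "2 * C5 \<le> 2 ^ k0"
    using real_arch_pow[of 2 "2 * C5"] by (auto intro: less_imp_le)
  have main: "1 \<le> (2 * C6 + 1) * \<bar>\<xi> - \<alpha>\<bar> * (real b ^ SS k) ^ (n\<^sup>2 * (3 * d + 4))"
    if k: "max k0 (K + R) \<le> k" and mu: "irreducible \<mu>" "poly (map_poly of_int \<mu>) \<alpha> = 0" "degree \<mu> \<le> d"
      "\<And>i. \<bar>of_int (coeff \<mu> i)\<bar> \<le> H" and H: "1 \<le> H" "H \<le> real b ^ SS k" and al: "\<bar>\<xi> - \<alpha>\<bar> \<le> 1"
      and nz: "pkk (n\<^sup>2) (n\<^sup>2) (n ^ 3) k \<alpha> \<noteq> 0" for k \<alpha> \<mu> H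
  proof -
    define \<beta> where "\<beta> = real b ^ SS k"
    define X where "X = \<beta> ^ E"
    define Y where "Y = X ^ (3 * d)"
    have \<beta>: "1 \<le> \<beta>" using b by (simp add: \<beta>_def)
    have X1: "1 \<le> X" unfolding X_def using \<beta> by (rule one_le_power)
    have Y1: "1 \<le> Y" unfolding Y_def using X1 by (rule one_le_power)
    obtain ph c where ph: "degree ph \<le> E" "1 \<le> c" "c \<le> \<beta> ^ (E + E)"
      "\<And>t. poly (map_poly of_int ph) t = c * pkk E E (n ^ 3) k t"
      "\<And>i. \<bar>of_int (coeff ph i)\<bar> \<le> CL * \<beta> ^ (E + 2 * E)"
      using phk[of k] unfolding \<beta>_def by blast
    have X3: "\<beta> ^ (E + 2 * E) = X ^ 3" by (simp add: X_def mult.commute flip: power_mult)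
    have X2: "\<beta> ^ (E + E) = X ^ 2" by (simp add: X_def power2_eq_square power_add)
    define p where "p t = poly (map_poly of_int ph :: real poly) t" for t
    have pa: "p \<alpha> \<noteq> 0" using nz ph by (simp add: p_def E_def)
    have aB: "\<bar>\<alpha>\<bar> \<le> B" "1 + \<bar>\<alpha>\<bar> \<le> B" "\<bar>\<xi>\<bar> \<le> B" "1 \<le> B" using al unfolding B_def by linarith+
    have L1: "1 \<le> CL * X ^ 3" using CL X1 mult_mono[of 1 CL 1 "X ^ 3"] one_le_power[OF X1, of 3] by simp
    have "1 \<le> \<bar>p \<alpha>\<bar> * (real (d + E) * fact (d + E) * (1 + \<bar>\<alpha>\<bar>) ^ (d + E) * H ^ E * (CL * X ^ 3) ^ d)"
      unfolding p_def
      by (rule liouville_inequality[OF mu(1,2) _ H(1) mu(4) L1 _ mu(3) ph(1)])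
        (use pa ph(5) X3 E1 in \<open>auto simp: p_def\<close>)
    also have "\<dots> \<le> \<bar>p \<alpha>\<bar> * (K1 * X * (CL ^ d * Y))"
    proof (rule mult_left_mono)
      have "H ^ E \<le> X" unfolding X_def \<beta>_def using H by (intro power_mono) auto
      moreover have "(1 + \<bar>\<alpha>\<bar>) ^ (d + E) \<le> B ^ (d + E)" using aB by (intro power_mono) auto
      moreover have "(CL * X ^ 3) ^ d = CL ^ d * Y" by (simp add: Y_def power_mult_distrib power_mult)
      ultimately show "real (d + E) * fact (d + E) * (1 + \<bar>\<alpha>\<bar>) ^ (d + E) * H ^ E * (CL * X ^ 3) ^ d \<le> K1 * X * (CL ^ d * Y)"
        unfolding K1_def using CL X1 Y1 H aB by (intro mult_mono) auto
    qed simp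
    finally have lv: "1 \<le> \<bar>p \<alpha>\<bar> * (K1 * X * (CL ^ d * Y))" .
    have lip: "\<bar>p \<alpha> - p \<xi>\<bar> \<le> \<bar>\<alpha> - \<xi>\<bar> * (CL * X ^ 3 * K2)"
      unfolding p_def K2_def
      by (rule poly_lipschitz) (use ph(1,5) X3 aB in \<open>auto simp: coeff_map_poly intro: order_trans[OF degree_map_poly_le]\<close>)
    have small: "\<bar>p \<xi>\<bar> * (X ^ 4 * Y) \<le> C1 * X ^ 2"
    proof -
      have "SS k \<le> (R + 2) * min (q1 k) (q2 k)" using q_comparable[of K R k] mix k by simp
      then have "E * (3 * d + 4) * SS k \<le> E * (3 * d + 4) * ((R + 2) * min (q1 k) (q2 k))" by (rule mult_le_mono2)
      also have "\<dots> = E * n * min (q1 k) (q2 k)" unfolding n by (simp only: mult_ac)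
      also have "E * n = n ^ 3" by (simp add: E_def power2_eq_square power3_eq_cube)
      finally have ex: "SS k * (E * (3 * d + 4)) \<le> n ^ 3 * min (q1 k) (q2 k)" by (simp only: mult_ac)
      have "X ^ 4 * Y = \<beta> ^ (E * (3 * d + 4))" by (simp add: X_def Y_def add.commute flip: power_add power_mult distrib_left)
      also have "\<dots> = real b ^ (SS k * (E * (3 * d + 4)))" by (simp add: \<beta>_def flip: power_mult)
      finally have XY: "X ^ 4 * Y = real b ^ (SS k * (E * (3 * d + 4)))" .
      have "z ^ (n ^ 3 * min (q1 k) (q2 k)) * (X ^ 4 * Y) \<le> z ^ (SS k * (E * (3 * d + 4))) * (X ^ 4 * Y)"
        using z ex X1 Y1 by (intro mult_right_mono power_decreasing) auto
      also have "\<dots> = 1" unfolding XY using bz by (simp add: mult.commute)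
      finally have z1: "z ^ (n ^ 3 * min (q1 k) (q2 k)) * (X ^ 4 * Y) \<le> 1" .
      have "\<bar>p \<xi>\<bar> \<le> X ^ 2 * (C1 * z ^ (n ^ 3 * min (q1 k) (q2 k)))"
        unfolding p_def ph(4) abs_mult using ph(2,3) X2 C1 by (intro mult_mono) auto
      then have "\<bar>p \<xi>\<bar> * (X ^ 4 * Y) \<le> X ^ 2 * (C1 * z ^ (n ^ 3 * min (q1 k) (q2 k))) * (X ^ 4 * Y)"
        using X1 Y1 by (intro mult_right_mono) auto
      also have "\<dots> = X ^ 2 * C1 * (z ^ (n ^ 3 * min (q1 k) (q2 k)) * (X ^ 4 * Y))" by (simp only: mult_ac)
      also have "\<dots> \<le> X ^ 2 * C1 * 1" using z1 C1(1) by (intro mult_left_mono) auto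
      finally show ?thesis by (simp add: mult.commute)
    qed
    have s2: "\<bar>p \<xi>\<bar> * (X * Y) * X \<le> C1"
    proof -
      have "(\<bar>p \<xi>\<bar> * (X * Y) * X) * X ^ 2 \<le> C1 * X ^ 2"
        using small by (simp add: power2_eq_square power4_eq_xxxx mult_ac)
      then show ?thesis using X1 by (simp add: mult_le_cancel_right)
    qed
    have XC: "2 * C5 \<le> X"
    proof -
      have "(2::real) ^ k0 \<le> 2 ^ SS k" using k SS_ge[of k] by (intro power_increasing) auto
      also have "\<dots> \<le> \<beta>" unfolding \<beta>_def using b by (intro power_mono) auto
      also have "\<beta> \<le> X" unfolding X_def using power_increasing[OF E1 \<beta>] by simp
      finally show ?thesis using k0 by linarith
    qed
    have "\<bar>p \<alpha>\<bar> \<le> \<bar>p \<xi>\<bar> + \<bar>\<alpha> - \<xi>\<bar> * (CL * X ^ 3 * K2)" using lip by linarith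
    then have "\<bar>p \<alpha>\<bar> * (K1 * X * (CL ^ d * Y)) \<le> (\<bar>p \<xi>\<bar> + \<bar>\<alpha> - \<xi>\<bar> * (CL * X ^ 3 * K2)) * (K1 * X * (CL ^ d * Y))"
      using K12 X1 Y1 CL by (intro mult_right_mono) auto
    with lv have "1 \<le> (\<bar>p \<xi>\<bar> + \<bar>\<alpha> - \<xi>\<bar> * (CL * X ^ 3 * K2)) * (K1 * X * (CL ^ d * Y))" by linarith
    also have "\<dots> = (K1 * CL ^ d) * (\<bar>p \<xi>\<bar> * (X * Y)) + C6 * \<bar>\<alpha> - \<xi>\<bar> * (X ^ 4 * Y)"
      by (simp add: C6_def algebra_simps power3_eq_cube power4_eq_xxxx)
    finally have f1: "1 \<le> (K1 * CL ^ d) * (\<bar>p \<xi>\<bar> * (X * Y)) + C6 * \<bar>\<alpha> - \<xi>\<bar> * (X ^ 4 * Y)" .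
    have "(K1 * CL ^ d) * (\<bar>p \<xi>\<bar> * (X * Y)) \<le> 1/2"
    proof -
      have "(K1 * CL ^ d) * (\<bar>p \<xi>\<bar> * (X * Y) * X) \<le> (K1 * CL ^ d) * C1"
        using s2 K12 CL by (intro mult_left_mono) auto
      then have "(K1 * CL ^ d) * (\<bar>p \<xi>\<bar> * (X * Y)) * X \<le> C5" by (simp add: C5_def mult_ac)
      also have "C5 \<le> 1/2 * X" using XC by simp
      finally show ?thesis using X1 by (simp only: mult_le_cancel_right)
    qed
    with f1 have f2: "1 \<le> 2 * C6 * \<bar>\<alpha> - \<xi>\<bar> * (X ^ 4 * Y)" by linarith
    also have "\<dots> \<le> (2 * C6 + 1) * \<bar>\<alpha> - \<xi>\<bar> * (X ^ 4 * Y)"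
      using X1 Y1 by (intro mult_right_mono) auto
    also have "X ^ 4 * Y = \<beta> ^ (E * (3 * d + 4))" by (simp add: X_def Y_def add.commute flip: power_add power_mult distrib_left)
    finally show ?thesis by (simp add: \<beta>_def E_def abs_minus_commute)
  qed
  show ?thesis
    by (rule exI[of _ "2 * C6 + 1"], rule conjI, use C56 in linarith, rule exI[of _ "max k0 (K + R)"]) (use main in blast)
qed

end

section \<open>Heights and the exponent of approximation\<close>

lemma naive_height_bounds:
  assumes "algebraic \<alpha>"
  shows "\<bar>coeff (int_minpoly \<alpha>) i\<bar> \<le> naive_height \<alpha>" "1 \<le> naive_height \<alpha>"
proof -
  define \<mu> where "\<mu> = int_minpoly \<alpha>"
  have \<mu>: "lead_coeff \<mu> > 0" using is_int_minpoly_int_minpoly[OF assms] by (simp add: \<mu>_def is_int_minpoly_def)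
  have le: "\<bar>coeff \<mu> i\<bar> \<le> naive_height \<alpha>" if "i \<le> degree \<mu>" for i
    unfolding naive_height_def \<mu>_def[symmetric] using that by (intro Max_ge) auto
  have "1 \<le> \<bar>lead_coeff \<mu>\<bar>" using \<mu> by linarith
  also have "\<dots> \<le> naive_height \<alpha>" by (rule le) simp
  finally show 1: "1 \<le> naive_height \<alpha>" .
  show "\<bar>coeff (int_minpoly \<alpha>) i\<bar> \<le> naive_height \<alpha>"
    using le[of i] 1 unfolding \<mu>_def by (cases "i \<le> degree (int_minpoly \<alpha>)") (auto simp: coeff_eq_0 not_le)
qed

text \<open>Northcott's finiteness: finitely many integer polynomials, each with finitely many
  roots.\<close>

lemma finite_bounded_algebraic:
  "finite {\<alpha>::real. algebraic \<alpha> \<and> alg_degree \<alpha> \<le> d \<and> naive_height \<alpha> \<le> B}"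
proof -
  define PP where "PP = Poly ` {xs. set xs \<subseteq> {- B..B} \<and> length xs \<le> d + 1}"
  have fin: "finite PP" unfolding PP_def by (intro finite_imageI finite_lists_length_le) auto
  have "{\<alpha>::real. algebraic \<alpha> \<and> alg_degree \<alpha> \<le> d \<and> naive_height \<alpha> \<le> B} \<subseteq>
    (\<Union>p\<in>PP - {0}. {\<alpha>. poly (map_poly of_int p) \<alpha> = 0})"
  proof
    fix \<alpha> :: real assume "\<alpha> \<in> {\<alpha>. algebraic \<alpha> \<and> alg_degree \<alpha> \<le> d \<and> naive_height \<alpha> \<le> B}"
    then have a: "algebraic \<alpha>" "alg_degree \<alpha> \<le> d" "naive_height \<alpha> \<le> B" by auto
    define \<mu> where "\<mu> = int_minpoly \<alpha>"
    have \<mu>: "irreducible \<mu>" "poly (map_poly of_int \<mu>) \<alpha> = 0"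
      using is_int_minpoly_int_minpoly[OF a(1)] by (auto simp: \<mu>_def is_int_minpoly_def)
    have "set (coeffs \<mu>) \<subseteq> {- B..B}"
    proof
      fix c assume "c \<in> set (coeffs \<mu>)"
      then obtain i where "c = coeff \<mu> i" by (auto simp: coeffs_def split: if_splits)
      then have "\<bar>c\<bar> \<le> B" using naive_height_bounds(1)[OF a(1), of i] a(3) by (simp add: \<mu>_def)
      then show "c \<in> {- B..B}" by auto
    qed
    moreover have "length (coeffs \<mu>) \<le> d + 1" using a(2) by (simp add: coeffs_def alg_degree_def \<mu>_def)
    ultimately have "Poly (coeffs \<mu>) \<in> PP" unfolding PP_def by blast
    then have "\<mu> \<in> PP - {0}" using \<mu>(1) by auto
    then show "\<alpha> \<in> (\<Union>p\<in>PP - {0}. {\<alpha>. poly (map_poly of_int p) \<alpha> = 0})" using \<mu>(2) by blast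
  qed
  moreover have "finite (\<Union>p\<in>PP - {0}. {\<alpha>::real. poly (map_poly of_int p) \<alpha> = 0})"
  proof (rule finite_UN_I)
    fix p assume "p \<in> PP - {0}"
    then have "p \<noteq> 0" by simp
    then have "(map_poly of_int p :: real poly) \<noteq> 0"
      by (metis coeff_map_poly leading_coeff_0_iff of_int_0 of_int_eq_0_iff coeff_0)
    then show "finite {\<alpha>::real. poly (map_poly of_int p) \<alpha> = 0}" by (rule poly_roots_finite)
  qed (use fin in simp)
  ultimately show ?thesis by (rule finite_subset)
qed

context sturm_num
begin

text \<open>Take the least admissible \<open>k\<close> with H \<le> b^(SS k), so b^(SS k) \<le> H^2,
  and let k' be k or k + m, with nonzero value at \<alpha>. Then b^(SS k') \<le> H^(2 * 2^m), and
  \<open>lower_bound\<close> gives |\<xi> - \<alpha>| \<ge> 1 / (C H^W), which contradicts an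
  approximation exponent above W once H > C.\<close>

lemma wstar_bound:
  assumes mix: "\<And>k. K \<le> k \<Longrightarrow> mixed (map e [k..<k + R])"
    and d: "1 \<le> d" and n: "n = (R + 2) * (3 * d + 4)" and n1: "2 * n\<^sup>2 < 2 ^ n1"
  shows "wstar d \<xi> \<le> ereal (real (2 * (n\<^sup>2 * (3 * d + 4)) * 2 ^ (R * (n1 + 1 + n1))))"
proof -
  define E where "E = n\<^sup>2 * (3 * d + 4)"
  define m where "m = R * (n1 + 1 + n1)"
  define W where "W = 2 * E * 2 ^ m"
  obtain C K1 where C: "0 < C" and K1: "\<And>k \<alpha> \<mu> H. K1 \<le> k \<Longrightarrow> irreducible \<mu> \<Longrightarrow> poly (map_poly of_int \<mu>) \<alpha> = 0 \<Longrightarrow> degree \<mu> \<le> d \<Longrightarrow>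
    (\<forall>i. \<bar>of_int (coeff \<mu> i)\<bar> \<le> H) \<Longrightarrow> 1 \<le> H \<Longrightarrow> H \<le> real b ^ SS k \<Longrightarrow> \<bar>\<xi> - \<alpha>\<bar> \<le> 1 \<Longrightarrow>
    pkk (n\<^sup>2) (n\<^sup>2) (n ^ 3) k \<alpha> \<noteq> 0 \<Longrightarrow> 1 \<le> C * \<bar>\<xi> - \<alpha>\<bar> * (real b ^ SS k) ^ E"
    unfolding E_def using lower_bound[of K R d n] mix d n by blast
  have V: "n ^ 3 * n ^ 3 < (n\<^sup>2 + 1) * (n\<^sup>2 + 1) * (n\<^sup>2 + 1)"
  proof -
    have "n ^ 3 * n ^ 3 = (n\<^sup>2) ^ 3" by (simp flip: power_add power_mult)
    also have "\<dots> < (n\<^sup>2 + 1) ^ 3" by (intro power_strict_mono) auto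
    finally show ?thesis by (simp add: power3_eq_cube)
  qed
  obtain K2 where K2: "\<And>k t. K2 \<le> k \<Longrightarrow> \<not> (pkk (n\<^sup>2) (n\<^sup>2) (n ^ 3) k t = 0 \<and> pkk (n\<^sup>2) (n\<^sup>2) (n ^ 3) (k + m) t = 0)"
    using pkk_nonvanishing[of K R "n ^ 3" "n\<^sup>2" "n\<^sup>2" n1] mix V n1 unfolding m_def by auto
  define Ks where "Ks = max K1 K2"
  have "w \<le> real W" if inf: "infinite {\<alpha>::real. algebraic \<alpha> \<and> alg_degree \<alpha> \<le> d \<and>
       0 < \<bar>\<xi> - \<alpha>\<bar> \<and> \<bar>\<xi> - \<alpha>\<bar> < real_of_int (naive_height \<alpha>) powr (- w - 1)}" for w
  proof (rule ccontr)
    assume "\<not> w \<le> real W"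
    then have w: "real W < w" by simp
    \<comment> \<open>Heights above \<open>B\<close> exceed the constant \<open>C\<close> and also
      b^(SS Ks), so the least \<open>k\<close> below is not \<open>Ks\<close> and has an admissible
      predecessor.\<close>
    define B where "B = max \<lceil>C\<rceil> (int (b ^ SS Ks))"
    have "infinite ({\<alpha>::real. algebraic \<alpha> \<and> alg_degree \<alpha> \<le> d \<and>
       0 < \<bar>\<xi> - \<alpha>\<bar> \<and> \<bar>\<xi> - \<alpha>\<bar> < real_of_int (naive_height \<alpha>) powr (- w - 1)} -
       {\<alpha>::real. algebraic \<alpha> \<and> alg_degree \<alpha> \<le> d \<and> naive_height \<alpha> \<le> B})"
      using inf finite_bounded_algebraic by (rule Diff_infinite_finite[rotated])
    then obtain \<alpha> where a: "algebraic \<alpha>" "alg_degree \<alpha> \<le> d"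
      "\<bar>\<xi> - \<alpha>\<bar> < real_of_int (naive_height \<alpha>) powr (- w - 1)" "B < naive_height \<alpha>"
      by (metis (mono_tags, lifting) DiffE infinite_imp_nonempty equals0I mem_Collect_eq not_le)
    define H where "H = real_of_int (naive_height \<alpha>)"
    have H1: "1 \<le> H" using naive_height_bounds(2)[OF a(1)] by (simp add: H_def)
    have HC: "C < H" and HK: "real b ^ SS Ks < H"
    proof -
      have "\<lceil>C\<rceil> < naive_height \<alpha>" "int (b ^ SS Ks) < naive_height \<alpha>" using a(4) by (auto simp: B_def)
      then show "C < H" "real b ^ SS Ks < H" unfolding H_def
        by (linarith, metis of_int_less_iff of_int_of_nat_eq of_nat_power)
    qed
    have al: "\<bar>\<xi> - \<alpha>\<bar> \<le> 1"
    proof -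
      have "H powr (- w - 1) \<le> H powr 0" using H1 w by (intro powr_mono) auto
      then show ?thesis using a(3) H1 by (simp add: H_def)
    qed
    define \<mu> where "\<mu> = int_minpoly \<alpha>"
    have \<mu>: "irreducible \<mu>" "poly (map_poly of_int \<mu>) \<alpha> = 0" "degree \<mu> \<le> d"
      using is_int_minpoly_int_minpoly[OF a(1)] a(2) by (auto simp: \<mu>_def is_int_minpoly_def alg_degree_def)
    have \<mu>H: "\<forall>i. \<bar>of_int (coeff \<mu> i)\<bar> \<le> H"
      unfolding \<mu>_def H_def using naive_height_bounds(1)[OF a(1)] by (metis of_int_abs of_int_le_iff)
    have "\<exists>k. Ks \<le> k \<and> H \<le> real b ^ SS k"
    proof -
      obtain j :: nat where "H < 2 ^ j" using real_arch_pow[of 2 H] by auto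
      also have "(2::real) ^ j \<le> 2 ^ SS (max j Ks)" using SS_ge[of "max j Ks"] by (intro power_increasing) auto
      also have "\<dots> \<le> real b ^ SS (max j Ks)" using b by (intro power_mono) auto
      finally show ?thesis by (intro exI[of _ "max j Ks"]) auto
    qed
    define k where "k = (LEAST k. Ks \<le> k \<and> H \<le> real b ^ SS k)"
    have k: "Ks \<le> k" "H \<le> real b ^ SS k"
      using LeastI_ex[OF \<open>\<exists>k. Ks \<le> k \<and> H \<le> real b ^ SS k\<close>] by (auto simp: k_def)
    have "k \<noteq> Ks" using k HK by auto
    then have k1: "Ks \<le> k - 1" "k - 1 < k" using k by auto
    then have "\<not> (Ks \<le> k - 1 \<and> H \<le> real b ^ SS (k - 1))" unfolding k_def by (intro not_less_Least) (simp add: k_def)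
    then have kl: "real b ^ SS (k - 1) < H" using k1 by auto
    have "SS k \<le> 2 * SS (k - 1)" using SS_double[of "k - 1" 1] k1 by simp
    then have "real b ^ SS k \<le> real b ^ (2 * SS (k - 1))" using b by (intro power_increasing) auto
    also have "\<dots> = (real b ^ SS (k - 1)) ^ 2" by (simp add: mult.commute flip: power_mult)
    also have "\<dots> \<le> H ^ 2" using kl by (intro power_mono) auto
    finally have bk: "real b ^ SS k \<le> H ^ 2" .
    have "pkk (n\<^sup>2) (n\<^sup>2) (n ^ 3) k \<alpha> \<noteq> 0 \<or> pkk (n\<^sup>2) (n\<^sup>2) (n ^ 3) (k + m) \<alpha> \<noteq> 0"
      using K2[of k \<alpha>] k by (auto simp: Ks_def)
    then obtain k' where k': "k' = k \<or> k' = k + m" "pkk (n\<^sup>2) (n\<^sup>2) (n ^ 3) k' \<alpha> \<noteq> 0" by blast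
    have kk: "k \<le> k'" "k' \<le> k + m" using k' by auto
    have "real b ^ SS k \<le> real b ^ SS k'" using b SS_mono[OF kk(1)] by (intro power_increasing) auto
    then have "H \<le> real b ^ SS k'" using k(2) by linarith
    then have lb: "1 \<le> C * \<bar>\<xi> - \<alpha>\<bar> * (real b ^ SS k') ^ E"
      using K1[OF _ \<mu> \<mu>H H1 _ al k'(2)] k kk by (simp add: Ks_def)
    have "SS k' \<le> SS (k + m)" by (rule SS_mono[OF kk(2)])
    also have "\<dots> \<le> 2 ^ m * SS k" by (rule SS_double)
    finally have "real b ^ SS k' \<le> real b ^ (2 ^ m * SS k)" using b by (intro power_increasing) auto
    also have "\<dots> = (real b ^ SS k) ^ (2 ^ m)" by (simp add: mult.commute flip: power_mult)
    also have "\<dots> \<le> (H ^ 2) ^ (2 ^ m)" using bk by (intro power_mono) auto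
    finally have "(real b ^ SS k') ^ E \<le> ((H ^ 2) ^ (2 ^ m)) ^ E" by (intro power_mono) auto
    also have "\<dots> = H ^ W" by (simp add: W_def mult_ac flip: power_mult)
    finally have "C * \<bar>\<xi> - \<alpha>\<bar> * (real b ^ SS k') ^ E \<le> C * \<bar>\<xi> - \<alpha>\<bar> * H ^ W"
      using C by (intro mult_left_mono) auto
    with lb have l2: "1 \<le> C * \<bar>\<xi> - \<alpha>\<bar> * H ^ W" by linarith
    also have "\<dots> \<le> C * H powr (- w - 1) * H ^ W"
      using C H1 a(3) by (intro mult_right_mono mult_left_mono) (auto simp: H_def)
    also have "\<dots> \<le> C * H powr (- real W - 1) * H ^ W"
      using C H1 w by (intro mult_right_mono mult_left_mono powr_mono) auto
    also have "\<dots> = C * (H powr (- real W - 1) * H powr real W)" using H1 by (simp add: powr_realpow)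
    also have "\<dots> = C * H powr (- 1)" by (simp flip: powr_add)
    also have "\<dots> = C / H" using H1 by (simp add: powr_minus divide_inverse)
    finally have "H \<le> C" using H1 by (simp add: pos_le_divide_eq)
    then show False using HC by simp
  qed
  then show ?thesis unfolding wstar_def W_def E_def m_def by (intro Sup_least) auto
qed

end

text \<open>Ensures that ln (ln 3) is positive, so that ln (ln (3d)) is bounded below by a positive
  constant for d \<ge> 1.\<close>

lemma ln_3_gt_1: "1 < ln (3::real)"
proof -
  have "exp (1/4 :: real) \<le> 1 + 1/4 + (1/4)\<^sup>2" by (rule exp_bound) auto
  then have "exp (1/4 :: real) ^ 4 \<le> (1 + 1/4 + (1/4)\<^sup>2) ^ 4" by (intro power_mono) auto
  also have "\<dots> < (3::real)" by (simp add: power_divide eval_nat_numeral)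
  also have "exp (1/4 :: real) ^ 4 = exp 1" by (simp flip: exp_of_nat_mult)
  finally have "exp (1::real) < 3" .
  then show ?thesis using ln_less_cancel_iff[of "exp 1" "3::real"] by simp
qed

text \<open>The least \<open>n1\<close> satisfies 2^n1 \<le> 4 n^2, so the whole expression is at
  most a constant times a power of d. The constant is below 2^g and is absorbed by the base 2d, and
  ln (ln (3d)) \<ge> ln (ln 3) turns the fixed exponent g + p into the required one.\<close>

lemma bound_arith:
  fixes R :: nat
  shows "\<exists>\<kappa>>0. \<forall>d\<ge>1. \<exists>n1. 2 * ((R + 2) * (3 * d + 4))\<^sup>2 < 2 ^ n1 \<and>
    real (2 * (((R + 2) * (3 * d + 4))\<^sup>2 * (3 * d + 4)) * 2 ^ (R * (n1 + 1 + n1)))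
      \<le> (2 * real d) powr (\<kappa> * ln (ln (3 * real d)))"
proof -
  define c where "c = 7 * (R + 2)"
  define C where "C = 2 * (c\<^sup>2 * 7) * (2 ^ R * (4 * c\<^sup>2) ^ (2 * R))"
  \<comment> \<open>The 3 comes from n^2 (3d + 4), the 4R from (2^n1)^(2R) with 2^n1 of order
    d^2.\<close>
  define p where "p = 3 + 4 * R"
  obtain g :: nat where g: "C < 2 ^ g" using less_exp by blast
  have ll: "0 < ln (ln (3::real))" using ln_3_gt_1 by simp
  define \<kappa> where "\<kappa> = real (g + p) / ln (ln 3)"
  have \<kappa>: "0 < \<kappa>" unfolding \<kappa>_def p_def using ll by (intro divide_pos_pos) auto
  have "\<exists>n1. 2 * ((R + 2) * (3 * d + 4))\<^sup>2 < 2 ^ n1 \<and>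
    real (2 * (((R + 2) * (3 * d + 4))\<^sup>2 * (3 * d + 4)) * 2 ^ (R * (n1 + 1 + n1)))
      \<le> (2 * real d) powr (\<kappa> * ln (ln (3 * real d)))" if d: "1 \<le> d" for d
  proof -
    define n where "n = (R + 2) * (3 * d + 4)"
    have nc: "n \<le> c * d" unfolding n_def c_def using d mult_le_mono2[of "3 * d + 4" "7 * d" "R + 2"] by (simp add: mult_ac)
    define n1 where "n1 = (LEAST j. 2 * n\<^sup>2 < 2 ^ j)"
    have "\<exists>j. 2 * n\<^sup>2 < 2 ^ j" using less_exp by blast
    then have n1: "2 * n\<^sup>2 < 2 ^ n1" unfolding n1_def by (rule LeastI_ex)
    have "n1 \<noteq> 0"
    proof
      assume "n1 = 0"
      then have "n\<^sup>2 = 0" using n1 by simp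
      then show False using d by (simp add: n_def)
    qed
    then have "\<not> 2 * n\<^sup>2 < 2 ^ (n1 - 1)" unfolding n1_def by (intro not_less_Least) (simp add: n1_def)
    then have "2 * 2 ^ (n1 - 1) \<le> 4 * n\<^sup>2" by simp
    also have "2 * 2 ^ (n1 - 1) = (2::nat) ^ n1" using \<open>n1 \<noteq> 0\<close> by (simp flip: power_Suc)
    finally have n2: "2 ^ n1 \<le> 4 * n\<^sup>2" .
    have ncs: "n\<^sup>2 \<le> (c * d)\<^sup>2" using nc by (intro power_mono) auto
    have "(2::nat) ^ (R * (n1 + 1 + n1)) = 2 ^ R * (2 ^ n1) ^ (2 * R)"
    proof -
      have "R * (n1 + 1 + n1) = R + n1 * (2 * R)" by (simp add: algebra_simps)
      then show ?thesis by (simp only: power_add power_mult)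
    qed
    also have "\<dots> \<le> 2 ^ R * (4 * (c * d)\<^sup>2) ^ (2 * R)"
    proof -
      have "2 ^ n1 \<le> 4 * (c * d)\<^sup>2" using n2 ncs by linarith
      then show ?thesis by (intro mult_left_mono power_mono) auto
    qed
    also have "\<dots> = 2 ^ R * (4 * c\<^sup>2) ^ (2 * R) * d ^ (4 * R)"
      by (simp add: power_mult_distrib flip: power_mult)
    finally have A: "(2::nat) ^ (R * (n1 + 1 + n1)) \<le> 2 ^ R * (4 * c\<^sup>2) ^ (2 * R) * d ^ (4 * R)" .
    have "2 * (n\<^sup>2 * (3 * d + 4)) * 2 ^ (R * (n1 + 1 + n1)) \<le>
      2 * ((c * d)\<^sup>2 * (7 * d)) * (2 ^ R * (4 * c\<^sup>2) ^ (2 * R) * d ^ (4 * R))"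
      using A ncs d by (intro mult_mono) auto
    also have "\<dots> = C * d ^ p"
      by (simp add: C_def p_def power_mult_distrib power_add power2_eq_square power3_eq_cube mult_ac)
    also have "\<dots> \<le> 2 ^ g * d ^ p" using g by (intro mult_right_mono) auto
    also have "\<dots> \<le> (2 * d) ^ g * (2 * d) ^ p" using d by (intro mult_mono power_mono) auto
    also have "\<dots> = (2 * d) ^ (g + p)" by (simp add: power_add)
    finally have "real (2 * (n\<^sup>2 * (3 * d + 4)) * 2 ^ (R * (n1 + 1 + n1))) \<le> real ((2 * d) ^ (g + p))"
      by (simp only: of_nat_le_iff)
    also have "\<dots> = (2 * real d) powr real (g + p)" using d by (simp add: powr_realpow del: of_nat_add)
    also have "\<dots> \<le> (2 * real d) powr (\<kappa> * ln (ln (3 * real d)))"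
    proof (rule powr_mono)
      have "ln 3 \<le> ln (3 * real d)" using d by (subst ln_le_cancel_iff) auto
      then have "ln (ln 3) \<le> ln (ln (3 * real d))" using ln_3_gt_1 by (subst ln_le_cancel_iff) auto
      then have "\<kappa> * ln (ln 3) \<le> \<kappa> * ln (ln (3 * real d))" using \<kappa> by (intro mult_left_mono) auto
      then show "real (g + p) \<le> \<kappa> * ln (ln (3 * real d))" using ll by (simp add: \<kappa>_def)
    qed (use d in auto)
    finally show ?thesis using n1 unfolding n_def by blast
  qed
  then show ?thesis using \<kappa> by blast
qed

theorem theorem2p7:
  fixes M :: int
  shows "\<exists>\<kappa>::real. 0 < \<kappa> \<and>
    (\<forall>(\<xi>::real) (\<theta>::real).
       sturmian_number \<theta> \<xi> \<longrightarrow>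
       (\<exists>N. \<forall>n\<ge>N. partial_quotient \<theta> n \<le> M) \<longrightarrow>
       (\<forall>d::nat. 1 \<le> d \<longrightarrow>
          wstar d \<xi> \<le> ereal ((2 * real d) powr (\<kappa> * ln (ln (3 * real d))))))"
proof -
  \<comment> \<open>The window length of \<open>mixed_windows\<close>; all later constants in the
    exponent depend on it only, hence on \<open>M\<close> only.\<close>
  define R where "R = nat M + 1"
  obtain \<kappa> where \<kappa>: "0 < \<kappa>" and bound: "\<And>d. 1 \<le> d \<Longrightarrow> \<exists>n1. 2 * ((R + 2) * (3 * d + 4))\<^sup>2 < 2 ^ n1 \<and>
    real (2 * (((R + 2) * (3 * d + 4))\<^sup>2 * (3 * d + 4)) * 2 ^ (R * (n1 + 1 + n1)))
      \<le> (2 * real d) powr (\<kappa> * ln (ln (3 * real d)))"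
    using bound_arith[of R] by blast
  have "wstar d \<xi> \<le> ereal ((2 * real d) powr (\<kappa> * ln (ln (3 * real d))))"
    if st: "sturmian_number \<theta> \<xi>" and pq: "\<forall>n\<ge>N. partial_quotient \<theta> n \<le> M" and d: "1 \<le> d" for \<xi> \<theta> N d
  proof -
    obtain b u v :: nat and t0 p0 where b: "2 \<le> b" "u < b" "v < b" "u \<noteq> v" "sturm_state \<theta> t0 p0"
      "(\<lambda>n. real (if wrd t0 n then v else u) / real b ^ Suc n) sums \<xi>"
      using sturmian_number_state[OF st] by blast
    interpret sturm_state \<theta> t0 p0 by (rule b(5))
    interpret sturm_num \<theta> t0 p0 b u v \<xi> by unfold_locales (use b in auto)
    obtain K where K: "\<And>k. K \<le> k \<Longrightarrow> mixed (map e [k..<k + R])"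
      using mixed_windows[OF pq] unfolding R_def by (auto simp: add.assoc)
    obtain n1 where n1: "2 * ((R + 2) * (3 * d + 4))\<^sup>2 < 2 ^ n1"
      "real (2 * (((R + 2) * (3 * d + 4))\<^sup>2 * (3 * d + 4)) * 2 ^ (R * (n1 + 1 + n1)))
      \<le> (2 * real d) powr (\<kappa> * ln (ln (3 * real d)))"
      using bound[OF d] by blast
    have "wstar d \<xi> \<le> ereal (real (2 * (((R + 2) * (3 * d + 4))\<^sup>2 * (3 * d + 4)) * 2 ^ (R * (n1 + 1 + n1))))"
      by (rule wstar_bound[of K R d _ n1]) (use K d n1 in auto)
    also have "\<dots> \<le> ereal ((2 * real d) powr (\<kappa> * ln (ln (3 * real d))))"
      using n1(2) by (simp only: ereal_less_eq)
    finally show ?thesis .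
  qed
  then show ?thesis using \<kappa> by blast
qed

end
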